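(* Let $f(x,y)\in\mathbb{C}[x,y]$ be a nonconstant complex polynomial. Assume that the complex algebraic curve $f(x,y)=0$ has $n$ branches at infinity counted without multiplicities. Then the polynomial $f$ has at most $n$ critical values at infinity different from $0$.
   Context: A complex number $\tau$ is called a critical value at infinity of a polynomial $f\in\mathbb{C}[x,y]$ if there exists a sequence of points $p_k\in\mathbb{C}^2$ such that $|p_k|\to\infty$, $\operatorname{grad} f(p_k)\to 0$ and $f(p_k)\to\tau$ as $k\to\infty$. Embed $\mathbb{C}^2$ in the projective plane $\mathbb{P}^2$ with homogeneous coordinates $X,Y,Z$ by $x=X/Z$, $y=Y/Z$; the line at infinity $L_\infty$ is $Z=0$. Let $C_0\subset\mathbb{P}^2$ be the projective closure of the curve $f(x,y)=0$, given by $Z^{\deg f}f(X/Z,Y/Z)=0$. The branches at infinity of the curve $f(x,y)=0$ are the branches (irreducible components) of the analytic curve germs $(C_0,P)$ for $P\in C_0\cap L_\infty$; counting without multiplicities means that each branch is counted once, even if it appears as a multiple component. *)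

theory Defs
  imports "HOL-Analysis.Analysis" "HOL-Computational_Algebra.Polynomial"
begin

text \<open>
  An element of $\mathbb{C}[x,y]$ is a \<^typ>\<open>complex poly poly\<close>: a polynomial in the (outer) variable
  $y$ whose coefficients are polynomials in the (inner) variable $x$. The coefficient of
  $x^i y^j$ in \<open>f\<close> is \<open>coeff (coeff f j) i\<close>.
\<close>

definition eval2 :: "complex poly poly \<Rightarrow> complex \<Rightarrow> complex \<Rightarrow> complex" where
  "eval2 f x y = poly (poly f [:y:]) x"

definition grad2 :: "complex poly poly \<Rightarrow> complex \<times> complex \<Rightarrow> complex \<times> complex" where
  "grad2 f = (\<lambda>(x, y). (eval2 (map_poly pderiv f) x y, eval2 (pderiv f) x y))"

definition critical_value_at_infinity :: "complex poly poly \<Rightarrow> complex \<Rightarrow> bool" where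
  "critical_value_at_infinity f \<tau> \<longleftrightarrow>
     (\<exists>p :: nat \<Rightarrow> complex \<times> complex.
        filterlim (\<lambda>k. norm (p k)) at_top sequentially \<and>
        (\<lambda>k. grad2 f (p k)) \<longlonglongrightarrow> 0 \<and>
        (\<lambda>k. eval2 f (fst (p k)) (snd (p k))) \<longlonglongrightarrow> \<tau>)"


section \<open>The projective closure\<close>

definition support2 :: "complex poly poly \<Rightarrow> (nat \<times> nat) set" where
  "support2 f = {(i, j). coeff (coeff f j) i \<noteq> 0}"

definition total_degree2 :: "complex poly poly \<Rightarrow> nat" where
  "total_degree2 f = Max ((\<lambda>(i, j). i + j) ` support2 f)"

definition homogenize2 :: "complex poly poly \<Rightarrow> complex \<Rightarrow> complex \<Rightarrow> complex \<Rightarrow> complex" where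
  "homogenize2 f X Y Z =
     (\<Sum>(i, j)\<in>support2 f. coeff (coeff f j) i * X ^ i * Y ^ j * Z ^ (total_degree2 f - (i + j)))"

lemma support2_subset:
  "support2 f \<subseteq> prod.swap ` (SIGMA j:{..degree f}. {..degree (coeff f j)})"
proof clarify
  fix i j assume "(i, j) \<in> support2 f"
  then have *: "coeff (coeff f j) i \<noteq> 0" by (simp add: support2_def)
  then have "coeff f j \<noteq> 0" by auto
  with * have "(j, i) \<in> (SIGMA j:{..degree f}. {..degree (coeff f j)})"
    by (simp add: le_degree)
  then show "(i, j) \<in> prod.swap ` (SIGMA j:{..degree f}. {..degree (coeff f j)})"
    by force
qed

lemma finite_support2: "finite (support2 f)"
  by (rule finite_subset[OF support2_subset]) auto

lemma eval2_altdef: "eval2 f x y = (\<Sum>(i, j)\<in>support2 f. coeff (coeff f j) i * x ^ i * y ^ j)"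
proof -
  let ?S = "SIGMA j:{..degree f}. {..degree (coeff f j)}"
  have "eval2 f x y = (\<Sum>j\<le>degree f. poly (coeff f j) x * y ^ j)"
    by (simp add: eval2_def poly_altdef[of f] poly_sum poly_power)
  also have "\<dots> = (\<Sum>(j, i)\<in>?S. coeff (coeff f j) i * x ^ i * y ^ j)"
    by (simp add: poly_altdef sum_distrib_right sum.Sigma)
  also have "\<dots> = (\<Sum>(i, j)\<in>prod.swap ` ?S. coeff (coeff f j) i * x ^ i * y ^ j)"
    by (subst sum.reindex) (auto simp: case_prod_unfold)
  also have "\<dots> = (\<Sum>(i, j)\<in>support2 f. coeff (coeff f j) i * x ^ i * y ^ j)"
    using support2_subset by (intro sum.mono_neutral_right) (auto simp: support2_def)
  finally show ?thesis .
qed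

lemma homogenize2_eq:
  assumes "Z \<noteq> 0"
  shows "homogenize2 f X Y Z = Z ^ total_degree2 f * eval2 f (X / Z) (Y / Z)"
proof -
  have "Z ^ (total_degree2 f - (i + j)) = Z ^ total_degree2 f / (Z ^ i * Z ^ j)"
    if "(i, j) \<in> support2 f" for i j
  proof -
    have "i + j \<le> total_degree2 f"
      unfolding total_degree2_def using that by (intro Max_ge) (auto simp: finite_support2)
    then show ?thesis
      using assms by (simp add: power_diff power_add)
  qed
  then show ?thesis
    unfolding homogenize2_def eval2_altdef sum_distrib_left
    by (intro sum.cong) (auto simp: power_divide)
qed

text \<open>Points of $\mathbb{P}^2$ are represented by the punctured lines $[X:Y:Z]$ through the
  origin in $\mathbb{C}^3$.\<close>

type_synonym proj_point = "(complex \<times> complex \<times> complex) set"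

definition proj :: "complex \<Rightarrow> complex \<Rightarrow> complex \<Rightarrow> proj_point" where
  "proj X Y Z = {(c * X, c * Y, c * Z) | c. c \<noteq> 0}"

definition line_at_infinity :: "proj_point set" where
  "line_at_infinity = {proj X Y 0 | X Y. (X, Y) \<noteq> (0, 0)}"

definition proj_closure :: "complex poly poly \<Rightarrow> proj_point set" where
  "proj_closure f = {proj X Y Z | X Y Z. (X, Y, Z) \<noteq> (0, 0, 0) \<and> homogenize2 f X Y Z = 0}"

text \<open>An affine chart of $\mathbb{P}^2$ whose image contains the given point.\<close>

definition proj_chart :: "proj_point \<Rightarrow> complex \<times> complex \<Rightarrow> proj_point" where
  "proj_chart P =
     (if P \<in> range (\<lambda>(u, v). proj 1 u v) then (\<lambda>(u, v). proj 1 u v)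
      else if P \<in> range (\<lambda>(u, v). proj u 1 v) then (\<lambda>(u, v). proj u 1 v)
      else (\<lambda>(u, v). proj u v 1))"


section \<open>Germs of analytic sets in $\mathbb{C}^2$\<close>

definition holomorphic2_on :: "(complex \<times> complex \<Rightarrow> complex) \<Rightarrow> (complex \<times> complex) set \<Rightarrow> bool" where
  "holomorphic2_on g U \<longleftrightarrow>
     (\<forall>z\<in>U. \<exists>a b. (g has_derivative (\<lambda>(h, k). a * h + b * k)) (at z))"

definition germ_le ::
    "complex \<times> complex \<Rightarrow> (complex \<times> complex) set \<Rightarrow> (complex \<times> complex) set \<Rightarrow> bool" where
  "germ_le p S T \<longleftrightarrow> (\<forall>\<^sub>F z in nhds p. z \<in> S \<longrightarrow> z \<in> T)"

definition germ_eq ::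
    "complex \<times> complex \<Rightarrow> (complex \<times> complex) set \<Rightarrow> (complex \<times> complex) set \<Rightarrow> bool" where
  "germ_eq p S T \<longleftrightarrow> (\<forall>\<^sub>F z in nhds p. z \<in> S \<longleftrightarrow> z \<in> T)"

definition germ :: "complex \<times> complex \<Rightarrow> (complex \<times> complex) set \<Rightarrow> (complex \<times> complex) set set" where
  "germ p S = {T. germ_eq p S T}"

definition analytic_at :: "complex \<times> complex \<Rightarrow> (complex \<times> complex) set \<Rightarrow> bool" where
  "analytic_at p S \<longleftrightarrow>
     (\<exists>U G. open U \<and> p \<in> U \<and> finite G \<and> (\<forall>g\<in>G. holomorphic2_on g U) \<and>
            S \<inter> U = {z \<in> U. \<forall>g\<in>G. g z = 0})"

text \<open>The condition \<open>p \<in> S\<close> says that the germ is not empty, analytic sets being locally closed.\<close>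

definition irreducible_at :: "complex \<times> complex \<Rightarrow> (complex \<times> complex) set \<Rightarrow> bool" where
  "irreducible_at p S \<longleftrightarrow>
     analytic_at p S \<and> p \<in> S \<and>
     (\<forall>A B. analytic_at p A \<and> analytic_at p B \<and> germ_eq p S (A \<union> B) \<longrightarrow>
            germ_eq p S A \<or> germ_eq p S B)"

text \<open>The irreducible components are the maximal irreducible analytic subgerms. As set germs they
  carry no multiplicities.\<close>

definition irreducible_components_at ::
    "complex \<times> complex \<Rightarrow> (complex \<times> complex) set \<Rightarrow> (complex \<times> complex) set set set" where
  "irreducible_components_at p S =
     {germ p T | T. irreducible_at p T \<and> germ_le p T S \<and>
        (\<forall>T'. irreducible_at p T' \<and> germ_le p T T' \<and> germ_le p T' S \<longrightarrow> germ_eq p T T')}"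


section \<open>Branches at infinity\<close>

definition branches_at :: "proj_point \<Rightarrow> proj_point set \<Rightarrow> (complex \<times> complex) set set set" where
  "branches_at P C = irreducible_components_at (inv (proj_chart P) P) (proj_chart P -` C)"

definition branches_at_infinity ::
    "complex poly poly \<Rightarrow> (proj_point \<times> (complex \<times> complex) set set) set" where
  "branches_at_infinity f =
     (SIGMA P : proj_closure f \<inter> line_at_infinity. branches_at P (proj_closure f))"

end

theory Submission
  imports Defs "HOL-Complex_Analysis.Complex_Analysis"
    "HOL-Computational_Algebra.Computational_Algebra" "HOL-Computational_Algebra.Field_as_Ring"
    "HOL-Combinatorics.Cycles"
begin

text \<open>
  After a shear \<open>f\<close> is monic in \<open>y\<close> of degree \<open>deg f\<close>. Near \<open>x = \<infinity>\<close>, the roots of \<open>f (x, _)\<close> and of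
  \<open>f\<^sub>y (x, _)\<close> are Puiseux series in \<open>t = x powr (- 1 / N)\<close>; the orbits of the roots of \<open>f\<close> under
  the monodromy \<open>t \<mapsto> \<zeta> t\<close> are the branches at infinity. Rescaling around a point of a critical
  sequence shows that a critical value \<open>\<tau> \<noteq> 0\<close> at infinity is the limit of \<open>f\<close> along some root \<open>\<gamma>\<close>
  of \<open>f\<^sub>y\<close>. If \<open>t ^ h\<close> is the order of the distance from \<open>\<gamma>\<close> to the nearest roots of \<open>f\<close>, then
  \<open>f (x, \<gamma> + z t ^ h)\<close> tends to a polynomial \<open>F z\<close> of which \<open>\<tau>\<close> is a critical value and whose roots
  are the leading coefficients of those nearest roots. \<open>F\<close> is invariant under the finite group of
  affine maps induced by the monodromy that preserves this cluster of roots. As \<open>F\<close> has fewer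
  critical points outside its zero set than roots, it has at most as many nonzero critical values
  as there are group orbits of roots, that is, as there are branches in the cluster. Different
  clusters are disjoint, so the critical values are bounded by the branches.
\<close>

section \<open>Critical values of polynomials with affine symmetries\<close>

text \<open>The shear makes the coefficient of y^d constant. So the roots grow at most linearly in
  x, which makes t^N times a root extend holomorphically over t = 0, and along a critical sequence
  the nearest root of f (x, _) stays at bounded distance. At bounded distance a small f_y forces
  either a small value of f or a critical point of f (x, _) with almost the same value; since \<tau>
  is nonzero, it is the second. Counting critical points of a limit polynomial F alone would bound
  the values by the Puiseux roots, that is, by branches counted once per conjugate. Dividing by a
  symmetry group of order m repairs this, with one obstacle: a critical fibre of F may contain a
  fixed point and have fewer than m points. There is at most one such fibre, and the strict
  inequality between critical points and roots pays for it: 1 + m (#T - 1) \<le> #critical points <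
  #roots \<le> m #R. The hypothesis \<tau> \<noteq> 0 also keeps F nonconstant: F 0 = \<tau>, while
  F has a root. For \<tau> = 0 the limit would vanish identically.\<close>

lemma sum_order_complex:
  fixes p :: "complex poly"
  assumes "p \<noteq> 0" "finite A" "{z. poly p z = 0} \<subseteq> A"
  shows "(\<Sum>z\<in>A. order z p) = degree p"
proof -
  have "degree p = size (proots p)" by (simp add: size_proots_complex)
  also have "\<dots> = (\<Sum>z\<in>set_mset (proots p). order z p)"
    using assms(1) by (simp add: size_multiset_overloaded_eq)
  also have "\<dots> = (\<Sum>z\<in>A. order z p)"
    using assms by (intro sum.mono_neutral_left) (auto simp: order_root)
  finally show ?thesis ..
qed

lemma card_critical_points_less:
  fixes p :: "complex poly"
  assumes "degree p > 0"
  shows "finite {z. poly p z \<noteq> 0 \<and> poly (pderiv p) z = 0}"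
    and "card {z. poly p z \<noteq> 0 \<and> poly (pderiv p) z = 0} < card {z. poly p z = 0}"
proof -
  let ?C = "{z. poly p z \<noteq> 0 \<and> poly (pderiv p) z = 0}" and ?Z = "{z. poly p z = 0}"
  have p0: "p \<noteq> 0" and p'0: "pderiv p \<noteq> 0"
    using assms by (auto simp: pderiv_eq_0_iff)
  have finZ: "finite ?Z" using p0 by (simp add: poly_roots_finite)
  show finC: "finite ?C"
    using poly_roots_finite[OF p'0] by (rule rev_finite_subset) auto
  have "degree p - 1 = (\<Sum>z\<in>?Z \<union> ?C. order z (pderiv p))"
    using finZ finC p'0 by (subst sum_order_complex) (auto simp: degree_pderiv)
  also have "\<dots> = (\<Sum>z\<in>?Z. order z (pderiv p)) + (\<Sum>z\<in>?C. order z (pderiv p))"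
    using finZ finC by (intro sum.union_disjoint) auto
  finally have 1: "degree p - 1 = \<dots>" .
  have 2: "card ?C \<le> (\<Sum>z\<in>?C. order z (pderiv p))"
  proof -
    have "(\<Sum>z\<in>?C. 1) \<le> (\<Sum>z\<in>?C. order z (pderiv p))"
      using p'0 by (intro sum_mono) (use order_root[of "pderiv p"] in \<open>auto simp: Suc_le_eq\<close>)
    then show ?thesis by simp
  qed
  have "degree p = (\<Sum>z\<in>?Z. order z p)"
    using finZ p0 by (subst sum_order_complex) auto
  also have "\<dots> = (\<Sum>z\<in>?Z. Suc (order z (pderiv p)))"
    using p0 p'0 by (intro sum.cong refl order_pderiv) (auto simp: order_root)
  also have "\<dots> = (\<Sum>z\<in>?Z. order z (pderiv p)) + card ?Z"
    by (simp add: Suc_eq_plus1 sum.distrib del: One_nat_def add_Suc_right)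
  finally show "card ?C < card ?Z" using 1 2 assms by linarith
qed

text \<open>A nontrivial affine symmetry has at most one fixed point, and commuting ones share it; hence
  all but one of the critical fibres consist of at least \<open>card \<A>\<close> points.\<close>

lemma card_critical_values_le:
  fixes p :: "complex poly" and \<A> :: "(complex \<Rightarrow> complex) set"
  assumes deg: "degree p > 0" and fin: "finite \<A>"
    and affine: "\<And>A. A \<in> \<A> \<Longrightarrow> \<exists>a b. a \<noteq> 0 \<and> A = (\<lambda>z. a * z + b)"
    and inv: "\<And>A z. A \<in> \<A> \<Longrightarrow> poly p (A z) = poly p z"
    and comm: "\<And>A B. A \<in> \<A> \<Longrightarrow> B \<in> \<A> \<Longrightarrow> A \<circ> B = B \<circ> A"
    and comp: "\<And>A B. A \<in> \<A> \<Longrightarrow> B \<in> \<A> \<Longrightarrow> A \<circ> B \<in> \<A>"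
    and inverse: "\<And>A. A \<in> \<A> \<Longrightarrow> \<exists>B\<in>\<A>. B \<circ> A = id"
    and R: "finite R" "{z. poly p z = 0} \<subseteq> (\<Union>z\<in>R. (\<lambda>A. A z) ` \<A>)"
    and T: "\<And>\<tau>. \<tau> \<in> T \<Longrightarrow> \<exists>z. poly p z = \<tau> \<and> \<tau> \<noteq> 0 \<and> poly (pderiv p) z = 0"
  shows "finite T \<and> card T \<le> card R"
proof -
  define C where "C = {z. poly p z \<noteq> 0 \<and> poly (pderiv p) z = 0}"
  define fib where "fib \<tau> = {z \<in> C. poly p z = \<tau>}" for \<tau>
  note C = card_critical_points_less[OF deg, folded C_def]
  define m where "m = card \<A>"
  \<comment> \<open>Differentiating p (a z + b) = p z gives a p' (a z + b) = p' z.\<close>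
  have Cinv: "A z \<in> C" if "A \<in> \<A>" "z \<in> C" for A z
  proof -
    obtain a b where ab: "a \<noteq> 0" "A = (\<lambda>z. a * z + b)" using affine[OF \<open>A \<in> \<A>\<close>] by blast
    have "poly (pcompose p [:b, a:]) w = poly p w" for w
      using inv[OF \<open>A \<in> \<A>\<close>, of w] ab(2) by (simp add: poly_pcompose mult.commute add.commute)
    then have "pcompose p [:b, a:] = p"
      by (simp add: poly_eq_poly_eq_iff[symmetric] fun_eq_iff)
    then have "pcompose (pderiv p) [:b, a:] * [:a:] = pderiv p"
      by (metis pderiv_pcompose pderiv_pCons pderiv_0 pCons_0_0 add.right_neutral)
    then have "poly (pcompose (pderiv p) [:b, a:] * [:a:]) z = 0"
      using that by (simp add: C_def)
    then have "poly (pderiv p) (A z) = 0"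
      using ab by (simp add: poly_pcompose mult.commute add.commute)
    then show ?thesis using that inv by (simp add: C_def)
  qed
  have finfib: "finite (fib \<tau>)" for \<tau> using C(1) by (simp add: fib_def)
  have fibne: "fib \<tau> \<noteq> {}" if "\<tau> \<in> T" for \<tau> using T[OF that] by (auto simp: fib_def C_def)
  \<comment> \<open>In a fibre with fewer than \<open>m\<close> points two symmetries
    \<open>A\<close>, \<open>B\<close> agree at some \<open>z\<close>, and the inverse of
    \<open>B\<close> composed with \<open>A\<close> is a nontrivial symmetry fixing
    \<open>z\<close>. Its linear coefficient is not 1, so \<open>z\<close> is its only fixed
    point.\<close>
  have fixedpt: "\<exists>z\<in>fib \<tau>. \<exists>D\<in>\<A>. D z = z \<and> (\<forall>w. D w = w \<longrightarrow> w = z)"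
    if t: "\<tau> \<in> T" "card (fib \<tau>) < m" for \<tau>
  proof -
    obtain z where z: "z \<in> fib \<tau>" using fibne[OF t(1)] by blast
    have "(\<lambda>A. A z) ` \<A> \<subseteq> fib \<tau>"
      using z Cinv inv by (auto simp: fib_def)
    then have "\<not> inj_on (\<lambda>A. A z) \<A>"
      using t(2) finfib card_inj_on_le[of "\<lambda>A. A z" \<A> "fib \<tau>"] by (auto simp: m_def)
    then obtain A B where AB: "A \<in> \<A>" "B \<in> \<A>" "A \<noteq> B" "A z = B z" by (auto simp: inj_on_def)
    obtain B' where B': "B' \<in> \<A>" "B' \<circ> B = id" using inverse AB by blast
    define D where "D = B' \<circ> A"
    have D: "D \<in> \<A>" "D z = z"
      using AB B' comp by (auto simp: D_def fun_eq_iff)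
    have "D \<noteq> id"
    proof
      assume "D = id"
      then have "B \<circ> (B' \<circ> A) = B" by (simp add: D_def)
      moreover have "B \<circ> B' = id" using comm[OF AB(2) B'(1)] B' by simp
      ultimately show False using AB by (simp add: comp_assoc[symmetric])
    qed
    obtain a b where ab: "a \<noteq> 0" "D = (\<lambda>z. a * z + b)" using affine[OF D(1)] by blast
    have "a \<noteq> 1"
    proof
      assume "a = 1"
      then have "D = id" using D(2) ab by (auto simp: fun_eq_iff)
      with \<open>D \<noteq> id\<close> show False by simp
    qed
    have "w = z" if "D w = w" for w
    proof -
      have "(a - 1) * (w - z) = (D w - w) - (D z - z)" unfolding ab(2) by (simp add: algebra_simps)
      then have "(a - 1) * (w - z) = 0" using that D(2) by simp
      then show ?thesis using \<open>a \<noteq> 1\<close> by simp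
    qed
    then show ?thesis using z D by blast
  qed
  have one: "\<tau> = \<tau>'" if t: "\<tau> \<in> T" "card (fib \<tau>) < m" "\<tau>' \<in> T" "card (fib \<tau>') < m" for \<tau> \<tau>'
  proof -
    obtain z D where z: "z \<in> fib \<tau>" "D \<in> \<A>" "D z = z" "\<And>w. D w = w \<Longrightarrow> w = z"
      using fixedpt[OF t(1,2)] by blast
    obtain z' D' where z': "z' \<in> fib \<tau>'" "D' \<in> \<A>" "D' z' = z'" "\<And>w. D' w = w \<Longrightarrow> w = z'"
      using fixedpt[OF t(3,4)] by blast
    have "D (D' z) = D' (D z)" using comm[OF z(2) z'(2)] by (simp add: fun_eq_iff)
    then have "D (D' z) = D' z" by (simp only: z(3))
    then have "D' z = z" by (rule z(4))
    then have "z = z'" by (rule z'(4))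
    then show ?thesis using z(1) z'(1) by (simp add: fib_def)
  qed
  have "T \<subseteq> poly p ` C" using T by (auto simp: C_def)
  then have finT: "finite T" using C(1) finite_subset by blast
  have roots: "card {z. poly p z = 0} \<le> m * card R"
  proof -
    have "card {z. poly p z = 0} \<le> card (\<Union>z\<in>R. (\<lambda>A. A z) ` \<A>)"
      using R fin by (intro card_mono) auto
    also have "\<dots> \<le> (\<Sum>z\<in>R. card ((\<lambda>A. A z) ` \<A>))" using R(1) by (rule card_UN_le)
    also have "\<dots> \<le> (\<Sum>z\<in>R. m)" unfolding m_def by (intro sum_mono card_image_le fin)
    finally show ?thesis by (simp add: mult.commute)
  qed
  have "card T \<le> card R"
  proof (cases "T = {}")
    case False
    obtain \<tau>0 where \<tau>0: "\<tau>0 \<in> T" "\<And>\<tau>. \<tau> \<in> T - {\<tau>0} \<Longrightarrow> m \<le> card (fib \<tau>)"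
      using one False by (metis DiffE ex_in_conv insert_iff leI)
    have "card (fib \<tau>0) \<ge> 1"
      using fibne[OF \<tau>0(1)] finfib by (simp add: Suc_le_eq card_gt_0_iff)
    moreover have "(\<Sum>\<tau>\<in>T - {\<tau>0}. m) \<le> (\<Sum>\<tau>\<in>T - {\<tau>0}. card (fib \<tau>))"
      by (intro sum_mono \<tau>0)
    ultimately have "1 + m * (card T - 1) \<le> (\<Sum>\<tau>\<in>T. card (fib \<tau>))"
      using \<tau>0(1) finT by (simp add: sum.remove card_Diff_singleton mult.commute)
    also have "\<dots> = card (\<Union>\<tau>\<in>T. fib \<tau>)"
      using finT finfib by (intro card_UN_disjoint[symmetric]) (auto simp: fib_def)
    also have "\<dots> \<le> card C" using C(1) by (intro card_mono) (auto simp: fib_def)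
    also have "\<dots> < m * card R" using C(2) roots by linarith
    finally have "m * (card T - 1) < m * card R" by linarith
    then have "card T - 1 < card R" by simp
    then show ?thesis by linarith
  qed simp
  with finT show ?thesis by simp
qed

section \<open>Clusters of Puiseux roots\<close>

lemma tendsto_at_0_rotate:
  fixes f :: "complex \<Rightarrow> 'a :: topological_space"
  assumes "(f \<longlongrightarrow> l) (at 0)" "\<omega> \<noteq> 0"
  shows "((\<lambda>t. f (\<omega> * t)) \<longlongrightarrow> l) (at 0)"
proof (rule filterlim_compose[OF assms(1)])
  have "((\<lambda>t. \<omega> * t) \<longlongrightarrow> \<omega> * 0) (at 0)" by (intro tendsto_intros)
  moreover have "\<forall>\<^sub>F t in at 0. \<omega> * t \<noteq> 0"
    using assms(2) by (auto simp: eventually_at_filter)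
  ultimately show "filterlim (\<lambda>t. \<omega> * t) (at 0) (at 0)"
    by (simp add: filterlim_at)
qed

text \<open>The logarithmic derivative of a product of linear factors. Coefficients
  \<open>b i\<close> = 0 are allowed because in the limit polynomials some roots have moved to
  infinity.\<close>

lemma poly_pderiv_prod_linear:
  fixes a b :: "'i \<Rightarrow> complex" and e :: "'i \<Rightarrow> nat"
  assumes "finite A" "\<And>i. i \<in> A \<Longrightarrow> e i > 0 \<Longrightarrow> a i + b i * z \<noteq> 0"
  shows "poly (pderiv (\<Prod>i\<in>A. [:a i, b i:] ^ e i)) z =
    (\<Prod>i\<in>A. (a i + b i * z) ^ e i) * (\<Sum>i\<in>A. of_nat (e i) * (b i / (a i + b i * z)))"
  using assms
proof (induction A rule: finite_induct)
  case (insert i A)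
  have "poly (pderiv ([:a i, b i:] ^ e i)) z =
      (a i + b i * z) ^ e i * (of_nat (e i) * (b i / (a i + b i * z)))"
  proof (cases "e i")
    case (Suc n)
    then have "a i + b i * z \<noteq> 0" using insert.prems[of i] by simp
    then show ?thesis using Suc
      by (simp add: pderiv_power_Suc pderiv_pCons mult_ac divide_simps del: power_Suc)
         (simp add: power_Suc mult_ac)
  qed simp
  then show ?case
    using insert by (simp add: pderiv_mult poly_prod algebra_simps)
qed simp

text \<open>The data of a polynomial in \<open>\<mu>\<close> whose distinct critical points and roots are
  convergent Puiseux series: \<open>t\<close> is an \<open>N\<close>-th root of the uniformizer, \<open>e l\<close> is the
  multiplicity of \<open>\<psi> l\<close> as a root (so that \<open>e l = 0\<close> means a critical point off the zero set)
  and \<open>\<sigma>\<close> is the monodromy permutation.\<close>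

locale root_system =
  fixes W :: "'i set" and \<psi> :: "'i \<Rightarrow> complex \<Rightarrow> complex" and e :: "'i \<Rightarrow> nat" and \<sigma> :: "'i \<Rightarrow> 'i"
    and N M :: nat and \<zeta> c :: complex and \<rho> :: real
  assumes finW: "finite W" and Wpos: "\<exists>l\<in>W. e l > 0"
    and Npos: "N > 0" and \<zeta>N: "\<zeta> ^ N = 1" and NM: "N dvd M"
    and \<sigma>bij: "bij_betw \<sigma> W W" and \<sigma>N: "\<And>l. l \<in> W \<Longrightarrow> (\<sigma> ^^ N) l = l"
    and \<rho>: "\<rho> > 0"
    and \<psi>\<sigma>: "\<And>l t. l \<in> W \<Longrightarrow> norm t < \<rho> \<Longrightarrow> \<psi> (\<sigma> l) t = \<psi> l (\<zeta> * t)"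
    and e\<sigma>: "\<And>l. l \<in> W \<Longrightarrow> e (\<sigma> l) = e l"
    and \<psi>neq: "\<And>l l' t. l \<in> W \<Longrightarrow> l' \<in> W \<Longrightarrow> l \<noteq> l' \<Longrightarrow> t \<noteq> 0 \<Longrightarrow> norm t < \<rho> \<Longrightarrow> \<psi> l t \<noteq> \<psi> l' t"
    and \<psi>diff: "\<And>l l'. l \<in> W \<Longrightarrow> l' \<in> W \<Longrightarrow> l \<noteq> l' \<Longrightarrow>
       \<exists>n a. a \<noteq> 0 \<and> ((\<lambda>t. (\<psi> l t - \<psi> l' t) / t ^ n) \<longlongrightarrow> a) (at 0)"
    and crit: "\<And>l t. l \<in> W \<Longrightarrow> e l = 0 \<Longrightarrow> t \<noteq> 0 \<Longrightarrow> norm t < \<rho> \<Longrightarrow>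
       (\<Sum>i\<in>W. of_nat (e i) / (\<psi> l t - \<psi> i t)) = 0"
begin

definition I where "I = {l \<in> W. e l > 0}"

text \<open>When \<open>M\<close> is \<open>N\<close> times the sum of the \<open>e l\<close>, this
  is the value at x = 1 / t^N, y = \<mu> / t^N of a polynomial with leading coefficient
  \<open>c\<close> in y and roots \<psi> l t / t^N. So \<mu> stands for y / x.\<close>

definition G :: "complex \<Rightarrow> complex \<Rightarrow> complex" where
  "G t \<mu> = c / t ^ M * (\<Prod>l\<in>W. (\<mu> - \<psi> l t) ^ e l)"

definition orb :: "'i \<Rightarrow> 'i set" where "orb i = {(\<sigma> ^^ k) i | k. True}"

definition good :: "'i \<Rightarrow> complex \<Rightarrow> bool" where
  "good j \<tau> \<longleftrightarrow> j \<in> W \<and> e j = 0 \<and> \<tau> \<noteq> 0 \<and> ((\<lambda>t. G t (\<psi> j t)) \<longlongrightarrow> \<tau>) (at 0)"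

text \<open>Rescaling by \<open>t ^ h\<close> around \<open>\<psi> j\<close> keeps the nearest roots at finite nonzero distance
  \<open>- 1 / \<kappa> i\<close> and moves the other ones to infinity (\<open>\<kappa> i = 0\<close>).\<close>

definition scale :: "'i \<Rightarrow> nat \<Rightarrow> ('i \<Rightarrow> complex) \<Rightarrow> bool" where
  "scale j h \<kappa> \<longleftrightarrow> (\<forall>i\<in>I. ((\<lambda>t. t ^ h / (\<psi> j t - \<psi> i t)) \<longlongrightarrow> \<kappa> i) (at 0)) \<and>
     (\<exists>i\<in>I. \<kappa> i \<noteq> 0) \<and> (\<forall>i. i \<notin> I \<longrightarrow> \<kappa> i = 0)"

text \<open>The nearest roots. The existential hides no choice: by \<open>scale_unique\<close>,
  \<open>j\<close> determines \<open>h\<close> and \<open>\<kappa>\<close>.\<close>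

definition cluster :: "'i \<Rightarrow> 'i set" where "cluster j = {i. \<exists>h \<kappa>. scale j h \<kappa> \<and> \<kappa> i \<noteq> 0}"

text \<open>Each factor is normalised to 1 at the origin, so the value there is
  \<open>\<tau>\<close>. The roots are the points - 1 / \<open>\<kappa> i\<close>; a root sent to
  infinity contributes the factor 1.\<close>

definition limit_poly :: "complex \<Rightarrow> ('i \<Rightarrow> complex) \<Rightarrow> complex poly" where
  "limit_poly \<tau> \<kappa> = smult \<tau> (\<Prod>i\<in>I. [:1, \<kappa> i:] ^ e i)"

lemma finI: "finite I" using finW by (simp add: I_def)
lemma I_W: "i \<in> I \<Longrightarrow> i \<in> W" by (simp add: I_def)
lemma I_ne: "I \<noteq> {}" using Wpos by (auto simp: I_def)
lemma eI: "j \<in> W \<Longrightarrow> e j = 0 \<Longrightarrow> j \<notin> I" by (simp add: I_def)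

lemma ev_small: "\<forall>\<^sub>F t in at 0. t \<noteq> 0 \<and> norm t < \<rho>"
  using \<rho> by (auto simp: eventually_at intro!: exI[of _ \<rho>])

section \<open>Monodromy on the indices and on the parameter\<close>

lemma norm_\<zeta>: "norm (\<zeta> ^ k) = 1"
proof -
  have "(norm \<zeta>) ^ N = 1" using \<zeta>N by (simp flip: norm_power)
  then have "norm \<zeta> = 1" using Npos power_eq_1_iff[of "norm \<zeta>" N] by auto
  then show ?thesis by (simp add: norm_power)
qed

lemma \<zeta>_nonzero: "\<zeta> ^ k \<noteq> 0" by (metis norm_\<zeta> norm_zero zero_neq_one)

lemma \<zeta>_neq0 [simp]: "\<zeta> \<noteq> 0" using \<zeta>_nonzero[of 1] by simp

lemma \<sigma>pow_bij: "bij_betw (\<sigma> ^^ k) W W"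
proof (induction k)
  case (Suc k)
  then show ?case using bij_betw_trans[OF Suc \<sigma>bij] by (simp add: comp_def)
qed (simp add: bij_betw_id[unfolded id_def])

lemma \<sigma>pow_W: "l \<in> W \<Longrightarrow> (\<sigma> ^^ k) l \<in> W"
  using \<sigma>pow_bij bij_betwE by blast

lemma e_\<sigma>pow: "l \<in> W \<Longrightarrow> e ((\<sigma> ^^ k) l) = e l"
  by (induction k) (auto simp: e\<sigma> \<sigma>pow_W)

lemma \<sigma>pow_I: "l \<in> I \<Longrightarrow> (\<sigma> ^^ k) l \<in> I"
  by (simp add: I_def \<sigma>pow_W e_\<sigma>pow)

lemma \<psi>_\<sigma>pow: "l \<in> W \<Longrightarrow> norm t < \<rho> \<Longrightarrow> \<psi> ((\<sigma> ^^ k) l) t = \<psi> l (\<zeta> ^ k * t)"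
proof (induction k arbitrary: t)
  case (Suc k)
  have "norm (\<zeta> * t) < \<rho>" using Suc.prems norm_\<zeta>[of 1] by (simp add: norm_mult)
  then show ?case using Suc by (simp add: \<psi>\<sigma> \<sigma>pow_W mult_ac)
qed simp

lemma \<sigma>pow_mult_N: "l \<in> W \<Longrightarrow> (\<sigma> ^^ (k * N)) l = l"
  by (induction k) (auto simp: funpow_add \<sigma>N)

lemma \<sigma>pow_mod: "l \<in> W \<Longrightarrow> (\<sigma> ^^ (k mod N)) l = (\<sigma> ^^ k) l"
  by (metis \<sigma>pow_mult_N comp_apply funpow_add mod_div_mult_eq)

lemma \<zeta>pow_mod: "\<zeta> ^ (k mod N) = \<zeta> ^ k"
  by (metis \<zeta>N mult.commute mult_1 mult_div_mod_eq power_add power_mult power_one)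

lemma \<sigma>pow_I_surj:
  assumes "i \<in> I" shows "\<exists>i'\<in>I. (\<sigma> ^^ k) i' = i"
proof -
  obtain i' where "i' \<in> W" "(\<sigma> ^^ k) i' = i"
    using bij_betw_imp_surj_on[OF \<sigma>pow_bij[of k]] I_W[OF assms] by (metis imageE)
  then show ?thesis using assms e_\<sigma>pow[of i' k] by (auto simp: I_def)
qed

text \<open>Rotating t permutes the roots together with their multiplicities, and t^M is unchanged
  because \<open>N\<close> divides \<open>M\<close>.\<close>

lemma G_rotate:
  assumes "norm t < \<rho>"
  shows "G (\<zeta> ^ k * t) \<mu> = G t \<mu>"
proof -
  have "(\<zeta> ^ k) ^ M = 1"
    using NM \<zeta>N by (metis (no_types, lifting) dvdE mult.commute power_mult power_one)
  moreover have "(\<Prod>l\<in>W. (\<mu> - \<psi> l (\<zeta> ^ k * t)) ^ e l) = (\<Prod>l\<in>W. (\<mu> - \<psi> l t) ^ e l)"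
  proof -
    have "(\<Prod>l\<in>W. (\<mu> - \<psi> l (\<zeta> ^ k * t)) ^ e l) =
        (\<Prod>l\<in>W. (\<mu> - \<psi> ((\<sigma> ^^ k) l) t) ^ e ((\<sigma> ^^ k) l))"
      using assms by (intro prod.cong) (auto simp: \<psi>_\<sigma>pow e_\<sigma>pow)
    also have "\<dots> = (\<Prod>l\<in>W. (\<mu> - \<psi> l t) ^ e l)"
      using \<sigma>pow_bij by (rule prod.reindex_bij_betw)
    finally show ?thesis .
  qed
  ultimately show ?thesis by (simp add: G_def power_mult_distrib)
qed

lemma good_rotate:
  assumes "good j \<tau>" shows "good ((\<sigma> ^^ k) j) \<tau>"
proof -
  have j: "j \<in> W" "e j = 0" "\<tau> \<noteq> 0" "((\<lambda>t. G t (\<psi> j t)) \<longlongrightarrow> \<tau>) (at 0)"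
    using assms by (auto simp: good_def)
  have "((\<lambda>t. G (\<zeta> ^ k * t) (\<psi> j (\<zeta> ^ k * t))) \<longlongrightarrow> \<tau>) (at 0)"
    using j(4) \<zeta>_nonzero by (rule tendsto_at_0_rotate)
  then have "((\<lambda>t. G t (\<psi> ((\<sigma> ^^ k) j) t)) \<longlongrightarrow> \<tau>) (at 0)"
    by (rule Lim_transform_eventually)
       (use ev_small in eventually_elim, simp add: G_rotate \<psi>_\<sigma>pow j)
  then show ?thesis using j by (simp add: good_def \<sigma>pow_W e_\<sigma>pow)
qed

section \<open>Rescaled limits around a critical series\<close>

lemma scale_exists:
  assumes "j \<in> W" "e j = 0"
  shows "\<exists>h \<kappa>. scale j h \<kappa>"
proof -
  have "\<forall>i\<in>I. \<exists>n a. a \<noteq> 0 \<and> ((\<lambda>t. (\<psi> j t - \<psi> i t) / t ^ n) \<longlongrightarrow> a) (at 0)"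
    using \<psi>diff assms eI I_W by blast
  then obtain v a where va: "\<And>i. i \<in> I \<Longrightarrow> a i \<noteq> 0"
      "\<And>i. i \<in> I \<Longrightarrow> ((\<lambda>t. (\<psi> j t - \<psi> i t) / t ^ v i) \<longlongrightarrow> a i) (at 0)"
    by metis
  \<comment> \<open>The nearest roots are those whose difference with \<open>\<psi> j\<close>
    vanishes to the highest order.\<close>
  define h where "h = Max (v ` I)"
  have le: "v i \<le> h" if "i \<in> I" for i using that finI by (simp add: h_def)
  obtain i0 where i0: "i0 \<in> I" "v i0 = h"
    unfolding h_def using Max_in[of "v ` I"] finI I_ne by fastforce
  \<comment> \<open>\<open>0 ^ (h - v i)\<close> is 1 if the order \<open>v i\<close> is maximal,
    and 0 for the roots that are sent to infinity.\<close>
  define \<kappa> where "\<kappa> i = (if i \<in> I then 0 ^ (h - v i) * inverse (a i) else 0)" for i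
  have "((\<lambda>t. t ^ h / (\<psi> j t - \<psi> i t)) \<longlongrightarrow> \<kappa> i) (at 0)" if i: "i \<in> I" for i
  proof -
    have "((\<lambda>t. t ^ (h - v i) * inverse ((\<psi> j t - \<psi> i t) / t ^ v i)) \<longlongrightarrow>
        0 ^ (h - v i) * inverse (a i)) (at 0)"
      by (intro tendsto_intros va i)
    then have "((\<lambda>t. t ^ (h - v i) * inverse ((\<psi> j t - \<psi> i t) / t ^ v i)) \<longlongrightarrow> \<kappa> i) (at 0)"
      using i by (simp add: \<kappa>_def)
    then show ?thesis
    proof (rule Lim_transform_eventually)
      show "\<forall>\<^sub>F t in at 0. t ^ (h - v i) * inverse ((\<psi> j t - \<psi> i t) / t ^ v i) = t ^ h / (\<psi> j t - \<psi> i t)"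
        using ev_small
      proof eventually_elim
        case (elim t)
        have "t ^ h = t ^ (h - v i) * t ^ v i" using le[OF i] by (simp flip: power_add)
        then show ?case by (simp add: field_simps)
      qed
    qed
  qed
  moreover have "\<kappa> i0 \<noteq> 0" using i0 va by (simp add: \<kappa>_def)
  ultimately have "scale j h \<kappa>"
    unfolding scale_def using i0 by (auto simp: \<kappa>_def)
  then show ?thesis by blast
qed

lemma good_scale: "good j \<tau> \<Longrightarrow> \<exists>h \<kappa>. scale j h \<kappa>"
  by (rule scale_exists) (auto simp: good_def)

lemma scale_unique_aux:
  assumes "scale j h \<kappa>" "scale j h' \<kappa>'"
  shows "h' \<le> h"
proof (rule ccontr)
  assume "\<not> h' \<le> h"
  then have hh: "h < h'" by simp
  have "\<kappa>' i = 0" if i: "i \<in> I" for i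
  proof -
    have "((\<lambda>t. t ^ (h' - h) * (t ^ h / (\<psi> j t - \<psi> i t))) \<longlongrightarrow> 0 ^ (h' - h) * \<kappa> i) (at 0)"
      using assms(1) i by (intro tendsto_intros) (auto simp: scale_def)
    moreover have "(\<lambda>t. t ^ (h' - h) * (t ^ h / (\<psi> j t - \<psi> i t))) = (\<lambda>t. t ^ h' / (\<psi> j t - \<psi> i t))"
      using hh by (auto simp: fun_eq_iff simp flip: power_add)
    moreover have "((\<lambda>t. t ^ h' / (\<psi> j t - \<psi> i t)) \<longlongrightarrow> \<kappa>' i) (at 0)"
      using assms(2) i by (auto simp: scale_def)
    ultimately show ?thesis using hh tendsto_unique[of "at (0::complex)"] by fastforce
  qed
  then show False using assms(2) by (auto simp: scale_def)
qed

lemma scale_unique: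
  assumes "scale j h \<kappa>" "scale j h' \<kappa>'"
  shows "h' = h" "\<kappa>' = \<kappa>"
proof -
  show h: "h' = h" using scale_unique_aux[OF assms] scale_unique_aux[OF assms(2,1)] by simp
  show "\<kappa>' = \<kappa>"
  proof
    fix i
    show "\<kappa>' i = \<kappa> i"
    proof (cases "i \<in> I")
      case True
      then have "((\<lambda>t. t ^ h / (\<psi> j t - \<psi> i t)) \<longlongrightarrow> \<kappa> i) (at 0)"
          "((\<lambda>t. t ^ h / (\<psi> j t - \<psi> i t)) \<longlongrightarrow> \<kappa>' i) (at 0)"
        using assms h by (auto simp: scale_def)
      then show ?thesis by (rule tendsto_unique[OF trivial_limit_at, rotated])
    qed (use assms in \<open>auto simp: scale_def\<close>)
  qed
qed

lemma cluster_eq: "scale j h \<kappa> \<Longrightarrow> cluster j = {i. \<kappa> i \<noteq> 0}"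
  unfolding cluster_def using scale_unique by blast

lemma cluster_I: "cluster j \<subseteq> I"
  by (auto simp: cluster_def scale_def)

lemma cluster_ne:
  assumes "good j \<tau>" shows "cluster j \<noteq> {}"
proof -
  obtain h \<kappa> where "scale j h \<kappa>" using assms good_scale by blast
  then show ?thesis unfolding cluster_eq[OF \<open>scale j h \<kappa>\<close>] by (auto simp: scale_def)
qed

lemma poly_limit_poly: "poly (limit_poly \<tau> \<kappa>) z = \<tau> * (\<Prod>i\<in>I. (1 + \<kappa> i * z) ^ e i)"
  by (simp add: limit_poly_def poly_prod mult.commute)

text \<open>Relative to the value at \<open>\<psi> j t\<close>, each root \<open>i\<close>
  contributes the factor 1 + z t^h / (\<psi> j - \<psi> i), raised to the power \<open>e i\<close>.
  The offset \<open>z\<close> may vary with t so that the argument can follow another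
  series.\<close>

lemma tendsto_limit_poly:
  assumes "good j \<tau>" "scale j h \<kappa>" "(z \<longlongrightarrow> z0) (at 0)"
  shows "((\<lambda>t. G t (\<psi> j t + z t * t ^ h)) \<longlongrightarrow> poly (limit_poly \<tau> \<kappa>) z0) (at 0)"
proof -
  have j: "j \<in> W" "e j = 0" "((\<lambda>t. G t (\<psi> j t)) \<longlongrightarrow> \<tau>) (at 0)"
    using assms by (auto simp: good_def)
  have "((\<lambda>t. G t (\<psi> j t) * (\<Prod>i\<in>I. (1 + (t ^ h / (\<psi> j t - \<psi> i t)) * z t) ^ e i))
     \<longlongrightarrow> \<tau> * (\<Prod>i\<in>I. (1 + \<kappa> i * z0) ^ e i)) (at 0)"
    using assms j by (intro tendsto_intros) (auto simp: scale_def)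
  then show ?thesis unfolding poly_limit_poly
  proof (rule Lim_transform_eventually)
    show "\<forall>\<^sub>F t in at 0. G t (\<psi> j t) * (\<Prod>i\<in>I. (1 + (t ^ h / (\<psi> j t - \<psi> i t)) * z t) ^ e i) =
        G t (\<psi> j t + z t * t ^ h)"
      using ev_small
    proof eventually_elim
      case (elim t)
      have W_I: "(\<Prod>l\<in>W. (\<mu> - \<psi> l t) ^ e l) = (\<Prod>l\<in>I. (\<mu> - \<psi> l t) ^ e l)" for \<mu>
        using finW by (intro prod.mono_neutral_right) (auto simp: I_def)
      have "(\<psi> j t - \<psi> i t) ^ e i * (1 + (t ^ h / (\<psi> j t - \<psi> i t)) * z t) ^ e i =
          (\<psi> j t + z t * t ^ h - \<psi> i t) ^ e i" if "i \<in> I" for i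
      proof -
        have "\<psi> j t - \<psi> i t \<noteq> 0"
          using \<psi>neq[of j i t] elim j that eI[of j] I_W by auto
        then show ?thesis
          by (simp add: field_simps flip: power_mult_distrib)
      qed
      then show ?case
        by (simp add: G_def W_I mult.assoc flip: prod.distrib)
    qed
  qed
qed

text \<open>The limit value at the second series \<open>j'\<close> is nonzero, so its rescaled
  offset \<open>r\<close> is not a root of the limit polynomial. Hence \<open>j'\<close> stays at
  finite nonzero rescaled distance from the nearest roots of \<open>j\<close> and sees the same
  cluster at the same scale.\<close>

lemma near_good:
  assumes j: "good j \<tau>" "scale j h \<kappa>" and j': "good j' \<tau>'"
    and r: "((\<lambda>t. (\<psi> j' t - \<psi> j t) / t ^ h) \<longlongrightarrow> r) (at 0)"
  shows "poly (limit_poly \<tau> \<kappa>) r = \<tau>'"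
    and "scale j' h (\<lambda>i. \<kappa> i / (1 + \<kappa> i * r))" and "cluster j' = cluster j"
    and "poly (pderiv (limit_poly \<tau> \<kappa>)) r = 0"
proof -
  have jW: "j \<in> W" "e j = 0" "j' \<in> W" "e j' = 0" using j j' by (auto simp: good_def)
  have "((\<lambda>t. G t (\<psi> j t + (\<psi> j' t - \<psi> j t) / t ^ h * t ^ h)) \<longlongrightarrow> poly (limit_poly \<tau> \<kappa>) r) (at 0)"
    using j r by (rule tendsto_limit_poly)
  then have "((\<lambda>t. G t (\<psi> j' t)) \<longlongrightarrow> poly (limit_poly \<tau> \<kappa>) r) (at 0)"
    by (rule Lim_transform_eventually) (use ev_small in eventually_elim, simp)
  then show 1: "poly (limit_poly \<tau> \<kappa>) r = \<tau>'"
    using j' tendsto_unique[of "at (0::complex)"] by (auto simp: good_def)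
  have nz: "1 + \<kappa> i * r \<noteq> 0" if "i \<in> I" for i
  proof
    assume "1 + \<kappa> i * r = 0"
    then have "(\<Prod>i\<in>I. (1 + \<kappa> i * r) ^ e i) = 0"
      using that finI by (auto simp: I_def intro!: bexI[of _ i])
    then show False using 1 j' by (simp add: poly_limit_poly good_def)
  qed
  have lim: "((\<lambda>t. t ^ h / (\<psi> j' t - \<psi> i t)) \<longlongrightarrow> \<kappa> i / (1 + \<kappa> i * r)) (at 0)" if i: "i \<in> I" for i
  proof -
    have "((\<lambda>t. (t ^ h / (\<psi> j t - \<psi> i t)) / (1 + (t ^ h / (\<psi> j t - \<psi> i t)) * ((\<psi> j' t - \<psi> j t) / t ^ h)))
      \<longlongrightarrow> \<kappa> i / (1 + \<kappa> i * r)) (at 0)"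
      using j(2) r i nz by (intro tendsto_intros) (auto simp: scale_def)
    then show ?thesis
    proof (rule Lim_transform_eventually)
      show "\<forall>\<^sub>F t in at 0. (t ^ h / (\<psi> j t - \<psi> i t)) / (1 + (t ^ h / (\<psi> j t - \<psi> i t)) * ((\<psi> j' t - \<psi> j t) / t ^ h)) =
         t ^ h / (\<psi> j' t - \<psi> i t)"
        using ev_small
      proof eventually_elim
        case (elim t)
        have "\<psi> j t - \<psi> i t \<noteq> 0" "\<psi> j' t - \<psi> i t \<noteq> 0"
          using \<psi>neq[of j i t] \<psi>neq[of j' i t] elim jW i eI[of j] eI[of j'] I_W by auto
        moreover from this have "1 + (t ^ h / (\<psi> j t - \<psi> i t)) * ((\<psi> j' t - \<psi> j t) / t ^ h) =
            (\<psi> j' t - \<psi> i t) / (\<psi> j t - \<psi> i t)"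
          using elim by (simp add: field_simps)
        ultimately show ?case by simp
      qed
    qed
  qed
  show sc: "scale j' h (\<lambda>i. \<kappa> i / (1 + \<kappa> i * r))"
    using j(2) lim nz unfolding scale_def by auto
  show "cluster j' = cluster j"
    using nz j(2) by (auto simp: cluster_eq[OF sc] cluster_eq[OF j(2)] scale_def)
  \<comment> \<open>This is t^h times the logarithmic derivative of \<open>G t\<close> at the
    critical point \<open>\<psi> j' t\<close>, which vanishes. Its limit is the logarithmic
    derivative of the limit polynomial at \<open>r\<close>.\<close>
  have "((\<lambda>t. \<Sum>i\<in>I. of_nat (e i) * (t ^ h / (\<psi> j' t - \<psi> i t))) \<longlongrightarrow>
      (\<Sum>i\<in>I. of_nat (e i) * (\<kappa> i / (1 + \<kappa> i * r)))) (at 0)"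
    by (intro tendsto_intros lim)
  moreover have "((\<lambda>t. \<Sum>i\<in>I. of_nat (e i) * (t ^ h / (\<psi> j' t - \<psi> i t))) \<longlongrightarrow> 0) (at 0)"
  proof (rule Lim_transform_eventually[OF tendsto_const])
    show "\<forall>\<^sub>F t in at 0. 0 = (\<Sum>i\<in>I. of_nat (e i) * (t ^ h / (\<psi> j' t - \<psi> i t)))"
      using ev_small
    proof eventually_elim
      case (elim t)
      have "(\<Sum>i\<in>I. of_nat (e i) * (t ^ h / (\<psi> j' t - \<psi> i t))) =
          t ^ h * (\<Sum>i\<in>I. of_nat (e i) / (\<psi> j' t - \<psi> i t))"
        by (simp add: sum_distrib_left field_simps)
      also have "(\<Sum>i\<in>I. of_nat (e i) / (\<psi> j' t - \<psi> i t)) = (\<Sum>i\<in>W. of_nat (e i) / (\<psi> j' t - \<psi> i t))"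
        using finW by (intro sum.mono_neutral_left) (auto simp: I_def)
      also have "\<dots> = 0" using crit[of j' t] elim jW by simp
      finally show ?case by simp
    qed
  qed
  ultimately have "(\<Sum>i\<in>I. of_nat (e i) * (\<kappa> i / (1 + \<kappa> i * r))) = 0"
    using tendsto_unique[of "at (0::complex)"] by auto
  then show "poly (pderiv (limit_poly \<tau> \<kappa>)) r = 0"
    using poly_pderiv_prod_linear[OF finI nz, of e] by (simp add: limit_poly_def pderiv_smult)
qed

lemma tendsto_root:
  assumes "scale j h \<kappa>" "\<kappa> i \<noteq> 0"
  shows "((\<lambda>t. (\<psi> i t - \<psi> j t) / t ^ h) \<longlongrightarrow> - 1 / \<kappa> i) (at 0)"
proof -
  have "i \<in> I" using assms by (auto simp: scale_def)
  then have "((\<lambda>t. - 1 / (t ^ h / (\<psi> j t - \<psi> i t))) \<longlongrightarrow> - 1 / \<kappa> i) (at 0)"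
    using assms by (intro tendsto_intros) (auto simp: scale_def)
  moreover have "- 1 / (t ^ h / (\<psi> j t - \<psi> i t)) = (\<psi> i t - \<psi> j t) / t ^ h" for t
    by (simp add: minus_divide_left)
  ultimately show ?thesis by simp
qed

text \<open>Both series are compared with the common root \<open>i\<close>. As h \<le> h', the
  distance from \<open>j'\<close> to \<open>i\<close>, of order t^h', stays bounded after division
  by t^h, as does the distance from \<open>j\<close> to \<open>i\<close>.\<close>

lemma cluster_meet_aux:
  assumes "scale j h \<kappa>" "scale j' h' \<kappa>'" "h \<le> h'" "\<kappa> i \<noteq> 0" "\<kappa>' i \<noteq> 0"
  shows "\<exists>r. ((\<lambda>t. (\<psi> j' t - \<psi> j t) / t ^ h) \<longlongrightarrow> r) (at 0)"
proof -
  have "((\<lambda>t. (\<psi> i t - \<psi> j t) / t ^ h - t ^ (h' - h) * ((\<psi> i t - \<psi> j' t) / t ^ h'))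
     \<longlongrightarrow> - 1 / \<kappa> i - 0 ^ (h' - h) * (- 1 / \<kappa>' i)) (at 0)"
    using assms by (intro tendsto_intros tendsto_root)
  then have "((\<lambda>t. (\<psi> j' t - \<psi> j t) / t ^ h) \<longlongrightarrow> - 1 / \<kappa> i - 0 ^ (h' - h) * (- 1 / \<kappa>' i)) (at 0)"
  proof (rule Lim_transform_eventually)
    show "\<forall>\<^sub>F t in at 0. (\<psi> i t - \<psi> j t) / t ^ h - t ^ (h' - h) * ((\<psi> i t - \<psi> j' t) / t ^ h') =
        (\<psi> j' t - \<psi> j t) / t ^ h"
      using ev_small
    proof eventually_elim
      case (elim t)
      have "t ^ (h' - h) / t ^ h' = 1 / t ^ h"
        using elim assms(3) by (simp add: power_diff)
      then have "t ^ (h' - h) * ((\<psi> i t - \<psi> j' t) / t ^ h') = (\<psi> i t - \<psi> j' t) / t ^ h"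
        by (metis (no_types, opaque_lifting) mult.commute mult.right_neutral times_divide_eq_left times_divide_eq_right)
      then show ?case by (simp add: diff_divide_distrib)
    qed
  qed
  then show ?thesis by blast
qed

lemma cluster_meet:
  assumes "good j \<tau>" "good j' \<tau>'" "i \<in> cluster j" "i \<in> cluster j'" "scale j h \<kappa>"
  shows "cluster j' = cluster j" "\<exists>r. ((\<lambda>t. (\<psi> j' t - \<psi> j t) / t ^ h) \<longlongrightarrow> r) (at 0)"
proof -
  obtain h' \<kappa>' where sc': "scale j' h' \<kappa>'" using assms good_scale by blast
  note sc = assms(5)
  have i: "\<kappa> i \<noteq> 0" "\<kappa>' i \<noteq> 0"
    using assms by (auto simp: cluster_eq[OF sc] cluster_eq[OF sc'])
  have "cluster j' = cluster j \<and> (\<exists>r. ((\<lambda>t. (\<psi> j' t - \<psi> j t) / t ^ h) \<longlongrightarrow> r) (at 0))"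
  proof (cases "h \<le> h'")
    case True
    then show ?thesis
      using cluster_meet_aux[OF sc sc' _ i] near_good[OF assms(1) sc assms(2)] by blast
  next
    case False
    then obtain r where r: "((\<lambda>t. (\<psi> j t - \<psi> j' t) / t ^ h') \<longlongrightarrow> r) (at 0)"
      using cluster_meet_aux[OF sc' sc] i by force
    \<comment> \<open>With the roles exchanged, \<open>near_good\<close> gives \<open>j\<close> the
      scale \<open>h'\<close>, so uniqueness excludes h' < h.\<close>
    have "h = h'" using near_good(2)[OF assms(2) sc' assms(1) r] scale_unique sc by blast
    with False show ?thesis by simp
  qed
  then show "cluster j' = cluster j" "\<exists>r. ((\<lambda>t. (\<psi> j' t - \<psi> j t) / t ^ h) \<longlongrightarrow> r) (at 0)" by auto
qed

lemma cluster_rotate: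
  assumes "j \<in> W" "e j = 0"
  shows "cluster ((\<sigma> ^^ k) j) = (\<sigma> ^^ k) ` cluster j"
proof -
  let ?j = "(\<sigma> ^^ k) j" and ?\<omega> = "\<zeta> ^ k"
  have "?j \<in> W" "e ?j = 0" using assms by (simp_all add: \<sigma>pow_W e_\<sigma>pow)
  then obtain h \<kappa>' where sc': "scale ?j h \<kappa>'" using scale_exists by blast
  \<comment> \<open>Substituting \<open>inverse ?\<omega> * t\<close> for t turns the series of
    \<open>(\<sigma> ^^ k) j\<close> back into that of \<open>j\<close>; the power of
    \<open>?\<omega>\<close> cancels the factor that this takes out of t^h.\<close>
  define \<kappa> where "\<kappa> i = (if i \<in> I then ?\<omega> ^ h * \<kappa>' ((\<sigma> ^^ k) i) else 0)" for i
  have "((\<lambda>t. t ^ h / (\<psi> j t - \<psi> i t)) \<longlongrightarrow> \<kappa> i) (at 0)" if i: "i \<in> I" for i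
  proof -
    let ?i = "(\<sigma> ^^ k) i"
    have "((\<lambda>t. t ^ h / (\<psi> ?j t - \<psi> ?i t)) \<longlongrightarrow> \<kappa>' ?i) (at 0)"
      using sc' \<sigma>pow_I[OF i] by (auto simp: scale_def)
    then have "((\<lambda>t. ?\<omega> ^ h * ((inverse ?\<omega> * t) ^ h / (\<psi> ?j (inverse ?\<omega> * t) - \<psi> ?i (inverse ?\<omega> * t)))) \<longlongrightarrow> \<kappa> i) (at 0)"
      unfolding \<kappa>_def if_P[OF i]
      by (rule tendsto_mult[OF tendsto_const tendsto_at_0_rotate]) (use \<zeta>_nonzero[of k] in simp)
    then show ?thesis
    proof (rule Lim_transform_eventually)
      show "\<forall>\<^sub>F t in at 0. ?\<omega> ^ h * ((inverse ?\<omega> * t) ^ h / (\<psi> ?j (inverse ?\<omega> * t) - \<psi> ?i (inverse ?\<omega> * t))) =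
         t ^ h / (\<psi> j t - \<psi> i t)"
        using ev_small
      proof eventually_elim
        case (elim t)
        have n: "norm (inverse ?\<omega> * t) < \<rho>" using elim norm_\<zeta>[of k] by (simp add: norm_mult norm_inverse)
        have e: "?\<omega> * (inverse ?\<omega> * t) = t" by simp
        show ?case
          unfolding \<psi>_\<sigma>pow[OF assms(1) n] \<psi>_\<sigma>pow[OF I_W[OF i] n] e
          by (simp add: power_mult_distrib power_inverse)
      qed
    qed
  qed
  moreover have "\<exists>i\<in>I. \<kappa> i \<noteq> 0"
  proof -
    obtain i where i: "i \<in> I" "\<kappa>' i \<noteq> 0" using sc' by (auto simp: scale_def)
    obtain i' where "i' \<in> I" "(\<sigma> ^^ k) i' = i" using \<sigma>pow_I_surj[OF i(1)] by blast
    then show ?thesis using i \<zeta>_nonzero[of k] by (auto simp: \<kappa>_def intro!: bexI[of _ i'])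
  qed
  ultimately have sc: "scale j h \<kappa>" by (simp add: scale_def \<kappa>_def)
  have sub: "i \<in> (\<sigma> ^^ k) ` {i. \<kappa> i \<noteq> 0}" if "\<kappa>' i \<noteq> 0" for i
  proof -
    have "i \<in> I" using that sc' by (auto simp: scale_def)
    then obtain i' where "i' \<in> I" "(\<sigma> ^^ k) i' = i" using \<sigma>pow_I_surj by blast
    then show ?thesis using that \<zeta>_nonzero[of k] by (auto simp: \<kappa>_def intro!: image_eqI[of _ _ i'])
  qed
  moreover have "\<kappa>' ((\<sigma> ^^ k) i) \<noteq> 0" if "\<kappa> i \<noteq> 0" for i
    using that by (auto simp: \<kappa>_def split: if_splits)
  ultimately show ?thesis
    unfolding cluster_eq[OF sc] cluster_eq[OF sc'] by blast
qed


section \<open>Orbits of the monodromy and the branches through a cluster\<close>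

lemma \<sigma>pow_funpow: "l \<in> W \<Longrightarrow> (\<sigma> ^^ (k * (N - 1))) ((\<sigma> ^^ k) l) = l"
proof -
  assume l: "l \<in> W"
  have "k * (N - 1) + k = k * N" using Npos by (simp add: algebra_simps flip: mult_Suc_right)
  then show ?thesis using \<sigma>pow_mult_N[OF l, of k] by (metis comp_apply funpow_add)
qed

lemma orb_refl: "i \<in> orb i"
  unfolding orb_def by (auto intro!: exI[of _ 0])

lemma orb_rotate:
  assumes "i \<in> W" shows "orb ((\<sigma> ^^ k) i) = orb i"
proof (intro equalityI subsetI)
  fix l assume "l \<in> orb ((\<sigma> ^^ k) i)"
  then obtain m where "l = (\<sigma> ^^ m) ((\<sigma> ^^ k) i)" by (auto simp: orb_def)
  then have "l = (\<sigma> ^^ (m + k)) i" by (simp add: funpow_add)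
  then show "l \<in> orb i" unfolding orb_def by blast
next
  fix l assume "l \<in> orb i"
  then obtain m where "l = (\<sigma> ^^ m) i" by (auto simp: orb_def)
  \<comment> \<open>The power k (N - 1) inverts \<open>\<sigma> ^^ k\<close>, so orbits can be
    defined by forward iterates.\<close>
  also have "i = (\<sigma> ^^ (k * (N - 1))) ((\<sigma> ^^ k) i)" using \<sigma>pow_funpow[OF assms] by simp
  finally have "l = (\<sigma> ^^ (m + k * (N - 1))) ((\<sigma> ^^ k) i)" by (simp add: funpow_add)
  then show "l \<in> orb ((\<sigma> ^^ k) i)" unfolding orb_def by blast
qed

lemma orb_eqD: "orb i = orb i' \<Longrightarrow> \<exists>k. i = (\<sigma> ^^ k) i'"
  using orb_refl[of i] by (auto simp: orb_def)

definition branch_set :: "'i \<Rightarrow> 'i set set" where "branch_set j = orb ` cluster j"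

lemma branch_set_rotate:
  assumes "good j \<tau>" shows "branch_set ((\<sigma> ^^ k) j) = branch_set j"
proof -
  have "branch_set ((\<sigma> ^^ k) j) = (\<lambda>i. orb ((\<sigma> ^^ k) i)) ` cluster j"
    using assms by (simp add: branch_set_def cluster_rotate good_def image_image)
  also have "\<dots> = branch_set j"
    unfolding branch_set_def by (intro image_cong refl orb_rotate) (use cluster_I I_W in blast)
  finally show ?thesis .
qed

text \<open>A common orbit gives conjugate roots in the two clusters. Rotating \<open>j'\<close> by
  the conjugating power makes the clusters share a root, and then they coincide by
  \<open>cluster_meet\<close>.\<close>

lemma branch_set_meet:
  assumes "good j \<tau>" "good j' \<tau>'" "branch_set j \<inter> branch_set j' \<noteq> {}"
  shows "\<exists>k. cluster ((\<sigma> ^^ k) j') \<inter> cluster j \<noteq> {}" "branch_set j = branch_set j'"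
proof -
  obtain i i' where i: "i \<in> cluster j" "i' \<in> cluster j'" "orb i = orb i'"
    using assms(3) unfolding branch_set_def by blast
  obtain k where k: "i = (\<sigma> ^^ k) i'" using orb_eqD[OF i(3)] by blast
  have mem: "i \<in> cluster ((\<sigma> ^^ k) j')"
    using assms(2) i(2) k by (simp add: cluster_rotate good_def)
  then show "\<exists>k. cluster ((\<sigma> ^^ k) j') \<inter> cluster j \<noteq> {}" using i by blast
  obtain h \<kappa> where "scale j h \<kappa>" using assms good_scale by blast
  then have "cluster ((\<sigma> ^^ k) j') = cluster j"
    using cluster_meet(1)[OF assms(1) good_rotate[OF assms(2)] i(1) mem] by blast
  then show "branch_set j = branch_set j'"
    using branch_set_rotate[OF assms(2), of k] by (simp add: branch_set_def)
qed

text \<open>The source of the affine symmetries: the offset of a rotated series is the original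
  offset taken at \<zeta>^k t, which multiplies its leading coefficient by \<zeta>^(k h), plus the
  offset of the rotated centre.\<close>

lemma tendsto_offset_rotate:
  assumes "l \<in> W" "j \<in> W"
    and "((\<lambda>t. (\<psi> l t - \<psi> j t) / t ^ h) \<longlongrightarrow> r) (at 0)"
    and "((\<lambda>t. (\<psi> ((\<sigma> ^^ k) j) t - \<psi> j t) / t ^ h) \<longlongrightarrow> b) (at 0)"
  shows "((\<lambda>t. (\<psi> ((\<sigma> ^^ k) l) t - \<psi> j t) / t ^ h) \<longlongrightarrow> (\<zeta> ^ k) ^ h * r + b) (at 0)"
proof -
  have "((\<lambda>t. (\<zeta> ^ k) ^ h * ((\<psi> l (\<zeta> ^ k * t) - \<psi> j (\<zeta> ^ k * t)) / (\<zeta> ^ k * t) ^ h) +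
      (\<psi> ((\<sigma> ^^ k) j) t - \<psi> j t) / t ^ h) \<longlongrightarrow> (\<zeta> ^ k) ^ h * r + b) (at 0)"
    by (intro tendsto_add tendsto_mult tendsto_const assms tendsto_at_0_rotate[OF assms(3) \<zeta>_nonzero])
  then show ?thesis
  proof (rule Lim_transform_eventually)
    show "\<forall>\<^sub>F t in at 0. (\<zeta> ^ k) ^ h * ((\<psi> l (\<zeta> ^ k * t) - \<psi> j (\<zeta> ^ k * t)) / (\<zeta> ^ k * t) ^ h) +
      (\<psi> ((\<sigma> ^^ k) j) t - \<psi> j t) / t ^ h = (\<psi> ((\<sigma> ^^ k) l) t - \<psi> j t) / t ^ h"
      using ev_small
    proof eventually_elim
      case (elim t)
      have "(\<zeta> ^ k) ^ h \<noteq> 0" using \<zeta>_nonzero[of k] by simp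
      then have "(\<zeta> ^ k) ^ h * ((\<psi> l (\<zeta> ^ k * t) - \<psi> j (\<zeta> ^ k * t)) / (\<zeta> ^ k * t) ^ h) =
          (\<psi> l (\<zeta> ^ k * t) - \<psi> j (\<zeta> ^ k * t)) / t ^ h"
        by (simp add: power_mult_distrib)
      also have "\<dots> = (\<psi> ((\<sigma> ^^ k) l) t - \<psi> ((\<sigma> ^^ k) j) t) / t ^ h"
        using elim assms by (simp add: \<psi>_\<sigma>pow)
      finally show ?case by (simp add: diff_divide_distrib)
    qed
  qed
qed

lemma degree_limit_poly:
  assumes "\<tau> \<noteq> 0" "scale j h \<kappa>"
  shows "degree (limit_poly \<tau> \<kappa>) > 0"
proof (rule ccontr)
  assume "\<not> degree (limit_poly \<tau> \<kappa>) > 0"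
  then obtain a where a: "limit_poly \<tau> \<kappa> = [:a:]" using degree_eq_zeroE by auto
  obtain i where i: "i \<in> I" "\<kappa> i \<noteq> 0" using assms by (auto simp: scale_def)
  have "poly (limit_poly \<tau> \<kappa>) 0 = \<tau>" by (simp add: poly_limit_poly)
  moreover have "poly (limit_poly \<tau> \<kappa>) (- 1 / \<kappa> i) = 0"
    using i finI by (auto simp: poly_limit_poly I_def intro!: bexI[of _ i])
  ultimately show False using a assms(1) by simp
qed

text \<open>One limit polynomial \<open>F\<close> serves all values with this branch set: each
  \<open>j'\<close> can be rotated until its cluster is that of \<open>j\<close>, and then it gives
  a critical point of \<open>F\<close>. The symmetries carry the root chosen on each branch to all
  other roots of \<open>F\<close> on it, so one representative per branch suffices.\<close>

lemma card_values_of_branch_set: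
  assumes j: "good j \<tau>"
    and T: "\<And>\<tau>'. \<tau>' \<in> T \<Longrightarrow> \<exists>j'. good j' \<tau>' \<and> branch_set j' = branch_set j"
  shows "finite T \<and> card T \<le> card (branch_set j)"
proof -
  obtain h \<kappa> where sc: "scale j h \<kappa>" using good_scale[OF j] by blast
  have jW: "j \<in> W" "e j = 0" "\<tau> \<noteq> 0" using j by (auto simp: good_def)
  note cl = cluster_eq[OF sc]
  define F where "F = limit_poly \<tau> \<kappa>"
  \<comment> \<open>The stabiliser of the cluster, kept as a set of natural exponents. The symmetry
    group is its image under \<open>A\<close>: finite since \<open>A\<close> only depends on
    exponents modulo \<open>N\<close>, commutative since exponents add.\<close>
  define K where "K = {k. cluster ((\<sigma> ^^ k) j) = cluster j}"
  define b where "b k = Lim (at 0) (\<lambda>t. (\<psi> ((\<sigma> ^^ k) j) t - \<psi> j t) / t ^ h)" for k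
  define A where "A k = (\<lambda>z. (\<zeta> ^ k) ^ h * z + b k)" for k
  have bI: "b k = r" if "((\<lambda>t. (\<psi> ((\<sigma> ^^ k) j) t - \<psi> j t) / t ^ h) \<longlongrightarrow> r) (at 0)" for k r
    unfolding b_def using that by (intro tendsto_Lim) auto
  have b: "((\<lambda>t. (\<psi> ((\<sigma> ^^ k) j) t - \<psi> j t) / t ^ h) \<longlongrightarrow> b k) (at 0)" if "k \<in> K" for k
  proof -
    obtain i where "i \<in> cluster j" using cluster_ne[OF j] by blast
    then have "\<exists>r. ((\<lambda>t. (\<psi> ((\<sigma> ^^ k) j) t - \<psi> j t) / t ^ h) \<longlongrightarrow> r) (at 0)"
      using that by (intro cluster_meet(2)[OF j good_rotate[OF j] _ _ sc]) (auto simp: K_def)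
    then show ?thesis using bI by blast
  qed
  have clK: "cluster ((\<sigma> ^^ k) ((\<sigma> ^^ l) j)) = (\<sigma> ^^ k) ` cluster ((\<sigma> ^^ l) j)" for k l
    using jW by (intro cluster_rotate) (simp_all add: \<sigma>pow_W e_\<sigma>pow)
  have Kadd: "k + l \<in> K" and Aadd: "A (k + l) = A k \<circ> A l" if kl: "k \<in> K" "l \<in> K" for k l
  proof -
    have "cluster ((\<sigma> ^^ (k + l)) j) = (\<sigma> ^^ k) ` cluster ((\<sigma> ^^ l) j)"
      using clK by (simp add: funpow_add)
    also have "\<dots> = cluster ((\<sigma> ^^ k) j)"
      using kl clK[of k 0] by (simp add: K_def)
    finally show "k + l \<in> K" using kl by (simp add: K_def)
    have "((\<lambda>t. (\<psi> ((\<sigma> ^^ k) ((\<sigma> ^^ l) j)) t - \<psi> j t) / t ^ h) \<longlongrightarrow> (\<zeta> ^ k) ^ h * b l + b k) (at 0)"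
      using jW by (intro tendsto_offset_rotate b kl) (simp_all add: \<sigma>pow_W)
    then have "b (k + l) = (\<zeta> ^ k) ^ h * b l + b k"
      by (intro bI) (simp add: funpow_add)
    then show "A (k + l) = A k \<circ> A l"
      by (simp add: A_def fun_eq_iff power_add power_mult_distrib algebra_simps)
  qed
  have KmultN: "k * N \<in> K" and AmultN: "A (k * N) = id" for k
  proof -
    show "k * N \<in> K" using jW by (simp add: K_def \<sigma>pow_mult_N)
    have "b (k * N) = 0" by (rule bI) (use jW in \<open>simp add: \<sigma>pow_mult_N\<close>)
    moreover have "\<zeta> ^ (k * N) = 1" using \<zeta>N by (metis mult.commute power_mult power_one)
    ultimately show "A (k * N) = id" by (simp add: A_def fun_eq_iff)
  qed
  have Kmult: "k * m \<in> K" if "k \<in> K" for k m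
  proof (induction m)
    case 0 show ?case using KmultN[of 0] by simp
  next
    case (Suc m) then show ?case using Kadd[OF that] by simp
  qed
  have Amod: "k mod N \<in> K" "A (k mod N) = A k" if "k \<in> K" for k
    using that jW by (simp_all add: K_def A_def b_def \<sigma>pow_mod \<zeta>pow_mod)
  have fin: "finite (A ` K)"
  proof -
    have "A ` K \<subseteq> A ` {..<N}" using Amod Npos by (metis image_subsetI imageI lessThan_iff mod_less_divisor)
    then show ?thesis by (rule finite_subset) simp
  qed
  \<comment> \<open>Rotating t does not affect the limit of G t (\<psi> j + z t^h). Since
    \<open>G\<close> is invariant, it only turns the argument into \<psi> j + u t^h, where
    \<open>u\<close> tends to \<open>A k z\<close>.\<close>
  have inv: "poly F (A k z) = poly F z" if k: "k \<in> K" for k z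
  proof -
    let ?\<omega> = "\<zeta> ^ k"
    define u where "u t = ?\<omega> ^ h * z + (\<psi> ((\<sigma> ^^ k) j) t - \<psi> j t) / t ^ h" for t
    have "(u \<longlongrightarrow> A k z) (at 0)" unfolding u_def A_def by (intro tendsto_intros b k)
    then have 1: "((\<lambda>t. G t (\<psi> j t + u t * t ^ h)) \<longlongrightarrow> poly F (A k z)) (at 0)"
      unfolding F_def by (rule tendsto_limit_poly[OF j sc])
    have "((\<lambda>t. G t (\<psi> j t + z * t ^ h)) \<longlongrightarrow> poly F z) (at 0)"
      unfolding F_def by (rule tendsto_limit_poly[OF j sc tendsto_const])
    then have "((\<lambda>t. G (?\<omega> * t) (\<psi> j (?\<omega> * t) + z * (?\<omega> * t) ^ h)) \<longlongrightarrow> poly F z) (at 0)"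
      using \<zeta>_nonzero by (rule tendsto_at_0_rotate)
    then have "((\<lambda>t. G t (\<psi> j t + u t * t ^ h)) \<longlongrightarrow> poly F z) (at 0)"
    proof (rule Lim_transform_eventually)
      show "\<forall>\<^sub>F t in at 0. G (?\<omega> * t) (\<psi> j (?\<omega> * t) + z * (?\<omega> * t) ^ h) = G t (\<psi> j t + u t * t ^ h)"
        using ev_small
      proof eventually_elim
        case (elim t)
        have "\<psi> j t + u t * t ^ h = \<psi> j (?\<omega> * t) + z * (?\<omega> * t) ^ h"
          using elim jW by (simp add: u_def \<psi>_\<sigma>pow distrib_right power_mult_distrib)
        then show ?case using elim by (simp add: G_rotate)
      qed
    qed
    then show ?thesis using 1 tendsto_unique[OF trivial_limit_at] by blast
  qed
  define rep where "rep Q = (SOME i. i \<in> cluster j \<and> orb i = Q)" for Q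
  have rep: "rep Q \<in> cluster j" "orb (rep Q) = Q" if "Q \<in> branch_set j" for Q
    using that someI_ex[of "\<lambda>i. i \<in> cluster j \<and> orb i = Q"] unfolding rep_def branch_set_def by auto
  define R where "R = (\<lambda>Q. - 1 / \<kappa> (rep Q)) ` branch_set j"
  have finbs: "finite (branch_set j)"
    using finite_subset[OF cluster_I finI] by (simp add: branch_set_def)
  have "finite T \<and> card T \<le> card R"
  proof (rule card_critical_values_le[where p=F and \<A>="A ` K"])
    show "degree F > 0" unfolding F_def using jW sc by (intro degree_limit_poly)
    show "\<exists>a b. a \<noteq> 0 \<and> B = (\<lambda>z. a * z + b)" if B: "B \<in> A ` K" for B
    proof -
      obtain k where "B = A k" using B by blast
      then show ?thesis using \<zeta>_nonzero[of k]
        by (intro exI[of _ "(\<zeta> ^ k) ^ h"] exI[of _ "b k"]) (simp add: A_def)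
    qed
    show "poly F (B z) = poly F z" if "B \<in> A ` K" for B z using that inv by auto
    show "B \<circ> C = C \<circ> B" if BC: "B \<in> A ` K" "C \<in> A ` K" for B C
    proof -
      obtain k l where "k \<in> K" "l \<in> K" "B = A k" "C = A l" using BC by blast
      then show ?thesis using Aadd[of k l] Aadd[of l k] by (simp add: add.commute)
    qed
    show "B \<circ> C \<in> A ` K" if BC: "B \<in> A ` K" "C \<in> A ` K" for B C
    proof -
      obtain k l where "k \<in> K" "l \<in> K" "B = A k" "C = A l" using BC by blast
      then show ?thesis using Aadd[of k l] Kadd[of k l] by (metis imageI)
    qed
    show "\<exists>C\<in>A ` K. C \<circ> B = id" if B: "B \<in> A ` K" for B
    proof -
      obtain k where k: "k \<in> K" "B = A k" using B by blast
      have "k * (N - 1) + k = k * N" using Npos by (simp add: algebra_simps flip: mult_Suc_right)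
      then have "A (k * (N - 1)) \<circ> B = id"
        using Aadd[OF Kmult[OF k(1)] k(1), of "N - 1"] AmultN[of k] k(2) by simp
      then show ?thesis using Kmult[OF k(1)] by blast
    qed
    show "{z. poly F z = 0} \<subseteq> (\<Union>z\<in>R. (\<lambda>B. B z) ` A ` K)"
    proof
      fix z assume "z \<in> {z. poly F z = 0}"
      then obtain i where i: "i \<in> I" "1 + \<kappa> i * z = 0"
        using jW finI by (auto simp: F_def poly_limit_poly)
      have \<kappa>i: "\<kappa> i \<noteq> 0" using i by auto
      have z: "z = - 1 / \<kappa> i" using i(2) \<kappa>i by (simp add: field_simps add_eq_0_iff)
      define Q where "Q = orb i"
      have Q: "Q \<in> branch_set j" using \<kappa>i by (simp add: Q_def branch_set_def cl)
      note r = rep[OF Q]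
      \<comment> \<open>The rotation relating the representative to \<open>i\<close> carries the
        cluster to one that also contains \<open>i\<close>, hence to the same cluster, and so it
        belongs to \<open>K\<close>.\<close>
      obtain k where k: "i = (\<sigma> ^^ k) (rep Q)" using orb_eqD r(2) Q_def by metis
      have "i \<in> cluster ((\<sigma> ^^ k) j)" using k r jW by (simp add: cluster_rotate)
      moreover have "i \<in> cluster j" using \<kappa>i by (simp add: cl)
      ultimately have kK: "k \<in> K"
        unfolding K_def using cluster_meet(1)[OF j good_rotate[OF j] _ _ sc] by blast
      have \<kappa>r: "\<kappa> (rep Q) \<noteq> 0" using r(1) by (simp add: cl)
      have "((\<lambda>t. (\<psi> ((\<sigma> ^^ k) (rep Q)) t - \<psi> j t) / t ^ h) \<longlongrightarrow>
          (\<zeta> ^ k) ^ h * (- 1 / \<kappa> (rep Q)) + b k) (at 0)"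
        using r(1) jW cluster_I I_W
        by (intro tendsto_offset_rotate tendsto_root[OF sc \<kappa>r] b kK) blast+
      then have "A k (- 1 / \<kappa> (rep Q)) = z"
        using tendsto_root[OF sc \<kappa>i] tendsto_unique[OF trivial_limit_at]
        unfolding z A_def k[symmetric] by blast
      then show "z \<in> (\<Union>z\<in>R. (\<lambda>B. B z) ` A ` K)"
        using kK Q unfolding R_def by blast
    qed
    show "\<exists>z. poly F z = \<tau>' \<and> \<tau>' \<noteq> 0 \<and> poly (pderiv F) z = 0" if \<tau>': "\<tau>' \<in> T" for \<tau>'
    proof -
      obtain j' where j': "good j' \<tau>'" "branch_set j' = branch_set j" using T[OF \<tau>'] by blast
      have "branch_set j \<inter> branch_set j' \<noteq> {}"
        using cluster_ne[OF j] j'(2) by (auto simp: branch_set_def)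
      then obtain k i where "i \<in> cluster j" "i \<in> cluster ((\<sigma> ^^ k) j')"
        using branch_set_meet(1)[OF j j'(1)] by blast
      then obtain r where r: "((\<lambda>t. (\<psi> ((\<sigma> ^^ k) j') t - \<psi> j t) / t ^ h) \<longlongrightarrow> r) (at 0)"
        using cluster_meet(2)[OF j good_rotate[OF j'(1)] _ _ sc] by blast
      note near_good[OF j sc good_rotate[OF j'(1)] r]
      then show ?thesis using j'(1) unfolding F_def good_def by blast
    qed
  qed (use fin finbs in \<open>auto simp: R_def\<close>)
  moreover have "card R \<le> card (branch_set j)" unfolding R_def using finbs by (rule card_image_le)
  ultimately show ?thesis by linarith
qed

text \<open>\<open>J\<close> assigns one critical series to each value, and the values are grouped
  by its branch set. Distinct branch sets are disjoint sets of orbits, so the bounds of the groups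
  add up to at most the number of orbits.\<close>

lemma card_good_values:
  "finite {\<tau>. \<exists>j. good j \<tau>} \<and> card {\<tau>. \<exists>j. good j \<tau>} \<le> card (orb ` I)"
proof -
  let ?T = "{\<tau>. \<exists>j. good j \<tau>}"
  define J where "J \<tau> = (SOME j. good j \<tau>)" for \<tau>
  have J: "good (J \<tau>) \<tau>" if "\<tau> \<in> ?T" for \<tau>
    using that unfolding J_def by (auto intro: someI_ex)
  define \<B> where "\<B> = (\<lambda>\<tau>. branch_set (J \<tau>)) ` ?T"
  define fib where "fib b = {\<tau> \<in> ?T. branch_set (J \<tau>) = b}" for b
  have sub: "b \<subseteq> orb ` I" if "b \<in> \<B>" for b
    using that cluster_I by (auto simp: \<B>_def branch_set_def)
  then have fin\<B>: "finite \<B>" using finI by (intro finite_subset[of \<B> "Pow (orb ` I)"]) auto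
  have fib: "finite (fib b) \<and> card (fib b) \<le> card b" if b: "b \<in> \<B>" for b
  proof -
    obtain \<tau> where "\<tau> \<in> ?T" "b = branch_set (J \<tau>)" using b unfolding \<B>_def by blast
    then show ?thesis
      using card_values_of_branch_set[OF J, of \<tau> "fib b"] J by (auto simp: fib_def)
  qed
  have T: "?T = (\<Union>b\<in>\<B>. fib b)" by (auto simp: \<B>_def fib_def)
  have fin: "finite ?T" unfolding T using fin\<B> fib by (intro finite_UN_I) blast+
  have "card ?T \<le> (\<Sum>b\<in>\<B>. card (fib b))" unfolding T using fin\<B> by (rule card_UN_le)
  also have "\<dots> \<le> (\<Sum>b\<in>\<B>. card b)" using fib by (intro sum_mono) blast
  also have "\<dots> = card (\<Union>\<B>)"
  proof (rule card_Union_disjoint[symmetric])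
    show "pairwise disjnt \<B>"
    proof (rule pairwiseI)
      fix b b' assume "b \<in> \<B>" "b' \<in> \<B>" "b \<noteq> b'"
      then obtain \<tau> \<tau>' where "\<tau> \<in> ?T" "\<tau>' \<in> ?T" "b = branch_set (J \<tau>)" "b' = branch_set (J \<tau>')"
        unfolding \<B>_def by blast
      then show "disjnt b b'"
        using branch_set_meet(2)[OF J J, of \<tau> \<tau>'] \<open>b \<noteq> b'\<close> unfolding disjnt_def by blast
    qed
    show "finite b" if "b \<in> \<B>" for b using sub[OF that] finI by (meson finite_imageI finite_subset)
  qed
  also have "\<dots> \<le> card (orb ` I)" using sub finI by (intro card_mono) auto
  finally show ?thesis using fin by simp
qed

end

section \<open>Squarefree parts\<close>

lemma degree_prod_mset_eq_0:
  fixes M :: "'a :: comm_semiring_1 poly multiset"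
  assumes "\<And>p. p \<in># M \<Longrightarrow> degree p = 0"
  shows "degree (prod_mset M) = 0"
  using assms
proof (induction M)
  case (add p M)
  then show ?case using degree_mult_le[of p "prod_mset M"] by simp
qed simp

lemma ex_prime_dvd_degree_pos:
  fixes g :: "complex poly poly"
  assumes "degree g > 0"
  shows "\<exists>\<pi>. prime_elem \<pi> \<and> \<pi> dvd g \<and> degree \<pi> > 0"
proof -
  have g0: "g \<noteq> 0" using assms by auto
  then have "normalize (prod_mset (prime_factorization g)) = normalize g"
    by (rule prod_mset_prime_factorization_weak)
  then have "prod_mset (prime_factorization g) dvd g" "g dvd prod_mset (prime_factorization g)"
    by (simp_all only: associated_iff_dvd)
  then have "degree (prod_mset (prime_factorization g)) > 0"
    using assms g0 dvd_imp_degree_le[of g "prod_mset (prime_factorization g)"]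
    by (metis dvd_0_left gr_zeroI leD)
  then obtain \<pi> where "\<pi> \<in> prime_factors g" "degree \<pi> > 0"
    using degree_prod_mset_eq_0 by (metis bot_nat_0.not_eq_extremum)
  then show ?thesis by (auto simp: in_prime_factors_iff prime_def)
qed

text \<open>\<open>r\<close> replaces a discriminant: it is an element of least degree in y of the
  ideal generated by \<open>q\<close> and its derivative. Over an x that is not a zero of
  \<open>r\<close>, the roots of \<open>q\<close> are simple, and they are the distinct roots of
  \<open>P\<close>.\<close>

lemma squarefree_part_exists:
  fixes P :: "complex poly poly"
  assumes "P \<noteq> 0"
  shows "\<exists>q k A B r. q dvd P \<and> P dvd q ^ k \<and> r \<noteq> 0 \<and> A * q + B * pderiv q = [:r:]"
proof -
  define Good where "Good q \<longleftrightarrow> q dvd P \<and> (\<exists>k. P dvd q ^ k)" for q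
  have "Good P" by (auto simp: Good_def intro!: exI[of _ 1])
  then obtain q where q: "Good q" "\<And>h. Good h \<Longrightarrow> degree q \<le> degree h"
    using ex_has_least_nat[of Good P degree] by blast
  have q0: "q \<noteq> 0" using q(1) assms by (auto simp: Good_def)
  define S where "S g \<longleftrightarrow> g \<noteq> 0 \<and> (\<exists>A B. g = A * q + B * pderiv q)" for g
  have "S q" using q0 unfolding S_def by (metis add.right_neutral mult_1 mult_zero_left)
  then obtain g where g: "S g" "\<And>g'. S g' \<Longrightarrow> degree g \<le> degree g'"
    using ex_has_least_nat[of S q degree] by blast
  obtain A B where AB: "g = A * q + B * pderiv q" "g \<noteq> 0" using g(1) by (auto simp: S_def)
  \<comment> \<open>The remainder of a pseudo-division stays in the ideal, so minimality of
    \<open>g\<close> makes it vanish: up to a nonzero factor in x alone, \<open>g\<close> divides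
    every element of the ideal.\<close>
  have dvd: "\<exists>a. a \<noteq> 0 \<and> g dvd [:a:] * f" if "f = C * q + D * pderiv q" for f C D
  proof -
    obtain u r where ur: "pseudo_divmod f g = (u, r)" by (cases "pseudo_divmod f g")
    define a where "a = lead_coeff g ^ (Suc (degree f) - degree g)"
    note pd = pseudo_divmod[OF AB(2) ur, folded a_def]
    have "r = [:a:] * f - g * u" using pd(1) by simp
    also have "\<dots> = ([:a:] * C - A * u) * q + ([:a:] * D - B * u) * pderiv q"
      by (simp only: that AB(1)) (simp add: algebra_simps)
    finally have "r = 0 \<or> S r" unfolding S_def by blast
    then have "r = 0" using pd(2) g(2)[of r] by auto
    then have "[:a:] * f = g * u" using pd(1) by simp
    then show ?thesis using AB(2) by (intro exI[of _ a]) (auto simp: a_def)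
  qed
  have "degree g = 0"
  proof (rule ccontr)
    assume "degree g \<noteq> 0"
    \<comment> \<open>A prime factor of positive degree divides \<open>q\<close> and its derivative,
      so it is repeated in \<open>q\<close>. Removing it once leaves an \<open>h\<close> of smaller
      degree that is still \<open>Good\<close>.\<close>
    then obtain \<pi> where \<pi>: "prime_elem \<pi>" "\<pi> dvd g" "degree \<pi> > 0"
      using ex_prime_dvd_degree_pos by blast
    have \<pi>dvd: "\<pi> dvd f" if f: "f = C * q + D * pderiv q" for f C D
    proof -
      obtain a where a: "a \<noteq> 0" "\<pi> dvd [:a:] * f" using dvd[OF f] \<pi>(2) dvd_trans by blast
      have "\<not> \<pi> dvd [:a:]" using a(1) \<pi>(3) dvd_imp_degree_le[of \<pi> "[:a:]"] by auto
      then show ?thesis using prime_elem_dvd_multD[OF \<pi>(1) a(2)] by blast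
    qed
    obtain h where h: "q = \<pi> * h" using \<pi>dvd[of q 1 0] by (auto elim: dvdE)
    have "\<pi> dvd pderiv q" by (rule \<pi>dvd[of _ 0 1]) simp
    then have "\<pi> dvd \<pi> * pderiv h + h * pderiv \<pi>" by (simp add: h pderiv_mult)
    then have "\<pi> dvd h * pderiv \<pi>" by (simp add: dvd_add_right_iff)
    moreover have "\<not> \<pi> dvd pderiv \<pi>"
    proof
      assume "\<pi> dvd pderiv \<pi>"
      moreover have "pderiv \<pi> \<noteq> 0" using \<pi>(3) by (simp add: pderiv_eq_0_iff)
      ultimately have "degree \<pi> \<le> degree (pderiv \<pi>)" by (rule dvd_imp_degree_le)
      then show False using \<pi>(3) by (simp add: degree_pderiv)
    qed
    ultimately have "\<pi> dvd h" using prime_elem_dvd_multD[OF \<pi>(1)] by blast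
    then have qh: "q dvd h ^ 2" unfolding h power2_eq_square by (intro mult_dvd_mono) auto
    obtain k where k: "q dvd P" "P dvd q ^ k" using q(1) by (auto simp: Good_def)
    have "P dvd h ^ (2 * k)"
      using k(2) dvd_power_same[OF qh, of k] by (auto simp: power_mult intro: dvd_trans)
    moreover have "h dvd P" using k(1) h by (auto intro: dvd_trans)
    ultimately have "Good h" by (auto simp: Good_def)
    then have "degree q \<le> degree h" by (rule q(2))
    moreover have "degree q = degree \<pi> + degree h"
      using q0 h by (auto simp: degree_mult_eq)
    ultimately show False using \<pi>(3) by simp
  qed
  then obtain r where "g = [:r:]" using degree_eq_zeroE by blast
  then show ?thesis using q(1) AB unfolding Good_def by (metis pCons_0_0)
qed

section \<open>Puiseux parametrization of the roots\<close>

lemma eval2_mult: "eval2 (p * q) x y = eval2 p x y * eval2 q x y"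
  by (simp add: eval2_def)
lemma eval2_add: "eval2 (p + q) x y = eval2 p x y + eval2 q x y"
  by (simp add: eval2_def)
lemma eval2_power: "eval2 (p ^ n) x y = eval2 p x y ^ n"
  by (simp add: eval2_def)
lemma eval2_const: "eval2 [:r:] x y = poly r x"
  by (simp add: eval2_def)
lemma eval2_pCons: "eval2 (pCons a p) x y = poly a x + y * eval2 p x y"
  by (simp add: eval2_def)

lemma continuous_on_eval2 [continuous_intros]:
  "continuous_on S f \<Longrightarrow> continuous_on S g \<Longrightarrow> continuous_on S (\<lambda>z. eval2 p (f z) (g z))"
  by (induction p) (auto simp: eval2_pCons eval2_def[of 0] intro!: continuous_intros)

lemma holomorphic_on_eval2 [holomorphic_intros]:
  "f holomorphic_on S \<Longrightarrow> g holomorphic_on S \<Longrightarrow> (\<lambda>z. eval2 p (f z) (g z)) holomorphic_on S"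
  by (induction p) (auto simp: eval2_pCons eval2_def[of 0] intro!: holomorphic_intros)

definition fiber :: "complex poly poly \<Rightarrow> complex \<Rightarrow> complex poly" where
  "fiber p x = map_poly (\<lambda>a. poly a x) p"

lemma coeff_fiber: "coeff (fiber p x) n = poly (coeff p n) x"
  by (simp add: fiber_def coeff_map_poly)

lemma fiber_pCons: "fiber (pCons a p) x = pCons (poly a x) (fiber p x)"
  by (rule poly_eqI) (simp add: coeff_fiber coeff_pCons split: nat.split)

lemma poly_fiber: "poly (fiber p x) y = eval2 p x y"
proof (induction p)
  case 0
  have "fiber 0 x = 0" by (simp add: fiber_def)
  then show ?case by (simp add: eval2_def)
qed (simp add: fiber_pCons eval2_pCons)

lemma pderiv_fiber: "pderiv (fiber p x) = fiber (pderiv p) x"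
  by (rule poly_eqI) (simp add: coeff_fiber coeff_pderiv)

lemma degree_fiber:
  assumes "lead_coeff p = [:c:]" "c \<noteq> 0"
  shows "degree (fiber p x) = degree p" "lead_coeff (fiber p x) = c"
proof -
  have c: "coeff (fiber p x) (degree p) = c" using assms by (simp add: coeff_fiber)
  have "degree (fiber p x) \<le> degree p" by (rule degree_le) (simp add: coeff_fiber coeff_eq_0)
  then show "degree (fiber p x) = degree p" using c assms(2) le_degree[of "fiber p x" "degree p"] by simp
  then show "lead_coeff (fiber p x) = c" using c by simp
qed

lemma rsquarefree_complex_roots:
  fixes p :: "complex poly"
  assumes "rsquarefree p"
  shows "poly p y = lead_coeff p * (\<Prod>w\<in>{w. poly p w = 0}. y - w)"
    and "card {w. poly p w = 0} = degree p"
proof -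
  have p: "smult (lead_coeff p) (\<Prod>z|poly p z = 0. [:-z, 1:]) = p"
    using assms by (rule complex_poly_decompose_rsquarefree)
  have "poly p y = poly (smult (lead_coeff p) (\<Prod>z|poly p z = 0. [:-z, 1:])) y" by (simp add: p)
  then show "poly p y = lead_coeff p * (\<Prod>w\<in>{w. poly p w = 0}. y - w)"
    by (simp add: poly_prod)
  have "p \<noteq> 0" using assms by (simp add: rsquarefree_def)
  have "degree p = degree (\<Prod>z|poly p z = 0. [:-z, 1:])"
    using \<open>p \<noteq> 0\<close> by (subst p[symmetric]) simp
  also have "\<dots> = card {w. poly p w = 0}" by (simp add: degree_prod_eq_sum_degree)
  finally show "card {w. poly p w = 0} = degree p" ..
qed

text \<open>The substitution x = exp s unrolls a punctured neighbourhood of infinity into a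
  half-plane. This is simply connected, so the roots can be continued globally, and a turn around
  infinity becomes the shift of s by 2 pi i.\<close>

locale covering_poly =
  fixes q :: "complex poly poly" and c :: complex and L :: real
  assumes lc: "lead_coeff q = [:c:]" "c \<noteq> 0" and deg: "degree q > 0"
    and simple: "\<And>s y. Re s > L \<Longrightarrow> eval2 q (exp s) y = 0 \<Longrightarrow> eval2 (pderiv q) (exp s) y \<noteq> 0"
begin

definition H where "H = {s. Re s > L}"
definition roots where "roots s = {y. eval2 q (exp s) y = 0}"
definition E where "E = {(s, y). s \<in> H \<and> y \<in> roots s}"

lemma open_H: "open H" unfolding H_def by (rule open_halfspace_Re_gt)
lemma convex_H: "convex H" unfolding H_def by (rule convex_halfspace_Re_gt)

lemma roots_fiber: "roots s = {y. poly (fiber q (exp s)) y = 0}"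
  by (simp add: roots_def poly_fiber)

lemma roots_props:
  assumes "s \<in> H"
  shows "eval2 q (exp s) y = c * (\<Prod>w\<in>roots s. y - w)" "card (roots s) = degree q" "finite (roots s)"
proof -
  have "rsquarefree (fiber q (exp s))"
    using simple assms by (auto simp: rsquarefree_roots poly_fiber pderiv_fiber H_def)
  note r = rsquarefree_complex_roots[OF this, folded roots_fiber]
  show "eval2 q (exp s) y = c * (\<Prod>w\<in>roots s. y - w)" "card (roots s) = degree q"
    using r by (simp_all add: degree_fiber(1)[OF lc] coeff_fiber lc poly_fiber)
  then show "finite (roots s)" using deg card_ge_0_finite by force
qed

text \<open>If all roots were at distance at least \<epsilon>, the factorisation into linear factors
  would bound |q| from below. Continuity of the roots in s rests on this.\<close>

lemma near_root:
  assumes "s \<in> H" "\<epsilon> > 0" "norm (eval2 q (exp s) y) < norm c * \<epsilon> ^ degree q"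
  shows "\<exists>w\<in>roots s. dist y w < \<epsilon>"
proof (rule ccontr)
  assume "\<not> ?thesis"
  then have "(\<Prod>w\<in>roots s. \<epsilon>) \<le> (\<Prod>w\<in>roots s. norm (y - w))"
    using assms(2) by (intro prod_mono) (auto simp: dist_norm not_less)
  then have "norm c * \<epsilon> ^ degree q \<le> norm (eval2 q (exp s) y)"
    using roots_props[OF assms(1)] by (simp add: norm_mult prod_norm mult_left_mono)
  then show False using assms(3) by simp
qed

lemma open_near_root:
  assumes "\<epsilon> > 0"
  shows "open {s \<in> H. norm (eval2 q (exp s) y) < norm c * \<epsilon> ^ degree q}"
proof -
  have "open ({s. norm (eval2 q (exp s) y) < norm c * \<epsilon> ^ degree q})"
    by (intro open_Collect_less continuous_intros)
  then have "open (H \<inter> {s. norm (eval2 q (exp s) y) < norm c * \<epsilon> ^ degree q})"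
    using open_H by blast
  then show ?thesis by (simp add: Collect_conj_eq)
qed

text \<open>The balls are disjoint because \<open>r\<close> is half a lower bound for the distances
  between roots over \<open>s0\<close>. For nearby s each contains a root by
  \<open>near_root\<close>, and as the number of roots is constant, each contains exactly
  one.\<close>

lemma local_roots:
  assumes s0: "s0 \<in> H"
  obtains T r where "open T" "s0 \<in> T" "T \<subseteq> H" "r > 0"
    "\<And>s y. s \<in> T \<Longrightarrow> y \<in> roots s0 \<Longrightarrow> \<exists>!w. w \<in> roots s \<inter> ball y r"
    "\<And>s w. s \<in> T \<Longrightarrow> w \<in> roots s \<Longrightarrow> \<exists>y\<in>roots s0. w \<in> ball y r"
    "\<And>y y'. y \<in> roots s0 \<Longrightarrow> y' \<in> roots s0 \<Longrightarrow> y \<noteq> y' \<Longrightarrow> ball y r \<inter> ball y' r = {}"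
proof -
  note fin = roots_props(3)[OF s0]
  obtain d where d: "d > 0" "\<And>y y'. y \<in> roots s0 \<Longrightarrow> y' \<in> roots s0 \<Longrightarrow> y \<noteq> y' \<Longrightarrow> d \<le> dist y y'"
  proof -
    let ?D = "(\<lambda>(y, y'). dist y y') ` {(y, y'). y \<in> roots s0 \<and> y' \<in> roots s0 \<and> y \<noteq> y'}"
    have f: "finite ?D"
      by (rule finite_imageI, rule finite_subset[of _ "roots s0 \<times> roots s0"]) (use fin in auto)
    then have "\<exists>d>0. \<forall>x\<in>?D. d \<le> x"
      by (intro exI[of _ "Min (insert 1 ?D)"]) auto
    then show ?thesis using that by fast
  qed
  define r where "r = d / 2"
  have r: "r > 0" using d by (simp add: r_def)
  define T where "T = H \<inter> (\<Inter>y\<in>roots s0. {s \<in> H. norm (eval2 q (exp s) y) < norm c * r ^ degree q})"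
  have disj: "ball y r \<inter> ball y' r = {}" if "y \<in> roots s0" "y' \<in> roots s0" "y \<noteq> y'" for y y'
    using d(2)[OF that] by (intro disjoint_ballI) (simp add: r_def)
  show ?thesis
  proof (rule that[of T r])
    show "open T" unfolding T_def
      using fin open_H by (intro open_Int open_INT open_near_root r ballI)
    show "s0 \<in> T" using s0 r lc by (auto simp: T_def roots_def)
    show "T \<subseteq> H" by (auto simp: T_def)
    show "r > 0" by (fact r)
    fix s assume s: "s \<in> T"
    have sH: "s \<in> H" using s by (simp add: T_def)
    have "\<exists>w\<in>roots s. w \<in> ball y r" if "y \<in> roots s0" for y
      using near_root[OF sH r, of y] s that by (auto simp: T_def)
    then obtain u where u: "\<And>y. y \<in> roots s0 \<Longrightarrow> u y \<in> roots s" "\<And>y. y \<in> roots s0 \<Longrightarrow> u y \<in> ball y r"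
      by metis
    have inj: "inj_on u (roots s0)"
      using disj u by (intro inj_onI) (metis IntI empty_iff)
    have img: "u ` roots s0 = roots s"
      using u inj roots_props[OF sH] roots_props[OF s0]
      by (intro card_subset_eq) (auto simp: card_image)
    show "\<exists>y\<in>roots s0. w \<in> ball y r" if "w \<in> roots s" for w
      using that img u(2) by (metis imageE)
    show "\<exists>!w. w \<in> roots s \<inter> ball y r" if y: "y \<in> roots s0" for y
    proof (rule ex1I[of _ "u y"])
      show "u y \<in> roots s \<inter> ball y r" using u y by blast
      fix w assume w: "w \<in> roots s \<inter> ball y r"
      then obtain y' where "y' \<in> roots s0" "w = u y'" using img by blast
      then show "w = u y" using w u disj y by (metis IntE IntI empty_iff)
    qed
  qed (use disj in blast)
qed

lemma covering: "covering_space E fst H"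
proof
  show "continuous_on E fst" by (intro continuous_intros)
  show "fst ` E = H"
  proof
    show "fst ` E \<subseteq> H" by (auto simp: E_def)
    show "H \<subseteq> fst ` E"
    proof
      fix s assume s: "s \<in> H"
      then have "roots s \<noteq> {}" using roots_props(2)[OF s] deg by auto
      then show "s \<in> fst ` E" using s by (force simp: E_def)
    qed
  qed
  fix s0 assume s0: "s0 \<in> H"
  obtain T r where T: "open T" "s0 \<in> T" "T \<subseteq> H" "r > 0"
    and ex1: "\<And>s y. s \<in> T \<Longrightarrow> y \<in> roots s0 \<Longrightarrow> \<exists>!w. w \<in> roots s \<inter> ball y r"
    and ex: "\<And>s w. s \<in> T \<Longrightarrow> w \<in> roots s \<Longrightarrow> \<exists>y\<in>roots s0. w \<in> ball y r"
    and disj: "\<And>y y'. y \<in> roots s0 \<Longrightarrow> y' \<in> roots s0 \<Longrightarrow> y \<noteq> y' \<Longrightarrow> ball y r \<inter> ball y' r = {}"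
    using local_roots[OF s0] by metis
  define v where "v = (\<lambda>y. E \<inter> (T \<times> ball y r)) ` roots s0"
  show "\<exists>T. s0 \<in> T \<and> openin (top_of_set H) T \<and>
      (\<exists>v. \<Union> v = E \<inter> fst -` T \<and> (\<forall>u\<in>v. openin (top_of_set E) u) \<and> pairwise disjnt v \<and>
        (\<forall>u\<in>v. Ex (homeomorphism u T fst)))"
  proof (intro exI[of _ T] exI[of _ v] conjI ballI)
    show "s0 \<in> T" by (fact T)
    show "openin (top_of_set H) T" using T by (auto intro: open_subset)
    show "\<Union> v = E \<inter> fst -` T" using ex T by (force simp: v_def E_def)
    show "openin (top_of_set E) u" if "u \<in> v" for u
      using that T by (auto simp: v_def intro!: openin_open_Int open_Times)
    show "pairwise disjnt v"
      unfolding v_def by (rule pairwise_imageI) (use disj in \<open>force simp: disjnt_def\<close>)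
    fix u assume "u \<in> v"
    then obtain y where y: "y \<in> roots s0" "u = E \<inter> (T \<times> ball y r)" by (auto simp: v_def)
    define w where "w s = (THE w. w \<in> roots s \<inter> ball y r)" for s
    have w: "w s \<in> roots s \<inter> ball y r" if "s \<in> T" for s
      unfolding w_def by (rule theI'[OF ex1[OF that y(1)]])
    have weq: "w' = w s" if "s \<in> T" "w' \<in> roots s \<inter> ball y r" for s w'
      using ex1[OF that(1) y(1)] w[OF that(1)] that(2) by blast
    have contw: "continuous_on T w"
      unfolding continuous_on_eq_continuous_at[OF T(1)]
    proof
      fix s1 assume s1: "s1 \<in> T"
      show "isCont w s1"
        unfolding continuous_at_eps_delta
      proof (intro allI impI)
        fix \<epsilon> :: real assume \<epsilon>: "\<epsilon> > 0"
        \<comment> \<open>Within \<epsilon>' of \<open>w s1\<close> one is still in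
          \<open>ball y r\<close>, where \<open>w s\<close> is the only root over s.\<close>
        define \<epsilon>' where "\<epsilon>' = min \<epsilon> (r - dist y (w s1))"
        have \<epsilon>': "\<epsilon>' > 0" using w[OF s1] \<epsilon> by (simp add: \<epsilon>'_def)
        let ?S = "T \<inter> {s \<in> H. norm (eval2 q (exp s) (w s1)) < norm c * \<epsilon>' ^ degree q}"
        have "open ?S" using T(1) open_near_root[OF \<epsilon>'] by (rule open_Int)
        moreover have "s1 \<in> ?S" using s1 T w[OF s1] lc \<epsilon>' by (auto simp: roots_def)
        ultimately obtain \<delta> where \<delta>: "\<delta> > 0" "ball s1 \<delta> \<subseteq> ?S" by (meson openE)
        have "dist (w s) (w s1) < \<epsilon>" if "dist s s1 < \<delta>" for s
        proof -
          have s: "s \<in> ?S" using that \<delta> by (auto simp: dist_commute)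
          then obtain w' where w': "w' \<in> roots s" "dist (w s1) w' < \<epsilon>'"
            using near_root[of s \<epsilon>' "w s1"] \<epsilon>' by blast
          then have "w' \<in> ball y r"
            using dist_triangle[of y w' "w s1"] by (simp add: \<epsilon>'_def)
          then have "w' = w s" using w' s by (intro weq) auto
          then show ?thesis using w' by (simp add: \<epsilon>'_def dist_commute)
        qed
        then show "\<exists>\<delta>>0. \<forall>s. dist s s1 < \<delta> \<longrightarrow> dist (w s) (w s1) < \<epsilon>" using \<delta>(1) by blast
      qed
    qed
    have "homeomorphism u T fst (\<lambda>s. (s, w s))"
    proof (rule homeomorphismI)
      show "continuous_on T (\<lambda>s. (s, w s))" by (intro continuous_intros contw)
      show "(\<lambda>s. (s, w s)) ` T \<subseteq> u" using w T(3) y by (fastforce simp: E_def)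
      show "(fst z, w (fst z)) = z" if "z \<in> u" for z
        using that y weq[of "fst z" "snd z"] by (auto simp: E_def)
    qed (use y in \<open>auto intro!: continuous_intros\<close>)
    then show "Ex (homeomorphism u T fst)" by blast
  qed
qed

lemma lift_exists:
  assumes "s0 \<in> H" "y \<in> roots s0"
  shows "\<exists>w. continuous_on H w \<and> w s0 = y \<and> (\<forall>s\<in>H. w s \<in> roots s)"
proof -
  obtain g where g: "continuous_on H g" "g \<in> H \<rightarrow> E" "g s0 = (s0, y)" "\<And>s. s \<in> H \<Longrightarrow> fst (g s) = s"
  proof (rule covering_space_lift_strong[OF covering, of "(s0, y)" s0 H "\<lambda>s. s"])
    show "simply_connected H" by (rule convex_imp_simply_connected[OF convex_H])
    show "locally path_connected H" by (rule convex_imp_locally_path_connected[OF convex_H])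
  qed (use assms in \<open>auto simp: E_def intro!: continuous_intros\<close>)
  have "snd (g s) \<in> roots s" if "s \<in> H" for s
    using g(2,4) that by (force simp: E_def Pi_def)
  then show ?thesis using g
    by (intro exI[of _ "\<lambda>s. snd (g s)"]) (auto intro!: continuous_intros)
qed

lemma lift_unique:
  assumes "continuous_on H w" "\<And>s. s \<in> H \<Longrightarrow> w s \<in> roots s"
    and "continuous_on H w'" "\<And>s. s \<in> H \<Longrightarrow> w' s \<in> roots s"
    and "s0 \<in> H" "w s0 = w' s0" "s \<in> H"
  shows "w s = w' s"
proof -
  have "(s, w s) = (s, w' s)"
  proof (rule covering_space_lift_unique[OF covering, of "\<lambda>s. (s, w s)" s0 "\<lambda>s. (s, w' s)" H "\<lambda>s. s"])
    show "connected H" by (rule convex_connected[OF convex_H])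
  qed (use assms in \<open>auto simp: E_def intro!: continuous_intros\<close>)
  then show ?thesis by simp
qed

end

context covering_poly
begin

lemma lifts:
  assumes s0: "s0 \<in> H"
  obtains w where "\<And>y. y \<in> roots s0 \<Longrightarrow> w y s0 = y"
    "\<And>y s. y \<in> roots s0 \<Longrightarrow> s \<in> H \<Longrightarrow> w y s \<in> roots s"
    "\<And>s. s \<in> H \<Longrightarrow> inj_on (\<lambda>y. w y s) (roots s0)"
    "\<And>s. s \<in> H \<Longrightarrow> (\<lambda>y. w y s) ` roots s0 = roots s"
    "\<And>y. y \<in> roots s0 \<Longrightarrow> w y holomorphic_on H"
proof -
  let ?Y = "roots s0"
  obtain w where w: "\<And>y. y \<in> ?Y \<Longrightarrow> continuous_on H (w y)" "\<And>y. y \<in> ?Y \<Longrightarrow> w y s0 = y"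
      "\<And>y s. y \<in> ?Y \<Longrightarrow> s \<in> H \<Longrightarrow> w y s \<in> roots s"
    using lift_exists[OF s0] by metis
  have inj: "inj_on (\<lambda>y. w y s) ?Y" if s: "s \<in> H" for s
  proof (rule inj_onI)
    fix y y' assume y: "y \<in> ?Y" "y' \<in> ?Y" "w y s = w y' s"
    have "w y s0 = w y' s0"
      by (rule lift_unique[of "w y" "w y'" s]) (use w y s s0 in auto)
    then show "y = y'" using w(2) y by simp
  qed
  have img: "(\<lambda>y. w y s) ` ?Y = roots s" if s: "s \<in> H" for s
    using w(3) s inj[OF s] roots_props[OF s] roots_props[OF s0]
    by (intro card_subset_eq) (auto simp: card_image)
  have hol: "w y holomorphic_on H" if y: "y \<in> ?Y" for y
    unfolding holomorphic_on_open[OF open_H]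
  proof
    fix s assume s: "s \<in> H"
    \<comment> \<open>With y frozen at \<open>w y s\<close>, \<open>Q\<close> is holomorphic in s'
      and equals (w y s - w y s') times \<open>D\<close>. \<open>D\<close> is nonzero near s since
      the roots are distinct, so the difference quotient of \<open>w y\<close> is that of
      \<open>Q\<close> divided by - \<open>D\<close>.\<close>
    define Q where "Q s' = eval2 q (exp s') (w y s)" for s'
    define D where "D s' = c * (\<Prod>y'\<in>?Y - {y}. w y s - w y' s')" for s'
    have fac: "Q s' = (w y s - w y s') * D s'" if "s' \<in> H" for s'
    proof -
      have "Q s' = c * (\<Prod>y'\<in>?Y. w y s - w y' s')"
        unfolding Q_def roots_props(1)[OF that] img[OF that, symmetric]
        by (subst prod.reindex[OF inj[OF that]]) simp
      also have "\<dots> = c * ((w y s - w y s') * (\<Prod>y'\<in>?Y - {y}. w y s - w y' s'))"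
        using y roots_props(3)[OF s0] by (subst prod.remove[of _ y]) auto
      finally show ?thesis by (simp add: D_def)
    qed
    have wlim: "(w y' \<longlongrightarrow> w y' s) (at s)" if "y' \<in> ?Y" for y'
      using w(1)[OF that] s open_H by (simp add: continuous_on_eq_continuous_at isCont_def)
    have "(D \<longlongrightarrow> D s) (at s)"
      unfolding D_def using wlim by (intro tendsto_intros) auto
    moreover have "D s \<noteq> 0"
      using lc(2) roots_props(3)[OF s0] inj_onD[OF inj[OF s]] y by (auto simp: D_def)
    ultimately have D: "(D \<longlongrightarrow> D s) (at s)" "D s \<noteq> 0" "\<forall>\<^sub>F s' in at s. D s' \<noteq> 0"
      by (auto intro: tendsto_imp_eventually_ne)
    have "Q field_differentiable at s"
      unfolding Q_def by (rule holomorphic_on_imp_differentiable_at[of _ UNIV]) (auto intro!: holomorphic_intros)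
    then obtain Q' where "(Q has_field_derivative Q') (at s)" by (auto simp: field_differentiable_def)
    then have Q': "((\<lambda>s'. (Q s' - Q s) / (s' - s)) \<longlongrightarrow> Q') (at s)" by (simp add: has_field_derivative_iff)
    have "((\<lambda>s'. - ((Q s' - Q s) / (s' - s)) / D s') \<longlongrightarrow> - Q' / D s) (at s)"
      by (intro tendsto_intros Q' D)
    then have "((\<lambda>s'. (w y s' - w y s) / (s' - s)) \<longlongrightarrow> - Q' / D s) (at s)"
    proof (rule Lim_transform_eventually)
      have "\<forall>\<^sub>F s' in at s. s' \<in> H" using s open_H by (simp add: eventually_at_topological) blast
      then show "\<forall>\<^sub>F s' in at s. - ((Q s' - Q s) / (s' - s)) / D s' = (w y s' - w y s) / (s' - s)"
        using D(3)
      proof eventually_elim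
        case (elim s')
        have "Q s = 0" using fac[OF s] by simp
        then have e: "Q s' - Q s = - ((w y s' - w y s) * D s')"
          using fac[OF elim(1)] by (simp add: algebra_simps)
        show ?case unfolding e using elim(2) by simp
      qed
    qed
    then show "\<exists>f'. (w y has_field_derivative f') (at s)" by (auto simp: has_field_derivative_iff)
  qed
  show ?thesis using that w inj img hol by blast
qed

text \<open>The monodromy permutes the finitely many roots over \<open>s0\<close>, so some power n
  of it is the identity and the continued roots depend only on t = exp (- s / n). By the linear
  growth bound t^n times a root is bounded near t = 0, and the singularity is removable.\<close>

lemma puiseux_parametrization:
  assumes K: "K \<ge> 0" and growth: "\<forall>x y. eval2 q x y = 0 \<longrightarrow> norm y \<le> K * (1 + norm x)"
  shows "\<exists>(W :: complex set) \<psi> \<sigma> N \<zeta> \<rho>. finite W \<and> card W = degree q \<and> N > 0 \<and> \<rho> > 0 \<and>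
    \<zeta> ^ N = 1 \<and> (\<forall>u. u ^ N = 1 \<longrightarrow> (\<exists>k. u = \<zeta> ^ k)) \<and>
    bij_betw \<sigma> W W \<and> (\<forall>l\<in>W. (\<sigma> ^^ N) l = l) \<and> (\<forall>l\<in>W. \<psi> l holomorphic_on ball 0 \<rho>) \<and>
    (\<forall>l\<in>W. \<forall>t\<in>ball 0 \<rho>. \<psi> (\<sigma> l) t = \<psi> l (\<zeta> * t)) \<and>
    (\<forall>t\<in>ball 0 \<rho> - {0}. inj_on (\<lambda>l. \<psi> l t) W \<and>
       {y. eval2 q (1 / t ^ N) y = 0} = (\<lambda>l. \<psi> l t / t ^ N) ` W)"
proof -
  define s0 where "s0 = complex_of_real (L + 1)"
  have s0: "s0 \<in> H" by (simp add: s0_def H_def)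
  let ?Y = "roots s0" and ?p = "2 * of_real pi * \<i>"
  obtain w where w0: "\<And>y. y \<in> ?Y \<Longrightarrow> w y s0 = y"
    and wr: "\<And>y s. y \<in> ?Y \<Longrightarrow> s \<in> H \<Longrightarrow> w y s \<in> roots s"
    and inj: "\<And>s. s \<in> H \<Longrightarrow> inj_on (\<lambda>y. w y s) ?Y"
    and img: "\<And>s. s \<in> H \<Longrightarrow> (\<lambda>y. w y s) ` ?Y = roots s"
    and hol: "\<And>y. y \<in> ?Y \<Longrightarrow> w y holomorphic_on H"
    using lifts[OF s0] by metis
  have finY: "finite ?Y" using roots_props[OF s0] by blast
  have shiftH: "s + ?p \<in> H" if "s \<in> H" for s using that by (simp add: H_def)
  have shift_roots: "roots (s + ?p) = roots s" for s by (simp add: roots_def exp_add)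
  \<comment> \<open>The identity outside the fibre makes \<open>\<sigma>\<close> a permutation of
    the whole type, so that it has a finite order.\<close>
  define \<sigma> where "\<sigma> y = (if y \<in> ?Y then w y (s0 + ?p) else y)" for y
  have \<sigma>Y: "\<sigma> y \<in> ?Y" if "y \<in> ?Y" for y
    using wr[OF that shiftH[OF s0]] that by (simp add: \<sigma>_def shift_roots)
  have shift: "w y (s + ?p) = w (\<sigma> y) s" if y: "y \<in> ?Y" and s: "s \<in> H" for y s
  proof (rule lift_unique[of "\<lambda>s. w y (s + ?p)" "w (\<sigma> y)" s0])
    show "continuous_on H (\<lambda>s. w y (s + ?p))"
    proof (rule continuous_on_compose2[where g="w y" and f="\<lambda>s. s + ?p"])
      show "continuous_on H (w y)" by (rule holomorphic_on_imp_continuous_on[OF hol[OF y]])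
      show "(\<lambda>s. s + ?p) ` H \<subseteq> H" using shiftH by blast
    qed (intro continuous_intros)
    show "continuous_on H (w (\<sigma> y))"
      using holomorphic_on_imp_continuous_on[OF hol[OF \<sigma>Y[OF y]]] .
    show "w y (s + ?p) \<in> roots s" if "s \<in> H" for s
      using wr[OF y shiftH[OF that]] by (simp add: shift_roots)
    have "w (\<sigma> y) s0 = \<sigma> y" by (rule w0[OF \<sigma>Y[OF y]])
    also have "\<dots> = w y (s0 + ?p)" unfolding \<sigma>_def if_P[OF y] ..
    finally show "w y (s0 + ?p) = w (\<sigma> y) s0" ..
    show "w (\<sigma> y) s \<in> roots s" if "s \<in> H" for s by (rule wr[OF \<sigma>Y[OF y] that])
  qed (rule s0 s)+
  have \<sigma>inj: "inj_on \<sigma> ?Y"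
  proof (rule inj_onI)
    fix y y' assume "y \<in> ?Y" "y' \<in> ?Y" "\<sigma> y = \<sigma> y'"
    then show "y = y'" using inj_onD[OF inj[OF shiftH[OF s0]], of y y'] by (simp add: \<sigma>_def)
  qed
  have bij: "bij_betw \<sigma> ?Y ?Y"
    unfolding bij_betw_def using \<sigma>inj \<sigma>Y endo_inj_surj[OF finY _ \<sigma>inj] by blast
  have "\<sigma> permutes ?Y" using bij by (rule bij_imp_permutes) (simp add: \<sigma>_def)
  then have "permutation \<sigma>" using finY permutation_permutes by blast
  then obtain n where n: "(\<sigma> ^^ n) = id" "n > 0" by (rule permutation_is_nilpotent)
  have \<sigma>pow: "(\<sigma> ^^ k) y \<in> ?Y" if "y \<in> ?Y" for k y
    using that \<sigma>Y by (induction k) auto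
  have shift_pow: "w y (s + of_nat k * ?p) = w ((\<sigma> ^^ k) y) s" if y: "y \<in> ?Y" and s: "s \<in> H" for y s k
    using s
  proof (induction k arbitrary: s)
    case (Suc k)
    have "w y (s + of_nat (Suc k) * ?p) = w y ((s + ?p) + of_nat k * ?p)" by (simp add: algebra_simps)
    also have "\<dots> = w ((\<sigma> ^^ k) y) (s + ?p)" using Suc shiftH by simp
    also have "\<dots> = w (\<sigma> ((\<sigma> ^^ k) y)) s" using shift \<sigma>pow y Suc by simp
    finally show ?case by simp
  qed simp
  have shift_n: "w y (s + of_nat (k * n) * ?p) = w y s" if "y \<in> ?Y" "s \<in> H" for y s k
  proof -
    have "\<sigma> ^^ (k * n) = id" using n(1) by (metis funpow_mult id_funpow mult.commute)
    then show ?thesis using shift_pow[OF that, of "k * n"] by simp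
  qed
  define t_of where "t_of s = exp (- s / of_nat n)" for s :: complex
  have period: "w y s = w y s'" if y: "y \<in> ?Y" and s: "s \<in> H" "s' \<in> H" and eq: "t_of s = t_of s'" for y s s'
  proof -
    obtain m :: int where "- s / of_nat n = - s' / of_nat n + (of_int (2 * m) * pi) * \<i>"
      using eq unfolding t_of_def exp_eq by blast
    then have "s' = s + of_int m * of_nat n * ?p"
      using n(2) by (simp add: field_simps)
    then show ?thesis
    proof (cases "m \<ge> 0")
      case True
      then obtain k where "m = int k" using nonneg_int_cases by blast
      then show ?thesis using shift_n[OF y s(1), of k] \<open>s' = _\<close> by simp
    next
      case False
      then obtain k where "m = - int k" by (metis int_cases2 nle_le of_nat_0_le_iff)
      then have "s = s' + of_nat (k * n) * ?p" using \<open>s' = _\<close> by simp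
      then show ?thesis using shift_n[OF y s(2), of k] by simp
    qed
  qed
  define \<rho> where "\<rho> = exp (- L / n)"
  have \<rho>: "\<rho> > 0" by (simp add: \<rho>_def)
  have norm_t_of: "norm (t_of s) < \<rho> \<longleftrightarrow> s \<in> H" for s
    using n(2) by (simp add: t_of_def \<rho>_def H_def divide_less_cancel)
  have exp_t_of: "exp s = 1 / t_of s ^ n" for s
  proof -
    have "exp s = exp (s / of_nat n) ^ n" using n(2) by (simp flip: exp_of_nat_mult)
    then show ?thesis by (simp add: t_of_def exp_minus power_inverse field_simps)
  qed
  \<comment> \<open>\<open>S\<close> jumps on the branch cut of \<open>Ln\<close>, but
    \<open>w y (S t)\<close> does not, because \<open>w y\<close> has period 2 pi i n.\<close>
  define S where "S t = - of_nat n * Ln t" for t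
  have tS: "t_of (S t) = t" if "t \<noteq> 0" for t using that n(2) by (simp add: t_of_def S_def)
  have SH: "S t \<in> H" if "t \<in> ball 0 \<rho> - {0}" for t
    using that norm_t_of[of "S t"] by (simp add: tS)
  define \<phi> where "\<phi> y t = w y (S t)" for y t
  have \<phi>I: "\<phi> y (t_of s) = w y s" if "y \<in> ?Y" "s \<in> H" for y s
  proof -
    have nz: "t_of s \<noteq> 0" by (simp add: t_of_def)
    then have "S (t_of s) \<in> H" using that norm_t_of[of s] by (intro SH) simp
    then show ?thesis unfolding \<phi>_def by (rule period[OF that(1) _ that(2)]) (rule tS[OF nz])
  qed
  have \<phi>hol: "\<phi> y holomorphic_on ball 0 \<rho> - {0}" if y: "y \<in> ?Y" for y
    unfolding holomorphic_on_def
  proof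
    fix t0 :: complex assume t0: "t0 \<in> ball 0 \<rho> - {0}"
    define B where "B = ball 0 \<rho> \<inter> ball t0 (norm t0)"
    \<comment> \<open>A local substitute for \<open>S\<close> that is holomorphic near
      \<open>t0\<close>, since t / t0 has positive real part there.\<close>
    define u where "u t = - of_nat n * (Ln t0 + Ln (t / t0))" for t
    have pos: "Re (t / t0) > 0" if "t \<in> B" for t
    proof -
      have "norm (1 - t / t0) < 1"
      proof -
        have "1 - t / t0 = (t0 - t) / t0" using t0 by (simp add: field_simps)
        then show ?thesis using that t0 by (simp add: B_def norm_divide dist_norm divide_less_eq)
      qed
      then show ?thesis using abs_Re_le_cmod[of "1 - t / t0"] by simp
    qed
    have tu: "t_of (u t) = t" if "t \<in> B" for t
    proof -
      have "t / t0 \<noteq> 0" using pos[OF that] by auto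
      then show ?thesis using n(2) t0 by (simp add: t_of_def u_def exp_add)
    qed
    have "u holomorphic_on B"
      unfolding u_def using pos t0
      by (intro holomorphic_intros) (auto simp: complex_nonpos_Reals_iff not_le)
    then have "w y \<circ> u holomorphic_on B"
      using hol[OF y]
    proof (rule holomorphic_on_compose_gen)
      show "u ` B \<subseteq> H" using norm_t_of tu by (force simp: B_def)
    qed
    then have "\<phi> y holomorphic_on B"
    proof (rule holomorphic_transform)
      fix t assume t: "t \<in> B"
      then have "u t \<in> H" using norm_t_of[of "u t"] tu by (auto simp: B_def)
      then show "(w y \<circ> u) t = \<phi> y t" using \<phi>I[OF y, of "u t"] tu[OF t] by simp
    qed
    moreover have "open B" "t0 \<in> B" using t0 by (auto simp: B_def)
    ultimately have "\<phi> y field_differentiable at t0" using holomorphic_on_imp_differentiable_at by blast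
    then show "\<phi> y field_differentiable at t0 within ball 0 \<rho> - {0}"
      by (rule field_differentiable_at_within)
  qed
  have ext: "\<exists>g. g holomorphic_on ball 0 \<rho> \<and> (\<forall>t\<in>ball 0 \<rho> - {0}. g t = t ^ n * \<phi> y t)" if y: "y \<in> ?Y" for y
  proof (subst holomorphic_on_extend_bounded)
    show "(\<lambda>t. t ^ n * \<phi> y t) holomorphic_on ball 0 \<rho> - {0}"
      by (intro holomorphic_intros \<phi>hol[OF y])
    show "0 \<in> interior (ball (0 :: complex) \<rho>)" using \<rho> by simp
    have bound: "norm (t ^ n * \<phi> y t) \<le> K * (\<rho> ^ n + 1)" if t: "t \<in> ball 0 \<rho> - {0}" for t
    proof -
      have "eval2 q (exp (S t)) (\<phi> y t) = 0" using wr[OF y SH[OF t]] by (simp add: \<phi>_def roots_def)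
      then have "eval2 q (1 / t ^ n) (\<phi> y t) = 0" using t exp_t_of[of "S t"] tS by simp
      then have "norm (\<phi> y t) \<le> K * (1 + norm (1 / t ^ n))" using growth by blast
      then have "norm (t ^ n * \<phi> y t) \<le> norm (t ^ n) * (K * (1 + norm (1 / t ^ n)))"
        unfolding norm_mult by (intro mult_left_mono) auto
      also have "\<dots> = K * (norm t ^ n + norm t ^ n * (1 / norm t ^ n))"
        by (simp only: norm_divide norm_power norm_one distrib_left mult.left_commute mult.commute[of K "norm t ^ n"] mult_1_right)
      also have "\<dots> = K * (norm t ^ n + 1)" using t by simp
      also have "\<dots> \<le> K * (\<rho> ^ n + 1)"
        using K t by (intro mult_left_mono add_right_mono power_mono) auto
      finally show ?thesis .
    qed
    have "\<forall>\<^sub>F t in at 0. t \<in> ball 0 \<rho> - {0 :: complex}"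
      using \<rho> by (auto simp: eventually_at intro!: exI[of _ \<rho>])
    then show "\<exists>B. \<forall>\<^sub>F t in at 0. norm (t ^ n * \<phi> y t) \<le> B"
      using bound by (intro exI[of _ "K * (\<rho> ^ n + 1)"]) (rule eventually_mono)
  qed
  then obtain \<psi> where \<psi>: "\<And>y. y \<in> ?Y \<Longrightarrow> \<psi> y holomorphic_on ball 0 \<rho>"
      "\<And>y t. y \<in> ?Y \<Longrightarrow> t \<in> ball 0 \<rho> - {0} \<Longrightarrow> \<psi> y t = t ^ n * \<phi> y t"
    by metis
  \<comment> \<open>The factor by which t = exp (- s / n) changes when s grows by 2 pi i.\<close>
  define \<zeta> where "\<zeta> = exp (- ?p / of_nat n)"
  have norm_\<zeta>: "norm \<zeta> = 1" by (simp add: \<zeta>_def)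
  have \<zeta>n: "\<zeta> ^ n = 1"
  proof -
    have "\<zeta> ^ n = exp (of_nat n * (- ?p / of_nat n))" unfolding \<zeta>_def by (rule exp_of_nat_mult[symmetric])
    also have "of_nat n * (- ?p / of_nat n) = - ?p" using n(2) by simp
    finally show ?thesis by (simp add: exp_minus)
  qed
  have unity: "\<exists>k. u = \<zeta> ^ k" if "u ^ n = 1" for u
  proof -
    have "inverse u ^ n = 1" using that by (simp add: power_inverse)
    then have "inverse u \<in> {exp (2 * of_real pi * \<i> * of_nat k / of_nat n) | k. k < n}"
      using n(2) by (subst complex_roots_unity[symmetric]) auto
    then obtain k where "inverse u = exp (2 * of_real pi * \<i> * of_nat k / of_nat n)" by blast
    then have "u = exp (- (2 * of_real pi * \<i> * of_nat k / of_nat n))"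
      by (metis exp_minus inverse_inverse_eq)
    also have "\<dots> = \<zeta> ^ k" unfolding \<zeta>_def exp_of_nat_mult[symmetric] by (simp add: mult_ac)
    finally show ?thesis by blast
  qed
  have \<psi>\<sigma>0: "\<psi> (\<sigma> y) t = \<psi> y (\<zeta> * t)" if y: "y \<in> ?Y" and t: "t \<in> ball 0 \<rho> - {0}" for y t
  proof -
    have "t_of (S t + ?p) = \<zeta> * t"
    proof -
      have "t_of (S t + ?p) = t_of (S t) * \<zeta>"
        unfolding t_of_def \<zeta>_def exp_add[symmetric] by (simp only: minus_add_distrib add_divide_distrib)
      then show ?thesis using t by (simp add: tS)
    qed
    then have "\<phi> y (\<zeta> * t) = \<phi> (\<sigma> y) t"
      using \<phi>I[OF y shiftH[OF SH[OF t]]] shift[OF y SH[OF t]] by (simp add: \<phi>_def)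
    moreover have "\<zeta> * t \<in> ball 0 \<rho> - {0}" using t norm_\<zeta> by (auto simp: norm_mult)
    ultimately show ?thesis using \<psi>(2)[OF y] \<psi>(2)[OF \<sigma>Y[OF y] t] \<zeta>n by (simp add: power_mult_distrib)
  qed
  have \<psi>\<sigma>: "\<psi> (\<sigma> y) t = \<psi> y (\<zeta> * t)" if y: "y \<in> ?Y" and t: "t \<in> ball 0 \<rho>" for y t
  proof (cases "t = 0")
    case True
    have "(\<psi> y \<longlongrightarrow> \<psi> y 0) (at 0)" if "y \<in> ?Y" for y
      using holomorphic_on_imp_continuous_on[OF \<psi>(1)[OF that]] \<rho>
      by (simp add: continuous_on_eq_continuous_at isCont_def)
    note lim = this[OF y] this[OF \<sigma>Y[OF y]]
    have "((\<lambda>t. \<psi> y (\<zeta> * t)) \<longlongrightarrow> \<psi> y 0) (at 0)"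
      by (rule tendsto_at_0_rotate[OF lim(1)]) (use norm_\<zeta> in auto)
    then have "(\<psi> (\<sigma> y) \<longlongrightarrow> \<psi> y 0) (at 0)"
    proof (rule Lim_transform_eventually)
      show "\<forall>\<^sub>F t in at 0. \<psi> y (\<zeta> * t) = \<psi> (\<sigma> y) t"
        using \<rho> \<psi>\<sigma>0[OF y] by (auto simp: eventually_at intro!: exI[of _ \<rho>])
    qed
    then show ?thesis using lim(2) True tendsto_unique[OF trivial_limit_at] by auto
  qed (use \<psi>\<sigma>0 y t in auto)
  have rts: "inj_on (\<lambda>l. \<psi> l t) ?Y \<and> {y. eval2 q (1 / t ^ n) y = 0} = (\<lambda>l. \<psi> l t / t ^ n) ` ?Y"
    if t: "t \<in> ball 0 \<rho> - {0}" for t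
  proof
    show "inj_on (\<lambda>l. \<psi> l t) ?Y"
      using inj[OF SH[OF t]] \<psi>(2)[OF _ t] t by (auto simp: inj_on_def \<phi>_def)
    have "{y. eval2 q (1 / t ^ n) y = 0} = roots (S t)"
      using t exp_t_of[of "S t"] tS by (simp add: roots_def)
    also have "\<dots> = (\<lambda>l. \<phi> l t) ` ?Y" unfolding img[OF SH[OF t], symmetric] \<phi>_def ..
    also have "\<dots> = (\<lambda>l. \<psi> l t / t ^ n) ` ?Y"
      using \<psi>(2)[OF _ t] t by (intro image_cong) auto
    finally show "{y. eval2 q (1 / t ^ n) y = 0} = (\<lambda>l. \<psi> l t / t ^ n) ` ?Y" .
  qed
  have \<sigma>n: "(\<sigma> ^^ n) y = y" for y using n(1) by simp
  show ?thesis
    by (rule exI[of _ ?Y], rule exI[of _ \<psi>], rule exI[of _ \<sigma>], rule exI[of _ n], rule exI[of _ \<zeta>], rule exI[of _ \<rho>])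
       (use finY roots_props(2)[OF s0] n(2) \<rho> \<zeta>n unity bij \<sigma>n \<psi>(1) \<psi>\<sigma> rts in blast)
qed

end

section \<open>Bounds and multiplicities\<close>

text \<open>With \<open>pderiv_pow_order\<close>: the order of a root is the index of the first
  derivative that does not vanish there. Nonvanishing is an open condition, which makes the order
  upper semicontinuous in a parameter.\<close>

lemma pderiv_pow_root:
  fixes p :: "'a :: field_char_0 poly"
  assumes "p \<noteq> 0" "k < order y p"
  shows "poly ((pderiv ^^ k) p) y = 0"
  using assms
proof (induction k arbitrary: p)
  case 0
  then show ?case by (simp add: order_root)
next
  case (Suc k)
  then have 0: "order y p \<noteq> 0" by simp
  have "pderiv p \<noteq> 0"
  proof
    assume "pderiv p = 0"
    then obtain a where "p = [:a:]" by (metis degree_eq_zeroE pderiv_eq_0_iff)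
    then show False using 0 Suc.prems(1) by (simp add: order_0I)
  qed
  moreover have "order y p = Suc (order y (pderiv p))"
    using order_pderiv[OF Suc.prems(1), of y] 0 by (auto simp: order_root)
  ultimately have "poly ((pderiv ^^ k) (pderiv p)) y = 0"
    using Suc.prems by (intro Suc.IH) auto
  then show ?case by (simp add: funpow_swap1)
qed

lemma pderiv_pow_order:
  fixes p :: "'a :: field_char_0 poly"
  assumes "p \<noteq> 0"
  shows "poly ((pderiv ^^ order y p) p) y \<noteq> 0"
  using assms
proof (induction "order y p" arbitrary: p)
  case 0
  then show ?case using order_root[of p y] by simp
next
  case (Suc n)
  then have 1: "order y p = Suc (order y (pderiv p))"
    using order_pderiv[OF Suc.prems, of y] by (simp add: order_root)
  have "pderiv p \<noteq> 0"
  proof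
    assume "pderiv p = 0"
    then obtain a where "p = [:a:]" by (metis degree_eq_zeroE pderiv_eq_0_iff)
    then show False using Suc by (simp add: order_0I)
  qed
  then have "poly ((pderiv ^^ order y (pderiv p)) (pderiv p)) y \<noteq> 0"
    using Suc(2) 1 by (intro Suc(1)) auto
  then show ?case by (simp add: 1 funpow_swap1)
qed

text \<open>Either a critical point of \<open>p\<close> lies close to \<open>y\<close> relative to the distance \<open>\<delta>\<close> of \<open>y\<close> from
  the nearest root, or \<open>p'\<close> varies so little on the disc of radius \<open>\<delta>\<close> that integrating it up to
  that root bounds \<open>\<bar>p y\<bar>\<close> by a multiple of \<open>\<delta> * \<bar>p' y\<bar>\<close>.\<close>

lemma critical_point_near:
  fixes p :: "complex poly"
  assumes deg: "degree p > 0" and y: "poly p y \<noteq> 0" and \<epsilon>: "\<epsilon> > 0"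
  shows "\<exists>\<delta>>0. norm (lead_coeff p) * \<delta> ^ degree p \<le> norm (poly p y) \<and>
    (norm (poly p y) \<le> norm (poly (pderiv p) y) * \<delta> * (1 + 1 / \<epsilon>) ^ degree p \<or>
     (\<exists>v. poly (pderiv p) v = 0 \<and> norm (poly p v - poly p y) \<le> norm (poly p y) * ((1 + \<epsilon>) ^ degree p - 1)))"
proof -
  let ?d = "degree p"
  obtain w where w: "smult (lead_coeff p) (\<Prod>i<?d. [:- w i, 1:]) = p" by (rule complex_poly_decompose')
  have pw: "poly p z = lead_coeff p * (\<Prod>i<?d. z - w i)" for z
  proof -
    have "poly p z = poly (smult (lead_coeff p) (\<Prod>i<?d. [:- w i, 1:])) z" by (simp only: w)
    then show ?thesis by (simp add: poly_prod)
  qed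
  define \<delta> where "\<delta> = Min ((\<lambda>i. norm (y - w i)) ` {..<?d})"
  have ne: "(\<lambda>i. norm (y - w i)) ` {..<?d} \<noteq> {}" using deg by auto
  obtain i0 where i0: "i0 < ?d" "norm (y - w i0) = \<delta>"
    using Min_in[OF _ ne] unfolding \<delta>_def by auto
  have le: "\<delta> \<le> norm (y - w i)" if "i < ?d" for i
    unfolding \<delta>_def using that by (intro Min_le) auto
  have nz: "y - w i \<noteq> 0" if "i < ?d" for i using y that unfolding pw by auto
  have \<delta>: "\<delta> > 0" using i0 nz by auto
  have "\<delta> ^ ?d \<le> (\<Prod>i<?d. norm (y - w i))"
    using prod_mono[of "{..<?d}" "\<lambda>_. \<delta>" "\<lambda>i. norm (y - w i)"] le \<delta> by simp
  then have 1: "norm (lead_coeff p) * \<delta> ^ ?d \<le> norm (poly p y)"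
    unfolding pw norm_mult prod_norm[symmetric] by (intro mult_left_mono) auto
  show ?thesis
  proof (intro exI[of _ \<delta>] conjI \<delta> 1)
    show "norm (poly p y) \<le> norm (poly (pderiv p) y) * \<delta> * (1 + 1 / \<epsilon>) ^ ?d \<or>
     (\<exists>v. poly (pderiv p) v = 0 \<and> norm (poly p v - poly p y) \<le> norm (poly p y) * ((1 + \<epsilon>) ^ ?d - 1))"
    proof (cases "\<exists>v. poly (pderiv p) v = 0 \<and> norm (v - y) < \<epsilon> * \<delta>")
      case True
      then obtain v where v: "poly (pderiv p) v = 0" "norm (v - y) < \<epsilon> * \<delta>" by blast
      \<comment> \<open>Moving from \<open>y\<close> to \<open>v\<close> multiplies the factor of
        the root \<open>w i\<close> by 1 + \<open>u i\<close>, and |u i| \<le> \<epsilon> because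
        every root is at least \<delta> away from \<open>y\<close>.\<close>
      define u where "u i = (v - y) / (y - w i)" for i
      have u: "norm (u i) \<le> \<epsilon>" if "i < ?d" for i
      proof -
        have "norm (v - y) \<le> \<epsilon> * norm (y - w i)"
          using v(2) mult_left_mono[OF le[OF that], of \<epsilon>] \<epsilon> by linarith
        then show ?thesis using nz[OF that] by (simp add: u_def norm_divide divide_le_eq)
      qed
      have "poly p v = poly p y * (\<Prod>i<?d. 1 + u i)"
        unfolding pw mult.assoc prod.distrib[symmetric]
        by (intro arg_cong[where f="\<lambda>z. _ * z"] prod.cong refl) (use nz in \<open>auto simp: u_def field_simps\<close>)
      then have "poly p v - poly p y = poly p y * ((\<Prod>i<?d. 1 + u i) - 1)" by (simp add: algebra_simps)
      also have "norm \<dots> \<le> norm (poly p y) * ((\<Prod>i<?d. 1 + norm (u i)) - 1)"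
        unfolding norm_mult by (intro mult_left_mono norm_prod_minus1_le_prod_minus1) auto
      also have "\<dots> \<le> norm (poly p y) * ((1 + \<epsilon>) ^ ?d - 1)"
      proof -
        have "(\<Prod>i<?d. 1 + norm (u i)) \<le> (\<Prod>i<?d. 1 + \<epsilon>)" using u by (intro prod_mono) auto
        then show ?thesis by (intro mult_left_mono) auto
      qed
      finally show ?thesis using v(1) by blast
    next
      case False
      let ?p' = "pderiv p"
      obtain v where v: "smult (lead_coeff ?p') (\<Prod>i<degree ?p'. [:- v i, 1:]) = ?p'"
        by (rule complex_poly_decompose')
      have pv: "poly ?p' z = lead_coeff ?p' * (\<Prod>i<degree ?p'. z - v i)" for z
      proof -
        have "poly ?p' z = poly (smult (lead_coeff ?p') (\<Prod>i<degree ?p'. [:- v i, 1:])) z" by (simp only: v)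
        then show ?thesis by (simp add: poly_prod)
      qed
      have far: "\<epsilon> * \<delta> \<le> norm (y - v i)" if "i < degree ?p'" for i
      proof -
        have "poly ?p' (v i) = 0" unfolding pv using that by auto
        then show ?thesis using False by (auto simp: norm_minus_commute not_less)
      qed
      \<comment> \<open>All zeros of the derivative are at least \<epsilon> \<delta> away from
        \<open>y\<close>, so moving by at most \<delta> stretches the distance to each by at most
        the factor 1 + 1 / \<epsilon>.\<close>
      have bound: "norm (poly ?p' z) \<le> norm (poly ?p' y) * (1 + 1 / \<epsilon>) ^ ?d" if z: "z \<in> cball y \<delta>" for z
      proof -
        have "norm (z - v i) \<le> norm (y - v i) * (1 + 1 / \<epsilon>)" if i: "i < degree ?p'" for i
        proof -
          have "norm (z - v i) \<le> \<delta> + norm (y - v i)"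
            using z norm_triangle_ineq[of "z - y" "y - v i"] by (simp add: dist_norm norm_minus_commute)
          also have "\<delta> \<le> norm (y - v i) / \<epsilon>" using far[OF i] \<epsilon> by (simp add: field_simps)
          finally show ?thesis by (simp add: algebra_simps)
        qed
        then have "(\<Prod>i<degree ?p'. norm (z - v i)) \<le> (\<Prod>i<degree ?p'. norm (y - v i) * (1 + 1 / \<epsilon>))"
          by (intro prod_mono) auto
        also have "\<dots> = (\<Prod>i<degree ?p'. norm (y - v i)) * (1 + 1 / \<epsilon>) ^ degree ?p'"
          by (simp add: prod.distrib)
        also have "\<dots> \<le> (\<Prod>i<degree ?p'. norm (y - v i)) * (1 + 1 / \<epsilon>) ^ ?d"
          using \<epsilon> by (intro mult_left_mono power_increasing prod_nonneg) (auto simp: degree_pderiv)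
        finally have "(\<Prod>i<degree ?p'. norm (z - v i)) \<le> (\<Prod>i<degree ?p'. norm (y - v i)) * (1 + 1 / \<epsilon>) ^ ?d" .
        then show ?thesis
          unfolding pv norm_mult prod_norm[symmetric] mult.assoc by (intro mult_left_mono) auto
      qed
      have "norm (poly p (w i0) - poly p y) \<le> norm (poly ?p' y) * (1 + 1 / \<epsilon>) ^ ?d * norm (w i0 - y)"
        by (rule field_differentiable_bound[of "cball y \<delta>" _ "poly ?p'"])
           (use bound i0 \<delta> in \<open>auto simp: dist_norm norm_minus_commute intro!: DERIV_subset[OF poly_DERIV]\<close>)
      moreover have "poly p (w i0) = 0" unfolding pw using i0 by auto
      ultimately show ?thesis using i0(2) by (simp add: norm_minus_commute mult_ac)
    qed
  qed
qed

text \<open>What the shear achieves: since y^d occurs in top degree, the projective closure avoids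
  the point [0 : 1 : 0].\<close>

definition degree_bounded :: "complex poly poly \<Rightarrow> nat \<Rightarrow> complex \<Rightarrow> bool" where
  "degree_bounded g d c \<longleftrightarrow> (\<forall>i j. coeff (coeff g j) i \<noteq> 0 \<longrightarrow> i + j \<le> d) \<and> coeff g d = [:c:] \<and> c \<noteq> 0"

lemma degree_bounded_lead:
  assumes "degree_bounded g d c"
  shows "degree g = d" "lead_coeff g = [:c:]" "c \<noteq> 0"
proof -
  have "coeff g j = 0" if "j > d" for j
    using assms that unfolding degree_bounded_def by (metis leD le_add2 le_trans leading_coeff_0_iff)
  then have "degree g \<le> d" by (intro degree_le) auto
  moreover have "d \<le> degree g" using assms by (intro le_degree) (auto simp: degree_bounded_def)
  ultimately show "degree g = d" by simp
  then show "lead_coeff g = [:c:]" "c \<noteq> 0" using assms by (auto simp: degree_bounded_def)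
qed

lemma degree_bounded_pderiv:
  assumes "degree_bounded g d c" "d > 0"
  shows "degree_bounded (pderiv g) (d - 1) (of_nat d * c)"
proof -
  have "i + j \<le> d - 1" if "coeff (coeff (pderiv g) j) i \<noteq> 0" for i j
  proof -
    have "coeff (coeff g (Suc j)) i \<noteq> 0"
    proof
      assume "coeff (coeff g (Suc j)) i = 0"
      then have "coeff (coeff (pderiv g) j) i = 0"
        by (simp only: coeff_pderiv of_nat_poly) simp
      then show False using that by simp
    qed
    then have "i + Suc j \<le> d" using assms(1) unfolding degree_bounded_def by blast
    then show ?thesis by simp
  qed
  moreover have "coeff (pderiv g) (d - 1) = [:of_nat d * c:]"
    using assms by (simp add: coeff_pderiv degree_bounded_def of_nat_poly)
  ultimately show ?thesis using assms by (simp add: degree_bounded_def)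
qed

text \<open>Where y dominates x, each monomial other than y^d is at most |y|^d / K in absolute
  value, because it contains x or a lower power of y. \<open>K\<close> is so large that together
  they cost at most half of the leading term.\<close>

lemma eval2_lower_bound:
  assumes g: "degree_bounded g d c"
  shows "\<exists>K\<ge>1. \<forall>x y. norm y \<ge> K * (1 + norm x) \<longrightarrow> norm (eval2 g x y) \<ge> norm c / 2 * norm y ^ d"
proof -
  define S where "S = support2 g - {(0, d)}"
  define M where "M = (\<Sum>(i, j)\<in>S. norm (coeff (coeff g j) i))"
  define K where "K = 1 + 2 * M / norm c"
  have c: "c \<noteq> 0" "coeff g d = [:c:]" using g by (auto simp: degree_bounded_def)
  have M: "M \<ge> 0" unfolding M_def by (intro sum_nonneg) auto
  have K: "K \<ge> 1" using M c by (simp add: K_def)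
  have finS: "finite S" by (simp add: S_def finite_support2)
  have "norm (eval2 g x y) \<ge> norm c / 2 * norm y ^ d" if y: "norm y \<ge> K * (1 + norm x)" for x y
  proof -
    have Y: "norm y \<ge> K" "norm x \<le> norm y / K"
    proof -
      have "K * 1 \<le> K * (1 + norm x)" using K by (intro mult_left_mono) auto
      then show "norm y \<ge> K" using y by simp
      have "K * norm x \<le> norm y" using y K by (simp add: distrib_left)
      then show "norm x \<le> norm y / K" using K by (simp add: field_simps)
    qed
    have trm: "norm x ^ i * norm y ^ j \<le> norm y ^ d / K" if "(i, j) \<in> S" for i j
    proof -
      have ij: "i + j \<le> d" "i > 0 \<or> j < d"
        using g that by (auto simp: S_def support2_def degree_bounded_def) fastforce+
      show ?thesis
      proof (cases "i = 0")
        case True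
        then have "j < d" using ij by simp
        then have "norm y ^ j * K \<le> norm y ^ j * norm y" using Y by (intro mult_left_mono) auto
        also have "\<dots> = norm y ^ Suc j" by simp
        also have "\<dots> \<le> norm y ^ d" using \<open>j < d\<close> Y K by (intro power_increasing) auto
        finally show ?thesis using True K by (simp add: field_simps)
      next
        case False
        have "norm x ^ i * norm y ^ j \<le> (norm y / K) ^ i * norm y ^ j"
          using Y by (intro mult_right_mono power_mono) auto
        also have "\<dots> = norm y ^ (i + j) / K ^ i" by (simp add: power_divide power_add)
        also have "\<dots> \<le> norm y ^ (i + j) / K"
          using K False power_increasing[of 1 i K] by (intro divide_left_mono) auto
        also have "\<dots> \<le> norm y ^ d / K"
          using K Y ij by (intro divide_right_mono power_increasing) auto
        finally show ?thesis .
      qed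
    qed
    have "eval2 g x y = (\<Sum>(i, j)\<in>insert (0, d) S. coeff (coeff g j) i * x ^ i * y ^ j)"
    proof -
      have "insert (0, d) S = support2 g" using c by (auto simp: S_def support2_def)
      then show ?thesis by (simp only: eval2_altdef)
    qed
    also have "\<dots> = c * y ^ d + (\<Sum>(i, j)\<in>S. coeff (coeff g j) i * x ^ i * y ^ j)"
      using finS c by (subst sum.insert) (auto simp: S_def)
    finally have ev: "eval2 g x y = \<dots>" .
    have "norm (\<Sum>(i, j)\<in>S. coeff (coeff g j) i * x ^ i * y ^ j) \<le>
        (\<Sum>(i, j)\<in>S. norm (coeff (coeff g j) i) * (norm y ^ d / K))"
    proof (rule sum_norm_le)
      fix ij assume "ij \<in> S"
      then obtain i j where ij: "ij = (i, j)" "(i, j) \<in> S" by (cases ij) auto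
      have "norm (coeff (coeff g j) i) * (norm x ^ i * norm y ^ j) \<le>
          norm (coeff (coeff g j) i) * (norm y ^ d / K)"
        by (intro mult_left_mono trm ij) auto
      then show "norm (case ij of (i, j) \<Rightarrow> coeff (coeff g j) i * x ^ i * y ^ j) \<le>
          (case ij of (i, j) \<Rightarrow> norm (coeff (coeff g j) i) * (norm y ^ d / K))"
        by (simp only: ij prod.case norm_mult norm_power mult.assoc)
    qed
    also have "\<dots> = M * (norm y ^ d / K)"
      unfolding M_def sum_distrib_right by (intro sum.cong) auto
    also have "\<dots> = M / K * norm y ^ d" by simp
    also have "\<dots> \<le> norm c / 2 * norm y ^ d"
    proof (intro mult_right_mono)
      have "2 * M \<le> norm c * K" using c by (simp add: K_def distrib_left)
      then show "M / K \<le> norm c / 2" using K by (simp add: field_simps)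
    qed auto
    finally have "norm (\<Sum>(i, j)\<in>S. coeff (coeff g j) i * x ^ i * y ^ j) \<le> norm c / 2 * norm y ^ d" .
    then show ?thesis
      unfolding ev using norm_diff_ineq[of "c * y ^ d" "\<Sum>(i, j)\<in>S. coeff (coeff g j) i * x ^ i * y ^ j"]
      by (simp add: norm_mult norm_power)
  qed
  then show ?thesis using K by blast
qed

lemma eval2_root_bound:
  assumes "degree_bounded g d c"
  shows "\<exists>K\<ge>1. \<forall>x y. eval2 g x y = 0 \<longrightarrow> norm y \<le> K * (1 + norm x)"
proof -
  obtain K where K: "K \<ge> 1" "\<And>x y. norm y \<ge> K * (1 + norm x) \<Longrightarrow> norm (eval2 g x y) \<ge> norm c / 2 * norm y ^ d"
    using eval2_lower_bound[OF assms] by blast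
  have "norm y \<le> K * (1 + norm x)" if "eval2 g x y = 0" for x y
  proof (rule ccontr)
    assume *: "\<not> norm y \<le> K * (1 + norm x)"
    have "0 \<le> K * (1 + norm x)" using K(1) by simp
    then have "norm y > 0" using * by linarith
    then have "norm c / 2 * norm y ^ d > 0" using assms by (simp add: degree_bounded_def)
    then show False using K(2)[of x y] * that by simp
  qed
  then show ?thesis using K(1) by blast
qed

text \<open>The quotient has at worst a pole at 0, so it cannot approach \<tau> along a sequence
  without tending to it. This turns information along a sequence into a limit.\<close>

lemma tendsto_or_bounded_away:
  fixes h :: "complex \<Rightarrow> complex"
  assumes "h holomorphic_on ball 0 \<rho>" "\<rho> > 0"
  shows "((\<lambda>t. h t / t ^ M) \<longlongrightarrow> \<tau>) (at 0) \<or> (\<exists>\<epsilon>>0. \<forall>\<^sub>F t in at 0. norm (h t / t ^ M - \<tau>) \<ge> \<epsilon>)"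
proof -
  have "not_essential (\<lambda>t. h t / t ^ M) 0"
  proof (rule not_essential_divide)
    show "not_essential h 0" "isolated_singularity_at h 0"
      using assms by (auto intro!: not_essential_holomorphic[of _ "ball 0 \<rho>"] isolated_singularity_at_holomorphic[of _ "ball 0 \<rho>"] holomorphic_on_subset[OF assms(1)])
    have "(\<lambda>t. t ^ M) holomorphic_on (UNIV :: complex set)" by (intro holomorphic_intros)
    then show "not_essential (\<lambda>t. t ^ M) (0::complex)" "isolated_singularity_at (\<lambda>t. t ^ M) (0::complex)"
      by (auto intro!: not_essential_holomorphic[of _ UNIV] isolated_singularity_at_holomorphic[of _ UNIV] holomorphic_intros)
  qed
  then consider L where "((\<lambda>t. h t / t ^ M) \<longlongrightarrow> L) (at 0)" | "is_pole (\<lambda>t. h t / t ^ M) 0"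
    by (auto simp: not_essential_def)
  then show ?thesis
  proof cases
    case 1
    show ?thesis
    proof (cases "L = \<tau>")
      case False
      have "((\<lambda>t. norm (h t / t ^ M - \<tau>)) \<longlongrightarrow> norm (L - \<tau>)) (at 0)" by (intro tendsto_intros 1)
      then have "\<forall>\<^sub>F t in at 0. norm (h t / t ^ M - \<tau>) > norm (L - \<tau>) / 2"
        by (rule order_tendstoD) (use False in auto)
      then show ?thesis using False
        by (intro disjI2 exI[of _ "norm (L - \<tau>) / 2"]) (auto elim: eventually_mono)
    qed (use 1 in auto)
  next
    case 2
    then have "\<forall>\<^sub>F t in at 0. norm (h t / t ^ M) \<ge> norm \<tau> + 1"
      by (auto simp: is_pole_def filterlim_at_infinity[of 0] dest!: spec[of _ "norm \<tau> + 1"])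
         (smt (verit) norm_ge_zero)
    then have "\<forall>\<^sub>F t in at 0. norm (h t / t ^ M - \<tau>) \<ge> 1"
    proof eventually_elim
      case (elim t)
      then show ?case using norm_triangle_ineq2[of "h t / t ^ M" \<tau>] by linarith
    qed
    then show ?thesis by (intro disjI2 exI[of _ 1]) auto
  qed
qed

text \<open>The order of a polynomial at a continuously moving root is upper semicontinuous; as the orders
  of all roots add up to the constant degree, they are locally constant.\<close>

lemma puiseux_root_system:
  assumes g: "degree_bounded g d c" and d: "d > 0"
  obtains W :: "complex set" and \<psi> e \<sigma> N \<zeta> \<rho>
  where "root_system W \<psi> e \<sigma> N (N * d) \<zeta> \<rho>"
    and "\<And>u. u ^ N = 1 \<Longrightarrow> \<exists>k. u = \<zeta> ^ k"
    and "\<And>l. l \<in> W \<Longrightarrow> \<psi> l holomorphic_on ball 0 \<rho>"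
    and "(\<Sum>l\<in>W. e l) = d"
    and "\<And>t y. t \<in> ball 0 \<rho> - {0} \<Longrightarrow> eval2 g (1 / t ^ N) y = c * (\<Prod>l\<in>W. (y - \<psi> l t / t ^ N) ^ e l)"
    and "\<And>t v. t \<in> ball 0 \<rho> - {0} \<Longrightarrow> eval2 (pderiv g) (1 / t ^ N) v = 0 \<Longrightarrow> \<exists>l\<in>W. v = \<psi> l t / t ^ N"
proof -
  let ?g' = "pderiv g"
  \<comment> \<open>Roots and critical points are parametrised together, as roots of the squarefree
    part of this product; so they share \<open>N\<close> and the monodromy, and distinct series
    never meet for t \<noteq> 0.\<close>
  define P where "P = g * ?g'"
  note g' = degree_bounded_pderiv[OF g d]
  note lg = degree_bounded_lead[OF g] and lg' = degree_bounded_lead[OF g']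
  have c0: "c \<noteq> 0" and g0: "g \<noteq> 0" and g'0: "?g' \<noteq> 0" using lg lg' by auto
  have P0: "P \<noteq> 0" using g0 g'0 by (simp add: P_def)
  have lP: "lead_coeff P = [:c * (of_nat d * c):]"
    unfolding P_def lead_coeff_mult lg(2) lg'(2) by simp
  obtain q k A B r where q: "q dvd P" "P dvd q ^ k" "r \<noteq> 0" "A * q + B * pderiv q = [:r:]"
    using squarefree_part_exists[OF P0] by blast
  obtain u where u: "P = q * u" using q(1) by (elim dvdE)
  have "lead_coeff q * lead_coeff u = [:c * (of_nat d * c):]"
    using lP by (simp only: u lead_coeff_mult)
  then have "degree (lead_coeff q * lead_coeff u) = 0" by simp
  moreover have q0: "q \<noteq> 0" "u \<noteq> 0" using P0 u by auto
  ultimately have "degree (lead_coeff q) = 0" by (simp add: degree_mult_eq)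
  then obtain c' where c': "lead_coeff q = [:c':]" by (rule degree_eq_zeroE)
  have c'0: "c' \<noteq> 0"
  proof
    assume "c' = 0"
    then have "lead_coeff q = 0" using c' by simp
    then show False using q0 by simp
  qed
  have degq: "degree q > 0"
  proof (rule ccontr)
    assume "\<not> degree q > 0"
    then have "degree (q ^ k) = 0" by (simp add: degree_power_eq q0)
    moreover have "degree P \<le> degree (q ^ k)" using q(2) q0 by (intro dvd_imp_degree_le) auto
    moreover have "degree P = degree g + degree ?g'" unfolding P_def using g0 g'0 by (rule degree_mult_eq)
    ultimately show False using lg(1) d by simp
  qed
  have "bounded {x. poly r x = 0}" using q(3) by (intro finite_imp_bounded poly_roots_finite)
  then obtain R where "\<forall>x\<in>{x. poly r x = 0}. norm x \<le> R" unfolding bounded_iff by blast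
  then have R: "\<And>x. poly r x = 0 \<Longrightarrow> norm x \<le> R" by simp
  interpret cp: covering_poly q c' R
  proof
    fix s y assume s: "Re s > R" and y: "eval2 q (exp s) y = 0"
    show "eval2 (pderiv q) (exp s) y \<noteq> 0"
    proof
      assume y': "eval2 (pderiv q) (exp s) y = 0"
      have "poly r (exp s) = eval2 (A * q + B * pderiv q) (exp s) y" by (simp add: q(4) eval2_const)
      also have "\<dots> = 0" using y y' by (simp add: eval2_add eval2_mult)
      finally have "norm (exp s) \<le> R" by (rule R)
      \<comment> \<open>|exp s| = exp (Re s) \<ge> 1 + Re s > R puts exp s beyond all zeros of
        \<open>r\<close>.\<close>
      then show False using s exp_ge_add_one_self[of "Re s"] by simp
    qed
  qed (use c' c'0 degq in auto)
  obtain K1 K2 where K: "K1 \<ge> 1" "\<And>x y. eval2 g x y = 0 \<Longrightarrow> norm y \<le> K1 * (1 + norm x)"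
      "K2 \<ge> 1" "\<And>x y. eval2 ?g' x y = 0 \<Longrightarrow> norm y \<le> K2 * (1 + norm x)"
    using eval2_root_bound[OF g] eval2_root_bound[OF g'] by metis
  have q_iff: "eval2 q x y = 0 \<longleftrightarrow> eval2 g x y = 0 \<or> eval2 ?g' x y = 0" for x y
  proof -
    have 1: "eval2 q x y * eval2 u x y = eval2 g x y * eval2 ?g' x y"
      by (simp add: eval2_mult[symmetric] u[symmetric] P_def)
    obtain v where "q ^ k = P * v" using q(2) by (elim dvdE)
    then have 2: "eval2 q x y ^ k = eval2 g x y * eval2 ?g' x y * eval2 v x y"
      by (simp add: eval2_power[symmetric] eval2_mult[symmetric] P_def)
    show ?thesis
    proof
      assume "eval2 q x y = 0"
      then show "eval2 g x y = 0 \<or> eval2 ?g' x y = 0" using 1 by simp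
    next
      assume "eval2 g x y = 0 \<or> eval2 ?g' x y = 0"
      then have "eval2 q x y ^ k = 0" using 2 by auto
      then show "eval2 q x y = 0" by simp
    qed
  qed
  have growth: "\<forall>x y. eval2 q x y = 0 \<longrightarrow> norm y \<le> max K1 K2 * (1 + norm x)"
  proof (intro allI impI)
    fix x y assume qxy: "eval2 q x y = 0"
    have "K1 * (1 + norm x) \<le> max K1 K2 * (1 + norm x)" "K2 * (1 + norm x) \<le> max K1 K2 * (1 + norm x)"
      by (intro mult_right_mono; simp)+
    then show "norm y \<le> max K1 K2 * (1 + norm x)"
      using qxy K(2)[of x y] K(4)[of x y] unfolding q_iff by linarith
  qed
  have K0: "0 \<le> max K1 K2" using K(1) by simp
  obtain W :: "complex set" and \<psi> \<sigma> N \<zeta> \<rho> where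
    finW: "finite W" and "card W = degree q" and N: "N > 0" and \<rho>: "\<rho> > 0"
    and \<zeta>: "\<zeta> ^ N = 1" "\<forall>u. u ^ N = 1 \<longrightarrow> (\<exists>k. u = \<zeta> ^ k)"
    and bij: "bij_betw \<sigma> W W" and \<sigma>N: "\<forall>l\<in>W. (\<sigma> ^^ N) l = l"
    and hol0: "\<forall>l\<in>W. \<psi> l holomorphic_on ball 0 \<rho>"
    and \<psi>\<sigma>0: "\<forall>l\<in>W. \<forall>t\<in>ball 0 \<rho>. \<psi> (\<sigma> l) t = \<psi> l (\<zeta> * t)"
    and rts: "\<forall>t\<in>ball 0 \<rho> - {0}. inj_on (\<lambda>l. \<psi> l t) W \<and>
      {y. eval2 q (1 / t ^ N) y = 0} = (\<lambda>l. \<psi> l t / t ^ N) ` W"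
    using cp.puiseux_parametrization[OF K0 growth] by (elim exE conjE) (rule that; assumption)
  have hol: "\<psi> l holomorphic_on ball 0 \<rho>" if "l \<in> W" for l using hol0 that by blast
  have \<psi>\<sigma>: "\<psi> (\<sigma> l) t = \<psi> l (\<zeta> * t)" if "l \<in> W" "t \<in> ball 0 \<rho>" for l t
    using \<psi>\<sigma>0 that by blast
  have inj: "inj_on (\<lambda>l. \<psi> l t) W"
    and roots: "{y. eval2 q (1 / t ^ N) y = 0} = (\<lambda>l. \<psi> l t / t ^ N) ` W"
    if "t \<in> ball 0 \<rho> - {0}" for t
    using rts that by blast+
  define p where "p t = fiber g (1 / t ^ N)" for t
  define w where "w l t = \<psi> l t / t ^ N" for l t
  have p: "degree (p t) = d" "lead_coeff (p t) = c" "p t \<noteq> 0" for t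
  proof -
    note df = degree_fiber[OF lg(2,3), of "1 / t ^ N"]
    show "degree (p t) = d" "lead_coeff (p t) = c" using df lg(1) unfolding p_def by simp_all
    then show "p t \<noteq> 0" using c0 by auto
  qed
  have winj: "inj_on (\<lambda>l. w l t) W" if t: "t \<in> ball 0 \<rho> - {0}" for t
    using inj[OF t] t by (auto simp: inj_on_def w_def)
  have sub: "{y. poly (p t) y = 0} \<subseteq> (\<lambda>l. w l t) ` W" if "t \<in> ball 0 \<rho> - {0}" for t
    using roots[OF that] q_iff unfolding w_def p_def poly_fiber by blast
  define ord where "ord l t = order (w l t) (p t)" for l t
  have ord_sum: "(\<Sum>l\<in>W. ord l t) = d" if t: "t \<in> ball 0 \<rho> - {0}" for t
  proof -
    have "(\<Sum>l\<in>W. ord l t) = (\<Sum>y\<in>(\<lambda>l. w l t) ` W. order y (p t))"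
      by (simp add: ord_def sum.reindex[OF winj[OF t]])
    also have "\<dots> = degree (p t)" using p(3) finW sub[OF t] by (intro sum_order_complex) auto
    finally show ?thesis by (simp add: p)
  qed
  have fiber_pow: "(pderiv ^^ k) (fiber f x) = fiber ((pderiv ^^ k) f) x" for k f x
    by (induction k) (simp_all add: pderiv_fiber)
  have usc: "\<forall>\<^sub>F t in at t1 within ball 0 \<rho> - {0}. ord l t \<le> ord l t1"
    if l: "l \<in> W" and t1: "t1 \<in> ball 0 \<rho> - {0}" for l t1
  proof -
    define f where "f t = eval2 ((pderiv ^^ ord l t1) g) (1 / t ^ N) (w l t)" for t
    have ff: "f t = poly ((pderiv ^^ ord l t1) (p t)) (w l t)" for t
      by (simp add: f_def p_def fiber_pow poly_fiber)
    have "continuous_on (ball 0 \<rho> - {0}) f"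
      unfolding f_def w_def
      by (intro continuous_intros continuous_on_subset[OF holomorphic_on_imp_continuous_on[OF hol[OF l]]]) auto
    then have "(f \<longlongrightarrow> f t1) (at t1 within ball 0 \<rho> - {0})"
      using t1 by (simp add: continuous_on_def)
    moreover have "f t1 \<noteq> 0" unfolding ff ord_def using p(3) by (rule pderiv_pow_order)
    ultimately have "\<forall>\<^sub>F t in at t1 within ball 0 \<rho> - {0}. f t \<noteq> 0" by (rule tendsto_imp_eventually_ne)
    then show ?thesis
    proof eventually_elim
      case (elim t)
      then show ?case
        using pderiv_pow_root[OF p(3), of "ord l t1" "w l t" t] unfolding ff ord_def[of l t] by force
    qed
  qed
  have loc: "\<forall>\<^sub>F t in at t1 within ball 0 \<rho> - {0}. ord l t1 = ord l t"
    if l: "l \<in> W" and t1: "t1 \<in> ball 0 \<rho> - {0}" for l t1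
  proof -
    have "\<forall>\<^sub>F t in at t1 within ball 0 \<rho> - {0}. \<forall>l\<in>W. ord l t \<le> ord l t1"
      using usc t1 finW by (simp add: eventually_ball_finite)
    moreover have "\<forall>\<^sub>F t in at t1 within ball 0 \<rho> - {0}. t \<in> ball 0 \<rho> - {0}"
      by (simp add: eventually_at_filter)
    ultimately show ?thesis
    proof eventually_elim
      case (elim t)
      show ?case
      proof (rule ccontr)
        assume "ord l t1 \<noteq> ord l t"
        then have "ord l t < ord l t1" using elim(1) l by (metis nat_less_le)
        then have "(\<Sum>l\<in>W. ord l t) < (\<Sum>l\<in>W. ord l t1)"
          using finW l elim(1) by (intro sum_strict_mono_ex1) auto
        then show False using ord_sum[OF t1] ord_sum[OF elim(2)] by simp
      qed
    qed
  qed
  define t0 where "t0 = complex_of_real (\<rho> / 2)"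
  have t0: "t0 \<in> ball 0 \<rho> - {0}" using \<rho> by (simp add: t0_def)
  \<comment> \<open>Locally constant orders on the connected punctured disc are determined by one
    base point. Order 0 marks a critical point that is not a root.\<close>
  define e where "e l = ord l t0" for l
  have ord_eq: "ord l t = e l" if "l \<in> W" "t \<in> ball 0 \<rho> - {0}" for l t
    unfolding e_def
  proof (rule connected_local_const[OF _ that(2) t0])
    show "connected (ball 0 \<rho> - {0 :: complex})" by (intro connected_punctured_ball) simp
  qed (use loc that in blast)
  have esum: "(\<Sum>l\<in>W. e l) = d" using ord_sum[OF t0] by (simp add: e_def)
  have pt: "p t = smult c (\<Prod>l\<in>W. [:- w l t, 1:] ^ e l)" if t: "t \<in> ball 0 \<rho> - {0}" for t
  proof -
    have "p t = smult (lead_coeff (p t)) (\<Prod>z\<in>{z. poly (p t) z = 0}. [:- z, 1:] ^ order z (p t))"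
      by (rule complex_poly_decompose[symmetric])
    also have "(\<Prod>z\<in>{z. poly (p t) z = 0}. [:- z, 1:] ^ order z (p t)) =
        (\<Prod>z\<in>(\<lambda>l. w l t) ` W. [:- z, 1:] ^ order z (p t))"
      using sub[OF t] finW by (intro prod.mono_neutral_left) (auto simp: order_0I)
    also have "\<dots> = (\<Prod>l\<in>W. [:- w l t, 1:] ^ e l)"
      using ord_eq[OF _ t] by (simp add: prod.reindex[OF winj[OF t]] ord_def)
    finally show ?thesis unfolding p(2) .
  qed
  have evg: "eval2 g (1 / t ^ N) y = c * (\<Prod>l\<in>W. (y - w l t) ^ e l)"
    if t: "t \<in> ball 0 \<rho> - {0}" for t y
  proof -
    have "eval2 g (1 / t ^ N) y = poly (p t) y" by (simp add: p_def poly_fiber)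
    also have "\<dots> = c * (\<Prod>l\<in>W. (y - w l t) ^ e l)" by (simp add: pt[OF t] poly_prod)
    finally show ?thesis .
  qed
  have crit: "(\<Sum>i\<in>W. of_nat (e i) / (\<psi> l t - \<psi> i t)) = 0"
    if l: "l \<in> W" "e l = 0" and t: "t \<in> ball 0 \<rho> - {0}" for l t
  proof -
    have ne: "w l t \<noteq> w i t" if "i \<in> W" "e i > 0" for i
    proof
      assume "w l t = w i t"
      then have "l = i" using inj_onD[OF winj[OF t]] l that by blast
      then show False using l that by simp
    qed
    have nz: "(\<Prod>i\<in>W. (w l t - w i t) ^ e i) \<noteq> 0"
      using ne finW by auto
    have "eval2 q (1 / t ^ N) (w l t) = 0" using roots[OF t] l by (auto simp: w_def)
    moreover have "eval2 g (1 / t ^ N) (w l t) \<noteq> 0" unfolding evg[OF t] using nz c0 by simp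
    ultimately have "eval2 ?g' (1 / t ^ N) (w l t) = 0" unfolding q_iff by simp
    then have "poly (pderiv (p t)) (w l t) = 0" by (simp add: p_def pderiv_fiber poly_fiber)
    then have "(\<Sum>i\<in>W. of_nat (e i) / (w l t - w i t)) = 0"
      using nz c0 poly_pderiv_prod_linear[OF finW, of e "\<lambda>i. - w i t" "\<lambda>_. 1" "w l t"] ne
      by (simp add: pt[OF t] pderiv_smult)
    moreover have "of_nat (e i) / (w l t - w i t) = t ^ N * (of_nat (e i) / (\<psi> l t - \<psi> i t))" for i
      using t by (simp add: w_def flip: diff_divide_distrib)
    ultimately have "t ^ N * (\<Sum>i\<in>W. of_nat (e i) / (\<psi> l t - \<psi> i t)) = 0"
      by (simp only: sum_distrib_left)
    then show ?thesis using t by simp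
  qed
  have e\<sigma>: "e (\<sigma> l) = e l" if l: "l \<in> W" for l
  proof -
    have "norm \<zeta> ^ N = 1" using \<zeta>(1) by (metis norm_one norm_power)
    then have n\<zeta>: "norm \<zeta> = 1" using N power_eq_imp_eq_base[of "norm \<zeta>" N 1] by simp
    then have t1: "\<zeta> * t0 \<in> ball 0 \<rho> - {0}" using t0 by (auto simp: norm_mult)
    have "p (\<zeta> * t0) = p t0" "w (\<sigma> l) t0 = w l (\<zeta> * t0)"
      using \<psi>\<sigma>[OF l, of t0] t0 \<zeta>(1) by (auto simp: p_def w_def power_mult_distrib)
    then have "ord (\<sigma> l) t0 = ord l (\<zeta> * t0)" by (simp add: ord_def)
    then show ?thesis using ord_eq[OF l t1] by (simp add: e_def)
  qed
  have diff: "\<exists>n a. a \<noteq> 0 \<and> ((\<lambda>t. (\<psi> l t - \<psi> l' t) / t ^ n) \<longlongrightarrow> a) (at 0)"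
    if l: "l \<in> W" "l' \<in> W" "l \<noteq> l'" for l l'
  proof -
    \<comment> \<open>\<open>D\<close> has no zero off 0, so it vanishes at 0 to a finite order,
      possibly 0; this order and the leading coefficient are the required \<open>n\<close> and
      \<open>a\<close>.\<close>
    define D where "D t = \<psi> l t - \<psi> l' t" for t
    have Dhol: "D holomorphic_on ball 0 \<rho>" unfolding D_def using hol l by (intro holomorphic_intros)
    have Dnz: "D t \<noteq> 0" if "t \<in> ball 0 \<rho> - {0}" for t
      using inj_onD[OF inj[OF that]] l by (auto simp: D_def)
    show ?thesis
    proof (cases "D 0 = 0")
      case False
      have "(D \<longlongrightarrow> D 0) (at 0)"
        using holomorphic_on_imp_continuous_on[OF Dhol] \<rho>
        by (simp add: continuous_on_eq_continuous_at isCont_def)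
      then show ?thesis using False unfolding D_def[abs_def]
        by (intro exI[of _ 0] exI[of _ "\<psi> l 0 - \<psi> l' 0"]) simp
    next
      case True
      have "\<not> D constant_on ball 0 \<rho>"
      proof
        assume "D constant_on ball 0 \<rho>"
        then have "D t0 = D 0" using t0 \<rho> by (auto simp: constant_on_def)
        then show False using Dnz[OF t0] True by simp
      qed
      note nc = this
      obtain h r n where h: "0 < r" "h holomorphic_on ball 0 r"
          "\<And>t. t \<in> ball 0 r \<Longrightarrow> D t = (t - 0) ^ n * h t" "\<And>t. t \<in> ball 0 r \<Longrightarrow> h t \<noteq> 0"
      proof (rule holomorphic_factor_zero_nonconstant[OF Dhol open_ball connected_ball _ True])
        show "0 \<in> ball (0 :: complex) \<rho>" using \<rho> by simp
        show "\<not> D constant_on ball 0 \<rho>" by (fact nc)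
      qed blast
      have "(h \<longlongrightarrow> h 0) (at 0)"
        using holomorphic_on_imp_continuous_on[OF h(2)] h(1)
        by (simp add: continuous_on_eq_continuous_at isCont_def)
      then have "((\<lambda>t. D t / t ^ n) \<longlongrightarrow> h 0) (at 0)"
      proof (rule Lim_transform_eventually)
        show "\<forall>\<^sub>F t in at 0. h t = D t / t ^ n"
          using h(1,3) by (auto simp: eventually_at intro!: exI[of _ r])
      qed
      then show ?thesis using h(1) h(4)[of 0] unfolding D_def
        by (intro exI[of _ n] exI[of _ "h 0"]) simp
    qed
  qed
  have rs: "root_system W \<psi> e \<sigma> N (N * d) \<zeta> \<rho>"
  proof
    show "\<exists>l\<in>W. e l > 0"
    proof (rule ccontr)
      assume "\<not> ?thesis"
      then have "(\<Sum>l\<in>W. e l) = 0" by simp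
      then show False using esum d by simp
    qed
    show "\<psi> l t \<noteq> \<psi> l' t" if "l \<in> W" "l' \<in> W" "l \<noteq> l'" "t \<noteq> 0" "norm t < \<rho>" for l l' t
      using inj_onD[OF inj[of t]] that by auto
  qed (use finW N \<zeta> bij \<sigma>N \<rho> \<psi>\<sigma> e\<sigma> diff crit in auto)
  have cr: "\<exists>l\<in>W. v = \<psi> l t / t ^ N"
    if "t \<in> ball 0 \<rho> - {0}" "eval2 ?g' (1 / t ^ N) v = 0" for t v
    using roots[OF that(1)] that(2) q_iff by blast
  have ev: "eval2 g (1 / t ^ N) y = c * (\<Prod>l\<in>W. (y - \<psi> l t / t ^ N) ^ e l)"
    if "t \<in> ball 0 \<rho> - {0}" for t y
    using evg[OF that] by (simp add: w_def)
  show ?thesis by (rule that[OF rs \<zeta>(2)[rule_format] hol esum ev cr])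
qed

section \<open>Critical sequences and critical Puiseux series\<close>

locale puiseux_polynomial = root_system W \<psi> e \<sigma> N "N * d" \<zeta> c \<rho>
  for W :: "complex set" and \<psi> e \<sigma> N \<zeta> c \<rho> and g :: "complex poly poly" and d +
  assumes g: "degree_bounded g d c" and d: "d > 0"
    and unity: "\<And>u. u ^ N = 1 \<Longrightarrow> \<exists>k. u = \<zeta> ^ k"
    and hol: "\<And>l. l \<in> W \<Longrightarrow> \<psi> l holomorphic_on ball 0 \<rho>"
    and esum: "(\<Sum>l\<in>W. e l) = d"
    and g_eq: "\<And>t y. t \<in> ball 0 \<rho> - {0} \<Longrightarrow> eval2 g (1 / t ^ N) y = c * (\<Prod>l\<in>W. (y - \<psi> l t / t ^ N) ^ e l)"
    and g_crit: "\<And>t v. t \<in> ball 0 \<rho> - {0} \<Longrightarrow> eval2 (pderiv g) (1 / t ^ N) v = 0 \<Longrightarrow> \<exists>l\<in>W. v = \<psi> l t / t ^ N"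
begin

lemma G_eq:
  assumes "t \<in> ball 0 \<rho> - {0}"
  shows "G t \<mu> = eval2 g (1 / t ^ N) (\<mu> / t ^ N)"
proof -
  have "(\<Prod>l\<in>W. (\<mu> / t ^ N - \<psi> l t / t ^ N) ^ e l) = (\<Prod>l\<in>W. (\<mu> - \<psi> l t) ^ e l / (t ^ N) ^ e l)"
    by (simp add: diff_divide_distrib[symmetric] power_divide)
  also have "\<dots> = (\<Prod>l\<in>W. (\<mu> - \<psi> l t) ^ e l) / (\<Prod>l\<in>W. (t ^ N) ^ e l)"
    by (rule prod_dividef)
  also have "(\<Prod>l\<in>W. (t ^ N) ^ e l) = t ^ (N * d)"
    by (simp only: power_sum[symmetric] esum power_mult)
  finally show ?thesis unfolding g_eq[OF assms] G_def by simp
qed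

text \<open>If no critical series tends to \<tau>, then near infinity the values at all critical
  points off the zero set keep a distance \<open>\<epsilon>0\<close> from \<tau>. Far out on the
  sequence, \<open>critical_point_near\<close> either bounds |g| by a multiple of |g_y|, which tends
  to 0 while |g| does not, or yields a critical point whose value is too close to \<tau>.\<close>

lemma critical_sequence_good:
  assumes x: "filterlim (\<lambda>k. norm (x k)) at_top sequentially"
    and lim: "(\<lambda>k. eval2 g (x k) (y k)) \<longlonglongrightarrow> \<tau>" and lim': "(\<lambda>k. eval2 (pderiv g) (x k) (y k)) \<longlonglongrightarrow> 0"
    and \<tau>: "\<tau> \<noteq> 0"
  shows "\<exists>j. good j \<tau>"
proof (rule ccontr)
  assume no: "\<not> ?thesis"
  define J where "J = {j \<in> W. e j = 0}"
  have finJ: "finite J" using finW by (simp add: J_def)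
  have c0: "c \<noteq> 0" and lg: "degree g = d" "lead_coeff g = [:c:]"
    using degree_bounded_lead[OF g] by auto
  have "\<exists>\<epsilon>>0. \<forall>\<^sub>F t in at 0. norm (G t (\<psi> j t) - \<tau>) \<ge> \<epsilon>" if j: "j \<in> J" for j
  proof -
    define h where "h t = c * (\<Prod>l\<in>W. (\<psi> j t - \<psi> l t) ^ e l)" for t
    have "h holomorphic_on ball 0 \<rho>"
      unfolding h_def using hol j by (intro holomorphic_intros) (auto simp: J_def)
    note dich = tendsto_or_bounded_away[OF this \<rho>, of "N * d" \<tau>]
    have "h t / t ^ (N * d) = G t (\<psi> j t)" for t by (simp add: h_def G_def)
    then show ?thesis using dich no j \<tau> by (auto simp: good_def J_def)
  qed
  then obtain \<epsilon>f where \<epsilon>f: "\<And>j. j \<in> J \<Longrightarrow> \<epsilon>f j > 0"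
      "\<And>j. j \<in> J \<Longrightarrow> \<forall>\<^sub>F t in at 0. norm (G t (\<psi> j t) - \<tau>) \<ge> \<epsilon>f j" by metis
  define \<epsilon>0 where "\<epsilon>0 = Min (insert 1 (\<epsilon>f ` J))"
  have \<epsilon>0: "\<epsilon>0 > 0" and \<epsilon>0le: "\<And>j. j \<in> J \<Longrightarrow> \<epsilon>0 \<le> \<epsilon>f j"
    using finJ \<epsilon>f by (auto simp: \<epsilon>0_def)
  have "\<forall>\<^sub>F t in at 0. \<forall>j\<in>J. norm (G t (\<psi> j t) - \<tau>) \<ge> \<epsilon>f j"
    using finJ \<epsilon>f by (simp add: eventually_ball_finite)
  then have "\<forall>\<^sub>F t in at 0. (t \<noteq> 0 \<and> norm t < \<rho>) \<and> (\<forall>j\<in>J. norm (G t (\<psi> j t) - \<tau>) \<ge> \<epsilon>0)"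
    using ev_small by eventually_elim (use \<epsilon>0le in fastforce)
  then obtain r0 where r0: "r0 > 0" "\<And>t::complex. t \<noteq> 0 \<Longrightarrow> norm t < r0 \<Longrightarrow> norm t < \<rho>"
      "\<And>t j. t \<noteq> 0 \<Longrightarrow> norm t < r0 \<Longrightarrow> j \<in> J \<Longrightarrow> norm (G t (\<psi> j t) - \<tau>) \<ge> \<epsilon>0"
    unfolding eventually_at by auto
  \<comment> \<open>A relative error below \<open>m\<close> is below 1, so the critical value found
    is nonzero; and as |g| < |\<tau>| + 1, the absolute error is below \<open>\<epsilon>0\<close> /
    2.\<close>
  define m where "m = min 1 (\<epsilon>0 / 2 / (norm \<tau> + 1))"
  have m: "m > 0" using \<epsilon>0 by (simp add: m_def add_nonneg_pos)
  obtain \<epsilon> :: real where \<epsilon>: "\<epsilon> > 0" "(1 + \<epsilon>) ^ d - 1 < m"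
  proof -
    have "((\<lambda>\<epsilon>::real. (1 + \<epsilon>) ^ d - 1) \<longlongrightarrow> (1 + 0) ^ d - 1) (at_right 0)" by (intro tendsto_intros)
    then have "\<forall>\<^sub>F \<epsilon> in at_right 0. (1 + \<epsilon>) ^ d - 1 < m" using m by (intro order_tendstoD) auto
    moreover have "\<forall>\<^sub>F \<epsilon>::real in at_right 0. \<epsilon> > 0" by (simp add: eventually_at_filter)
    ultimately have "\<forall>\<^sub>F \<epsilon> in at_right 0. (1 + \<epsilon>) ^ d - 1 < m \<and> \<epsilon> > 0" by eventually_elim simp
    then show ?thesis using that eventually_happens[of _ "at_right (0::real)"] by force
  qed
  \<comment> \<open>Bounds the distance \<delta> to the nearest root, through |c| \<delta>^d \<le>
    |g| < |\<tau>| + 1. The summand 1 gives B \<ge> 1, so that \<delta> > B implies \<delta>^d \<ge>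
    \<delta>.\<close>
  define B where "B = (norm \<tau> + 1) / norm c + 1"
  have B: "B \<ge> 1" unfolding B_def by simp
  define C where "C = B * (1 + 1 / \<epsilon>) ^ d"
  have C: "C \<ge> 0" using B \<epsilon> by (simp add: C_def)
  have e1: "\<forall>\<^sub>F k in sequentially. norm (eval2 g (x k) (y k) - \<tau>) < min (\<epsilon>0 / 2) (min (norm \<tau> / 2) 1)"
    using tendstoD[OF lim, of "min (\<epsilon>0 / 2) (min (norm \<tau> / 2) 1)"] \<epsilon>0 \<tau> by (simp add: dist_norm)
  have "(\<lambda>k. norm (eval2 (pderiv g) (x k) (y k)) * C) \<longlonglongrightarrow> norm (0::complex) * C"
    by (intro tendsto_intros lim')
  then have e2: "\<forall>\<^sub>F k in sequentially. norm (eval2 (pderiv g) (x k) (y k)) * C < norm \<tau> / 2"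
    using \<tau> by (intro order_tendstoD) auto
  \<comment> \<open>This places the N-th roots t of 1 / x in the disc |t| <
    \<open>r0\<close>.\<close>
  have e3: "\<forall>\<^sub>F k in sequentially. norm (x k) > (1 / r0) ^ N"
    using x unfolding filterlim_at_top_dense by blast
  from eventually_happens'[OF sequentially_bot eventually_conj[OF e1 eventually_conj[OF e2 e3]]]
  obtain k where k: "norm (eval2 g (x k) (y k) - \<tau>) < min (\<epsilon>0 / 2) (min (norm \<tau> / 2) 1)"
      "norm (eval2 (pderiv g) (x k) (y k)) * C < norm \<tau> / 2" "norm (x k) > (1 / r0) ^ N"
    by blast
  define p where "p = fiber g (x k)"
  have pe: "poly p v = eval2 g (x k) v" "poly (pderiv p) v = eval2 (pderiv g) (x k) v" for v
    by (simp_all add: p_def poly_fiber pderiv_fiber)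
  have dp: "degree p = d" "lead_coeff p = c"
    unfolding p_def using degree_fiber[OF lg(2) c0] lg(1) by simp_all
  have pk: "norm (poly p (y k)) > norm \<tau> / 2" "norm (poly p (y k)) < norm \<tau> + 1"
    using k(1) norm_triangle_ineq2[of \<tau> "poly p (y k)"] norm_triangle_ineq2[of "poly p (y k)" \<tau>]
    by (auto simp: pe norm_minus_commute)
  have pk0: "poly p (y k) \<noteq> 0" using pk(1) by auto
  have "degree p > 0" using dp(1) d by simp
  note near = critical_point_near[OF this pk0 \<epsilon>(1), unfolded dp(2), unfolded dp(1)]
  obtain \<delta> where \<delta>: "\<delta> > 0" "norm c * \<delta> ^ d \<le> norm (poly p (y k))"
    and alt: "norm (poly p (y k)) \<le> norm (poly (pderiv p) (y k)) * \<delta> * (1 + 1 / \<epsilon>) ^ d \<or>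
     (\<exists>v. poly (pderiv p) v = 0 \<and> norm (poly p v - poly p (y k)) \<le> norm (poly p (y k)) * ((1 + \<epsilon>) ^ d - 1))"
    using near by (elim exE conjE) (rule that; assumption)
  have "\<delta> \<le> B"
  proof (rule ccontr)
    assume "\<not> \<delta> \<le> B"
    then have "\<delta> > B" by simp
    then have "\<delta> ^ 1 \<le> \<delta> ^ d" using B d by (intro power_increasing) auto
    then have "norm c * B < norm c * \<delta> ^ d" using \<open>\<delta> > B\<close> c0 by simp
    moreover have "norm c * B \<ge> norm \<tau> + 1" using c0 by (simp add: B_def distrib_left)
    ultimately show False using \<delta>(2) pk(2) by linarith
  qed
  from alt show False
  proof
    assume "norm (poly p (y k)) \<le> norm (poly (pderiv p) (y k)) * \<delta> * (1 + 1 / \<epsilon>) ^ d"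
    also have "\<dots> \<le> norm (poly (pderiv p) (y k)) * B * (1 + 1 / \<epsilon>) ^ d"
      using \<open>\<delta> \<le> B\<close> \<epsilon>(1) by (intro mult_right_mono mult_left_mono) auto
    also have "\<dots> = norm (eval2 (pderiv g) (x k) (y k)) * C" by (simp add: C_def pe)
    finally show False using k(2) pk(1) by simp
  next
    assume "\<exists>v. poly (pderiv p) v = 0 \<and> norm (poly p v - poly p (y k)) \<le> norm (poly p (y k)) * ((1 + \<epsilon>) ^ d - 1)"
    then obtain v where v: "poly (pderiv p) v = 0"
      "norm (poly p v - poly p (y k)) \<le> norm (poly p (y k)) * ((1 + \<epsilon>) ^ d - 1)" by blast
    have small: "norm (poly p v - poly p (y k)) < norm (poly p (y k)) * m"
      using v(2) \<epsilon>(2) pk0 by (smt (verit) mult_strict_left_mono zero_less_norm_iff)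
    have "norm (poly p (y k)) * m \<le> norm (poly p (y k)) * 1" by (intro mult_left_mono) (auto simp: m_def)
    then have pv0: "poly p v \<noteq> 0" using small by auto
    have "norm (poly p (y k)) * m \<le> (norm \<tau> + 1) * (\<epsilon>0 / 2 / (norm \<tau> + 1))"
      using pk(2) m by (intro mult_mono) (auto simp: m_def)
    also have "\<dots> = \<epsilon>0 / 2"
    proof -
      have "norm \<tau> + 1 \<noteq> 0" using norm_ge_zero[of \<tau>] by linarith
      then show ?thesis by (metis nonzero_mult_div_cancel_left times_divide_eq_right)
    qed
    finally have "norm (poly p v - poly p (y k)) < \<epsilon>0 / 2" using small by simp
    then have close: "norm (poly p v - \<tau>) < \<epsilon>0"
      using k(1) norm_triangle_ineq[of "poly p v - poly p (y k)" "poly p (y k) - \<tau>"] by (simp add: pe)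
    have xk: "x k \<noteq> 0" using k(3) r0(1) by auto
    obtain t where t: "1 / x k = t ^ N" using exists_complex_root[of N "1 / x k"] Npos by auto
    have t0: "t \<noteq> 0"
    proof
      assume "t = 0"
      then have "1 / x k = 0" using t Npos by simp
      then show False using xk by simp
    qed
    have xt: "x k = 1 / t ^ N" unfolding t[symmetric] by simp
    have "norm t ^ N < r0 ^ N"
    proof -
      have "norm t ^ N = 1 / norm (x k)" using xt by (simp add: norm_divide norm_power)
      also have "\<dots> < r0 ^ N"
      proof -
        have "1 < norm (x k) * r0 ^ N" using k(3) r0(1) by (simp add: power_divide divide_less_eq)
        then show ?thesis using xk by (simp add: divide_less_eq mult.commute)
      qed
      finally show ?thesis .
    qed
    then have tr: "norm t < r0" using r0(1) by (meson less_imp_le power_less_imp_less_base)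
    then have tb: "t \<in> ball 0 \<rho> - {0}" using r0(2)[OF t0] t0 by simp
    obtain l where l: "l \<in> W" "v = \<psi> l t / t ^ N"
      using g_crit[OF tb, of v] v(1) by (auto simp: pe xt)
    have "e l = 0"
    proof (rule ccontr)
      assume "e l \<noteq> 0"
      then have "poly p v = 0" unfolding pe xt g_eq[OF tb] using l finW by auto
      then show False using pv0 by simp
    qed
    then have "l \<in> J" using l by (simp add: J_def)
    moreover have "G t (\<psi> l t) = poly p v" unfolding G_eq[OF tb] pe xt l(2) ..
    ultimately show False using r0(3)[OF t0 tr] close by fastforce
  qed
qed

end

section \<open>Germs of analytic sets\<close>

lemma holomorphic2_onI:
  assumes "\<And>z. z \<in> U \<Longrightarrow> (g has_derivative (\<lambda>w. a z * fst w + b z * snd w)) (at z)"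
  shows "holomorphic2_on g U"
  unfolding holomorphic2_on_def
proof
  fix z assume "z \<in> U"
  then have "(g has_derivative (\<lambda>(h, k). a z * h + b z * k)) (at z)"
    using assms[of z] by (simp add: case_prod_unfold)
  then show "\<exists>a b. (g has_derivative (\<lambda>(h, k). a * h + b * k)) (at z)" by blast
qed

lemma holomorphic2_onE:
  assumes "holomorphic2_on g U"
  obtains a b where "\<And>z. z \<in> U \<Longrightarrow> (g has_derivative (\<lambda>w. a z * fst w + b z * snd w)) (at z)"
  using assms unfolding holomorphic2_on_def case_prod_unfold by metis

lemma holomorphic2_on_subset: "holomorphic2_on g U \<Longrightarrow> V \<subseteq> U \<Longrightarrow> holomorphic2_on g V"
  unfolding holomorphic2_on_def by blast

lemma holomorphic2_on_const: "holomorphic2_on (\<lambda>_. c) U"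
  by (rule holomorphic2_onI[where a="\<lambda>_. 0" and b="\<lambda>_. 0"]) (auto intro!: derivative_eq_intros)

lemma holomorphic2_on_fst: "holomorphic2_on fst U"
  by (rule holomorphic2_onI[where a="\<lambda>_. 1" and b="\<lambda>_. 0"]) (auto intro!: derivative_eq_intros)

lemma holomorphic2_on_snd: "holomorphic2_on snd U"
  by (rule holomorphic2_onI[where a="\<lambda>_. 0" and b="\<lambda>_. 1"]) (auto intro!: derivative_eq_intros)

lemma holomorphic2_on_add:
  assumes "holomorphic2_on f U" "holomorphic2_on g U"
  shows "holomorphic2_on (\<lambda>z. f z + g z) U"
proof -
  obtain a b where f: "\<And>z. z \<in> U \<Longrightarrow> (f has_derivative (\<lambda>w. a z * fst w + b z * snd w)) (at z)"
    using assms(1) by (rule holomorphic2_onE) (rule that)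
  obtain a' b' where g: "\<And>z. z \<in> U \<Longrightarrow> (g has_derivative (\<lambda>w. a' z * fst w + b' z * snd w)) (at z)"
    using assms(2) by (rule holomorphic2_onE) (rule that)
  show ?thesis
    by (rule holomorphic2_onI[where a="\<lambda>z. a z + a' z" and b="\<lambda>z. b z + b' z"])
       (rule has_derivative_eq_rhs, rule has_derivative_add, erule f, erule g, simp add: algebra_simps)
qed

lemma holomorphic2_on_mult:
  assumes "holomorphic2_on f U" "holomorphic2_on g U"
  shows "holomorphic2_on (\<lambda>z. f z * g z) U"
proof -
  obtain a b where f: "\<And>z. z \<in> U \<Longrightarrow> (f has_derivative (\<lambda>w. a z * fst w + b z * snd w)) (at z)"
    using assms(1) by (rule holomorphic2_onE) (rule that)
  obtain a' b' where g: "\<And>z. z \<in> U \<Longrightarrow> (g has_derivative (\<lambda>w. a' z * fst w + b' z * snd w)) (at z)"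
    using assms(2) by (rule holomorphic2_onE) (rule that)
  show ?thesis
    by (rule holomorphic2_onI[where a="\<lambda>z. f z * a' z + a z * g z" and b="\<lambda>z. f z * b' z + b z * g z"])
       (rule has_derivative_eq_rhs, rule has_derivative_mult, erule f, erule g, simp add: algebra_simps)
qed

lemma holomorphic2_on_power: "holomorphic2_on f U \<Longrightarrow> holomorphic2_on (\<lambda>z. f z ^ n) U"
  by (induction n) (simp_all add: holomorphic2_on_const holomorphic2_on_mult)

lemma holomorphic2_on_sum:
  assumes "finite A" "\<And>i. i \<in> A \<Longrightarrow> holomorphic2_on (f i) U"
  shows "holomorphic2_on (\<lambda>z. \<Sum>i\<in>A. f i z) U"
  using assms by (induction A rule: finite_induct) (simp_all add: holomorphic2_on_const holomorphic2_on_add)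

lemma holomorphic2_on_compose_field:
  assumes "holomorphic2_on f U" "\<phi> holomorphic_on V" "open V" "f ` U \<subseteq> V"
  shows "holomorphic2_on (\<lambda>z. \<phi> (f z)) U"
proof -
  obtain a b where f: "\<And>z. z \<in> U \<Longrightarrow> (f has_derivative (\<lambda>w. a z * fst w + b z * snd w)) (at z)"
    using assms(1) by (rule holomorphic2_onE) (rule that)
  have \<phi>: "(\<phi> has_derivative (\<lambda>w. deriv \<phi> (f z) * w)) (at (f z))" if "z \<in> U" for z
    using holomorphic_derivI[OF assms(2,3), of "f z"] that assms(4)
    by (auto simp: has_field_derivative_def)
  show ?thesis
    by (rule holomorphic2_onI[where a="\<lambda>z. deriv \<phi> (f z) * a z" and b="\<lambda>z. deriv \<phi> (f z) * b z"])
       (rule has_derivative_eq_rhs, rule has_derivative_compose, erule f, erule \<phi>, simp add: algebra_simps)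
qed

lemma holomorphic2_on_divide:
  assumes "holomorphic2_on f U" "holomorphic2_on g U" "\<And>z. z \<in> U \<Longrightarrow> g z \<noteq> 0"
  shows "holomorphic2_on (\<lambda>z. f z / g z) U"
proof -
  have "holomorphic2_on (\<lambda>z. inverse (g z)) U"
    by (rule holomorphic2_on_compose_field[OF assms(2), of inverse "- {0}"])
       (use assms(3) in \<open>auto intro!: holomorphic_intros\<close>)
  then show ?thesis using holomorphic2_on_mult[OF assms(1)] by (simp add: divide_inverse)
qed

lemma holomorphic2_on_compose:
  assumes "holomorphic2_on \<xi>1 U" "holomorphic2_on \<xi>2 U" "holomorphic2_on g V"
    and "\<And>z. z \<in> U \<Longrightarrow> (\<xi>1 z, \<xi>2 z) \<in> V"
  shows "holomorphic2_on (\<lambda>z. g (\<xi>1 z, \<xi>2 z)) U"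
proof -
  obtain a b where 1: "\<And>z. z \<in> U \<Longrightarrow> (\<xi>1 has_derivative (\<lambda>w. a z * fst w + b z * snd w)) (at z)"
    using assms(1) by (rule holomorphic2_onE) (rule that)
  obtain a' b' where 2: "\<And>z. z \<in> U \<Longrightarrow> (\<xi>2 has_derivative (\<lambda>w. a' z * fst w + b' z * snd w)) (at z)"
    using assms(2) by (rule holomorphic2_onE) (rule that)
  obtain p q where "\<And>z. z \<in> V \<Longrightarrow> (g has_derivative (\<lambda>w. p z * fst w + q z * snd w)) (at z)"
    using assms(3) by (rule holomorphic2_onE) (rule that)
  then have 3: "(g has_derivative (\<lambda>w. p (\<xi>1 z, \<xi>2 z) * fst w + q (\<xi>1 z, \<xi>2 z) * snd w)) (at (\<xi>1 z, \<xi>2 z))"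
    if "z \<in> U" for z using assms(4)[OF that] by blast
  show ?thesis
    by (rule holomorphic2_onI[where a="\<lambda>z. p (\<xi>1 z, \<xi>2 z) * a z + q (\<xi>1 z, \<xi>2 z) * a' z"
          and b="\<lambda>z. p (\<xi>1 z, \<xi>2 z) * b z + q (\<xi>1 z, \<xi>2 z) * b' z"])
       (rule has_derivative_eq_rhs, rule has_derivative_compose, rule has_derivative_Pair,
        erule 1, erule 2, erule 3, simp add: algebra_simps)
qed

lemma holomorphic2_on_curve:
  assumes "holomorphic2_on g U" "\<gamma>1 holomorphic_on S" "\<gamma>2 holomorphic_on S" "open S"
    and "\<And>t. t \<in> S \<Longrightarrow> (\<gamma>1 t, \<gamma>2 t) \<in> U"
  shows "(\<lambda>t. g (\<gamma>1 t, \<gamma>2 t)) holomorphic_on S"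
  unfolding holomorphic_on_open[OF assms(4)]
proof
  fix t assume t: "t \<in> S"
  obtain p q where "\<And>z. z \<in> U \<Longrightarrow> (g has_derivative (\<lambda>w. p z * fst w + q z * snd w)) (at z)"
    using assms(1) by (rule holomorphic2_onE) (rule that)
  then have g: "(g has_derivative (\<lambda>w. p (\<gamma>1 t, \<gamma>2 t) * fst w + q (\<gamma>1 t, \<gamma>2 t) * snd w)) (at (\<gamma>1 t, \<gamma>2 t))"
    using assms(5)[OF t] by blast
  have 1: "(\<gamma>1 has_derivative (*) (deriv \<gamma>1 t)) (at t)" "(\<gamma>2 has_derivative (*) (deriv \<gamma>2 t)) (at t)"
    using holomorphic_derivI[OF assms(2,4) t] holomorphic_derivI[OF assms(3,4) t]
    by (auto simp: has_field_derivative_def)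
  have "((\<lambda>t. g (\<gamma>1 t, \<gamma>2 t)) has_derivative
      (*) (p (\<gamma>1 t, \<gamma>2 t) * deriv \<gamma>1 t + q (\<gamma>1 t, \<gamma>2 t) * deriv \<gamma>2 t)) (at t)"
    by (rule has_derivative_eq_rhs, rule has_derivative_compose[OF has_derivative_Pair[OF 1] g])
       (simp add: fun_eq_iff algebra_simps)
  then show "\<exists>f'. ((\<lambda>t. g (\<gamma>1 t, \<gamma>2 t)) has_field_derivative f') (at t)"
    by (auto simp: has_field_derivative_def)
qed

lemma continuous_on_holomorphic2: "holomorphic2_on g U \<Longrightarrow> continuous_on U g"
  unfolding holomorphic2_on_def
  by (meson continuous_at_imp_continuous_on has_derivative_continuous)

section \<open>Analytic germs, irreducibility and components\<close>

lemma analytic_at_Int: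
  assumes "analytic_at p S" "analytic_at p T"
  shows "analytic_at p (S \<inter> T)"
proof -
  obtain U G where U: "open U" "p \<in> U" "finite G" "\<And>g. g \<in> G \<Longrightarrow> holomorphic2_on g U"
      "S \<inter> U = {z \<in> U. \<forall>g\<in>G. g z = 0}" using assms(1) by (auto simp: analytic_at_def)
  obtain V H where V: "open V" "p \<in> V" "finite H" "\<And>g. g \<in> H \<Longrightarrow> holomorphic2_on g V"
      "T \<inter> V = {z \<in> V. \<forall>g\<in>H. g z = 0}" using assms(2) by (auto simp: analytic_at_def)
  show ?thesis unfolding analytic_at_def
  proof (intro exI[of _ "U \<inter> V"] exI[of _ "G \<union> H"] conjI ballI)
    show "holomorphic2_on g (U \<inter> V)" if "g \<in> G \<union> H" for g
      using that U(4) V(4) holomorphic2_on_subset by (metis UnE inf_le1 inf_le2)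
    show "S \<inter> T \<inter> (U \<inter> V) = {z \<in> U \<inter> V. \<forall>g\<in>G \<union> H. g z = 0}" using U(5) V(5) by blast
  qed (use U V in auto)
qed

lemma analytic_at_Un:
  assumes "analytic_at p S" "analytic_at p T"
  shows "analytic_at p (S \<union> T)"
proof -
  obtain U G where U: "open U" "p \<in> U" "finite G" "\<And>g. g \<in> G \<Longrightarrow> holomorphic2_on g U"
      "S \<inter> U = {z \<in> U. \<forall>g\<in>G. g z = 0}" using assms(1) by (auto simp: analytic_at_def)
  obtain V H where V: "open V" "p \<in> V" "finite H" "\<And>g. g \<in> H \<Longrightarrow> holomorphic2_on g V"
      "T \<inter> V = {z \<in> V. \<forall>g\<in>H. g z = 0}" using assms(2) by (auto simp: analytic_at_def)
  let ?GH = "(\<lambda>(g, h) z. g z * h z) ` (G \<times> H)"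
  show ?thesis unfolding analytic_at_def
  proof (intro exI[of _ "U \<inter> V"] exI[of _ ?GH] conjI ballI)
    show "holomorphic2_on g (U \<inter> V)" if gh: "g \<in> ?GH" for g
    proof -
      obtain g1 h1 where "g1 \<in> G" "h1 \<in> H" "g = (\<lambda>z. g1 z * h1 z)" using gh by auto
      then show ?thesis
        using holomorphic2_on_mult[OF holomorphic2_on_subset[OF U(4)] holomorphic2_on_subset[OF V(4)]] by blast
    qed
    show "(S \<union> T) \<inter> (U \<inter> V) = {z \<in> U \<inter> V. \<forall>g\<in>?GH. g z = 0}"
    proof (intro equalityI subsetI)
      fix z assume "z \<in> (S \<union> T) \<inter> (U \<inter> V)"
      then have "z \<in> U \<inter> V" "(\<forall>g\<in>G. g z = 0) \<or> (\<forall>g\<in>H. g z = 0)" using U(5) V(5) by blast+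
      then show "z \<in> {z \<in> U \<inter> V. \<forall>g\<in>?GH. g z = 0}" by auto
    next
      fix z assume z: "z \<in> {z \<in> U \<inter> V. \<forall>g\<in>?GH. g z = 0}"
      then have "\<And>g h. g \<in> G \<Longrightarrow> h \<in> H \<Longrightarrow> g z * h z = 0" by fastforce
      then have "(\<forall>g\<in>G. g z = 0) \<or> (\<forall>g\<in>H. g z = 0)" by (metis mult_eq_0_iff)
      then show "z \<in> (S \<union> T) \<inter> (U \<inter> V)" using z U(5) V(5) by blast
    qed
  qed (use U V in auto)
qed

lemma analytic_at_empty: "analytic_at p {}"
  unfolding analytic_at_def
  by (intro exI[of _ UNIV] exI[of _ "{\<lambda>_. 1}"]) (auto intro: holomorphic2_on_const)

lemma analytic_at_Union:
  assumes "finite \<F>" "\<And>S. S \<in> \<F> \<Longrightarrow> analytic_at p S"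
  shows "analytic_at p (\<Union>\<F>)"
  using assms by (induction \<F> rule: finite_induct) (auto intro: analytic_at_empty analytic_at_Un)

lemma germ_le_trans:
  assumes "germ_le p S T" "germ_le p T R" shows "germ_le p S R"
  using assms unfolding germ_le_def by eventually_elim blast

lemma germ_eq_iff: "germ_eq p S T \<longleftrightarrow> germ_le p S T \<and> germ_le p T S"
  unfolding germ_eq_def germ_le_def by (simp add: iff_conv_conj_imp eventually_conj_iff)

lemma germ_inject: "germ p S = germ p T \<Longrightarrow> germ_eq p S T"
proof -
  assume "germ p S = germ p T"
  moreover have "T \<in> germ p T" by (simp add: germ_def germ_eq_def)
  ultimately show ?thesis by (auto simp: germ_def)
qed

text \<open>\<open>T\<close> is the union of its intersections with \<open>S\<close> and with the
  rest, so it equals one of them. For the empty family, membership of \<open>p\<close> in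
  \<open>T\<close> gives the contradiction.\<close>

lemma irreducible_le_Union:
  assumes T: "irreducible_at p T" and "finite \<F>" "\<And>S. S \<in> \<F> \<Longrightarrow> analytic_at p S" "germ_le p T (\<Union>\<F>)"
  shows "\<exists>S\<in>\<F>. germ_le p T S"
  using assms(2-4)
proof (induction \<F> rule: finite_induct)
  case empty
  then have "p \<notin> T" unfolding germ_le_def by (auto dest: eventually_nhds_x_imp_x)
  then show ?case using T by (simp add: irreducible_at_def)
next
  case (insert S \<F>)
  have aT: "analytic_at p T" using T by (simp add: irreducible_at_def)
  have "germ_eq p T ((T \<inter> S) \<union> (T \<inter> \<Union>\<F>))"
    using insert.prems(2) unfolding germ_le_def germ_eq_def by eventually_elim auto
  moreover have "analytic_at p (T \<inter> S)" "analytic_at p (T \<inter> \<Union>\<F>)"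
    using insert.prems(1) insert.hyps(1) by (auto intro!: analytic_at_Int aT analytic_at_Union)
  ultimately consider "germ_eq p T (T \<inter> S)" | "germ_eq p T (T \<inter> \<Union>\<F>)"
    using T unfolding irreducible_at_def by blast
  then show ?case
  proof cases
    case 1
    then have "germ_le p T S" unfolding germ_eq_def germ_le_def by eventually_elim auto
    then show ?thesis by blast
  next
    case 2
    then have "germ_le p T (\<Union>\<F>)" unfolding germ_eq_def germ_le_def by eventually_elim auto
    then show ?thesis using insert by blast
  qed
qed

text \<open>An irreducible germ between \<open>T k\<close> and \<open>S\<close> lies in some
  \<open>T l\<close> by \<open>irreducible_le_Union\<close>. Then \<open>T k\<close> lies in
  \<open>T l\<close>, so k = l and the germ is squeezed onto \<open>T k\<close>.\<close>

lemma irreducible_componentsI: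
  assumes fin: "finite K" and irr: "\<And>k. k \<in> K \<Longrightarrow> irreducible_at p (T k)"
    and eq: "germ_eq p S (\<Union>k\<in>K. T k)"
    and anti: "\<And>k l. k \<in> K \<Longrightarrow> l \<in> K \<Longrightarrow> germ_le p (T k) (T l) \<Longrightarrow> k = l"
    and k: "k \<in> K"
  shows "germ p (T k) \<in> irreducible_components_at p S"
proof -
  have le: "germ_le p (T k) S"
    using eq k unfolding germ_eq_def germ_le_def by (auto elim: eventually_mono)
  have "germ_eq p (T k) T'" if T': "irreducible_at p T'" "germ_le p (T k) T'" "germ_le p T' S" for T'
  proof -
    have "germ_le p T' (\<Union>(T ` K))" using T'(3) eq germ_le_trans by (auto simp: germ_eq_iff)
    moreover have "analytic_at p R" if "R \<in> T ` K" for R using that irr by (auto simp: irreducible_at_def)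
    ultimately obtain l where l: "l \<in> K" "germ_le p T' (T l)"
      using irreducible_le_Union[OF T'(1), of "T ` K"] fin by blast
    have "k = l" using anti[OF k l(1)] germ_le_trans[OF T'(2) l(2)] by blast
    then show ?thesis using T'(2) l(2) by (simp add: germ_eq_iff)
  qed
  then show ?thesis using irr[OF k] le unfolding irreducible_components_at_def by blast
qed

lemma holomorphic_zero_dichotomy:
  assumes f: "f holomorphic_on ball 0 s" and s: "s > 0"
  shows "(\<forall>t\<in>ball 0 s. f t = 0) \<or> (\<forall>\<^sub>F t in at 0. f t \<noteq> 0)"
proof (cases "\<exists>t\<in>ball 0 s. f t \<noteq> 0")
  case True
  then obtain b where b: "b \<in> ball 0 s" "f b \<noteq> 0" by blast
  have "\<forall>\<^sub>F t in at 0. f t \<noteq> 0"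
  proof (cases "f 0 = 0")
    case True
    obtain r where r: "r > 0" "\<And>z. z \<in> ball 0 r - {0} \<Longrightarrow> f z \<noteq> 0"
      using isolated_zeros[OF f open_ball connected_ball _ True b] s by (metis centre_in_ball)
    then show ?thesis by (auto simp: eventually_at intro!: exI[of _ r])
  next
    case False
    have "(f \<longlongrightarrow> f 0) (at 0)"
      using holomorphic_on_imp_continuous_on[OF f] s
      by (simp add: continuous_on_eq_continuous_at isCont_def)
    then show ?thesis using False by (rule tendsto_imp_eventually_ne)
  qed
  then show ?thesis ..
qed blast

text \<open>The identity theorem: if an equation of \<open>A\<close> does not vanish identically
  along the curve, its zeros there are isolated, so the curve lies in \<open>B\<close> near 0, and
  the equations of \<open>B\<close> vanish along the whole disc. The last hypothesis ensures that
  points of \<open>T\<close> near \<open>p\<close> have small parameters, so small discs already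
  fill the germ of \<open>T\<close>.\<close>

lemma irreducible_curve:
  assumes r: "r > 0" and \<gamma>: "\<gamma>1 holomorphic_on ball 0 r" "\<gamma>2 holomorphic_on ball 0 r"
    and p: "p = (\<gamma>1 0, \<gamma>2 0)" and an: "analytic_at p T"
    and inT: "\<forall>\<^sub>F t in nhds 0. (\<gamma>1 t, \<gamma>2 t) \<in> T"
    and onT: "\<And>\<epsilon>. \<epsilon> > 0 \<Longrightarrow> \<forall>\<^sub>F z in nhds p. z \<in> T \<longrightarrow> (\<exists>t. norm t < \<epsilon> \<and> z = (\<gamma>1 t, \<gamma>2 t))"
  shows "irreducible_at p T"
  unfolding irreducible_at_def
proof (intro conjI allI impI an)
  show "p \<in> T" using eventually_nhds_x_imp_x[OF inT] p by simp
  fix A B assume AB: "analytic_at p A \<and> analytic_at p B \<and> germ_eq p T (A \<union> B)"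
  obtain U G where U: "open U" "p \<in> U" "\<And>g. g \<in> G \<Longrightarrow> holomorphic2_on g U"
      "A \<inter> U = {z \<in> U. \<forall>g\<in>G. g z = 0}"
    using conjunct1[OF AB] unfolding analytic_at_def by blast
  obtain V H where V: "open V" "p \<in> V" "\<And>g. g \<in> H \<Longrightarrow> holomorphic2_on g V"
      "B \<inter> V = {z \<in> V. \<forall>g\<in>H. g z = 0}"
    using conjunct1[OF conjunct2[OF AB]] unfolding analytic_at_def by blast
  define \<gamma> where "\<gamma> t = (\<gamma>1 t, \<gamma>2 t)" for t
  have cont: "continuous_on (ball 0 r) \<gamma>"
    unfolding \<gamma>_def by (intro continuous_intros holomorphic_on_imp_continuous_on \<gamma>)
  have "open (ball 0 r \<inter> \<gamma> -` (U \<inter> V))"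
    using cont U(1) V(1) by (intro continuous_open_preimage) auto
  moreover have "0 \<in> ball 0 r \<inter> \<gamma> -` (U \<inter> V)" using r U V p by (simp add: \<gamma>_def)
  ultimately obtain s where s: "s > 0" "ball 0 s \<subseteq> ball 0 r \<inter> \<gamma> -` (U \<inter> V)" by (meson openE)
  have hol: "(\<lambda>t. g (\<gamma> t)) holomorphic_on ball 0 s" if "g \<in> G \<or> g \<in> H" for g
  proof -
    have "\<gamma>1 holomorphic_on ball 0 s" "\<gamma>2 holomorphic_on ball 0 s"
      using s \<gamma> by (meson holomorphic_on_subset le_infE)+
    then show ?thesis
      using that s(2) U(3) V(3) unfolding \<gamma>_def
      by (elim disjE) (rule holomorphic2_on_curve[where U=U] holomorphic2_on_curve[where U=V]; auto simp: \<gamma>_def)+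
  qed
  have lim: "filterlim \<gamma> (nhds p) (at 0)"
  proof -
    have "isCont \<gamma> 0" using cont r by (simp add: continuous_on_eq_continuous_at)
    moreover have "\<gamma> 0 = p" by (simp add: \<gamma>_def p)
    ultimately show ?thesis by (simp add: isCont_def)
  qed
  have sub: "germ_eq p T C" if C: "\<And>t. t \<in> ball 0 s \<Longrightarrow> \<gamma> t \<in> C" "C \<subseteq> A \<union> B" for C
  proof -
    have "\<forall>\<^sub>F z in nhds p. z \<in> T \<longrightarrow> (\<exists>t. norm t < s \<and> z = \<gamma> t)"
      using onT[OF s(1)] by (simp add: \<gamma>_def)
    moreover have "\<forall>\<^sub>F z in nhds p. z \<in> T \<longleftrightarrow> z \<in> A \<union> B" using AB by (simp add: germ_eq_def)
    ultimately show ?thesis unfolding germ_eq_def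
      by eventually_elim (use C in auto)
  qed
  show "germ_eq p T A \<or> germ_eq p T B"
  proof (cases "\<forall>g\<in>G. \<forall>t\<in>ball 0 s. g (\<gamma> t) = 0")
    case True
    then have "\<gamma> t \<in> A" if "t \<in> ball 0 s" for t using that s(2) U(4) by blast
    then show ?thesis using sub by blast
  next
    case False
    then obtain g where g: "g \<in> G" "\<not> (\<forall>t\<in>ball 0 s. g (\<gamma> t) = 0)" by blast
    then have ne: "\<forall>\<^sub>F t in at 0. g (\<gamma> t) \<noteq> 0" using holomorphic_zero_dichotomy[OF hol s(1)] by blast
    have ev: "\<forall>\<^sub>F t in at 0. \<gamma> t \<in> B \<inter> V"
    proof -
      have "\<forall>\<^sub>F t in at 0. \<gamma> t \<in> T \<longleftrightarrow> \<gamma> t \<in> A \<union> B"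
        using AB lim unfolding germ_eq_def by (auto dest: filterlim_iff[THEN iffD1, rule_format])
      moreover have "\<forall>\<^sub>F t in at 0. \<gamma> t \<in> T"
        using inT by (simp add: \<gamma>_def eventually_at_filter eventually_mono)
      moreover have "\<forall>\<^sub>F t in at 0. t \<in> ball 0 s" using s(1)
        by (auto simp: eventually_at dist_commute intro!: exI[of _ s])
      ultimately show ?thesis using ne
      proof eventually_elim
        case (elim t)
        then have "\<gamma> t \<in> U" "\<gamma> t \<in> V" using s(2) by auto
        then show ?case using elim g(1) U(4) by blast
      qed
    qed
    have "\<forall>t\<in>ball 0 s. h (\<gamma> t) = 0" if h: "h \<in> H" for h
    proof (rule ccontr)
      assume "\<not> ?thesis"
      then have "\<forall>\<^sub>F t in at 0. h (\<gamma> t) \<noteq> 0" using holomorphic_zero_dichotomy[OF hol s(1), of h] h by blast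
      then have "\<forall>\<^sub>F t in at (0::complex). False" using ev
      proof eventually_elim
        case (elim t)
        then show ?case using V(4) h by blast
      qed
      then show False by simp
    qed
    then have "\<gamma> t \<in> B" if "t \<in> ball 0 s" for t using that s(2) V(4) by blast
    then show ?thesis using sub by blast
  qed
qed

section \<open>Branches at infinity\<close>

lemma coeff_prod_linear_holomorphic:
  fixes \<psi> :: "'i \<Rightarrow> complex \<Rightarrow> complex"
  assumes "finite A" "\<And>l. l \<in> A \<Longrightarrow> \<psi> l holomorphic_on S"
  shows "(\<lambda>t. coeff (\<Prod>l\<in>A. [:- \<psi> l t, 1:]) m) holomorphic_on S"
  using assms
proof (induction A arbitrary: m rule: finite_induct)
  case (insert l A)
  let ?p = "\<lambda>t. \<Prod>l\<in>A. [:- \<psi> l t, 1:]"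
  have IH: "(\<lambda>t. coeff (?p t) m) holomorphic_on S" for m using insert by simp
  have "coeff (\<Prod>l\<in>insert l A. [:- \<psi> l t, 1:]) m =
      - \<psi> l t * coeff (?p t) m + (case m of 0 \<Rightarrow> 0 | Suc n \<Rightarrow> coeff (?p t) n)" for t
    using insert.hyps by (simp add: coeff_pCons split: nat.split)
  moreover have "(\<lambda>t. - \<psi> l t * coeff (?p t) m + (case m of 0 \<Rightarrow> 0 | Suc n \<Rightarrow> coeff (?p t) n)) holomorphic_on S"
    using IH insert.prems by (cases m) (auto intro!: holomorphic_intros)
  ultimately show ?case by simp
qed simp

text \<open>An arbitrary root, in general discontinuous in \<nu>. Composing with it is meaningful
  for functions of t that agree on all N-th roots of \<nu>.\<close>

definition nth_root :: "nat \<Rightarrow> complex \<Rightarrow> complex" where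
  "nth_root N \<nu> = (SOME t. t ^ N = \<nu>)"

lemma nth_root_power: "N > 0 \<Longrightarrow> nth_root N \<nu> ^ N = \<nu>"
  unfolding nth_root_def using exists_complex_root[of N \<nu>] by (metis (mono_tags, lifting) neq0_conv someI_ex)

lemma norm_nth_root_less:
  assumes "N > 0" "r \<ge> 0" "norm \<nu> < r ^ N" shows "norm (nth_root N \<nu>) < r"
proof -
  have "norm (nth_root N \<nu>) ^ N = norm \<nu>" using nth_root_power[OF assms(1), of \<nu>] by (simp flip: norm_power)
  then show ?thesis using assms power_less_imp_less_base by metis
qed

text \<open>A holomorphic function of \<open>t\<close> that only depends on \<open>\<nu> = t ^ N\<close> is holomorphic in \<open>\<nu>\<close>: away
  from \<open>0\<close> there are holomorphic \<open>N\<close>-th roots, and \<open>0\<close> is removable.\<close>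

lemma holomorphic_on_nth_root:
  assumes N: "N > 0" and \<rho>: "\<rho> > 0" and \<alpha>: "\<alpha> holomorphic_on ball 0 \<rho>"
    and inv: "\<And>s t. s ^ N = t ^ N \<Longrightarrow> norm t < \<rho> \<Longrightarrow> \<alpha> s = \<alpha> t"
  shows "(\<lambda>\<nu>. \<alpha> (nth_root N \<nu>)) holomorphic_on ball 0 (\<rho> ^ N)"
proof (rule no_isolated_singularity'[where K="{0}"])
  let ?\<beta> = "\<lambda>\<nu>. \<alpha> (nth_root N \<nu>)"
  have r0: "nth_root N 0 = 0" using nth_root_power[OF N, of 0] N by simp
  have cont: "isCont \<alpha> 0"
    using holomorphic_on_imp_continuous_on[OF \<alpha>] \<rho> by (simp add: continuous_on_eq_continuous_at)
  show "(?\<beta> \<longlongrightarrow> ?\<beta> z) (at z within ball 0 (\<rho> ^ N))" if "z \<in> {0}" for z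
    unfolding tendsto_iff
  proof (intro allI impI)
    fix \<epsilon> :: real assume "\<epsilon> > 0"
    then obtain \<delta> where \<delta>: "\<delta> > 0" "\<And>t. dist t 0 < \<delta> \<Longrightarrow> dist (\<alpha> t) (\<alpha> 0) < \<epsilon>"
      using cont unfolding continuous_at_eps_delta by blast
    have "dist (?\<beta> \<nu>) (?\<beta> 0) < \<epsilon>" if "dist \<nu> 0 < \<delta> ^ N" for \<nu>
      using \<delta> norm_nth_root_less[OF N, of \<delta> \<nu>] that r0 by simp
    then show "\<forall>\<^sub>F \<nu> in at z within ball 0 (\<rho> ^ N). dist (?\<beta> \<nu>) (?\<beta> z) < \<epsilon>"
      using \<open>z \<in> {0}\<close> \<delta>(1) unfolding eventually_at by (intro exI[of _ "\<delta> ^ N"]) auto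
  qed
  show "?\<beta> holomorphic_on ball 0 (\<rho> ^ N) - {0}"
    unfolding holomorphic_on_def
  proof
    fix \<nu>0 :: complex assume \<nu>0: "\<nu>0 \<in> ball 0 (\<rho> ^ N) - {0}"
    define B where "B = ball 0 (\<rho> ^ N) \<inter> ball \<nu>0 (norm \<nu>0)"
    define h where "h \<nu> = nth_root N \<nu>0 * exp (Ln (\<nu> / \<nu>0) / of_nat N)" for \<nu>
    have pos: "Re (\<nu> / \<nu>0) > 0" if "\<nu> \<in> B" for \<nu>
    proof -
      have "norm (1 - \<nu> / \<nu>0) < 1"
      proof -
        have "1 - \<nu> / \<nu>0 = (\<nu>0 - \<nu>) / \<nu>0" using \<nu>0 by (simp add: field_simps)
        then show ?thesis using that \<nu>0 by (simp add: B_def norm_divide dist_norm divide_less_eq)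
      qed
      then show ?thesis using abs_Re_le_cmod[of "1 - \<nu> / \<nu>0"] by simp
    qed
    have hN: "h \<nu> ^ N = \<nu>" if "\<nu> \<in> B" for \<nu>
    proof -
      have "\<nu> / \<nu>0 \<noteq> 0" using pos[OF that] by auto
      have "exp (Ln (\<nu> / \<nu>0) / of_nat N) ^ N = exp (of_nat N * (Ln (\<nu> / \<nu>0) / of_nat N))"
        by (rule exp_of_nat_mult[symmetric])
      also have "\<dots> = \<nu> / \<nu>0" using N \<open>\<nu> / \<nu>0 \<noteq> 0\<close> by simp
      finally show ?thesis using nth_root_power[OF N] \<nu>0 by (simp add: h_def power_mult_distrib)
    qed
    have hsmall: "norm (h \<nu>) < \<rho>" if "\<nu> \<in> B" for \<nu>
    proof -
      have "norm (h \<nu>) ^ N = norm \<nu>" using hN[OF that] by (simp flip: norm_power)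
      then have "norm (h \<nu>) ^ N < \<rho> ^ N" using that by (simp add: B_def)
      then show ?thesis using \<rho> power_less_imp_less_base by (metis less_imp_le)
    qed
    have "h holomorphic_on B"
      unfolding h_def using pos \<nu>0
      by (intro holomorphic_intros) (auto simp: complex_nonpos_Reals_iff not_le)
    then have "\<alpha> \<circ> h holomorphic_on B"
      using \<alpha> by (rule holomorphic_on_compose_gen) (use hsmall in auto)
    then have "?\<beta> holomorphic_on B"
    proof (rule holomorphic_transform)
      fix \<nu> assume "\<nu> \<in> B"
      then show "(\<alpha> \<circ> h) \<nu> = ?\<beta> \<nu>"
        using inv[of "nth_root N \<nu>" "h \<nu>"] hN hsmall nth_root_power[OF N] by simp
    qed
    moreover have "open B" "\<nu>0 \<in> B" using \<nu>0 by (auto simp: B_def)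
    ultimately have "?\<beta> field_differentiable at \<nu>0" using holomorphic_on_imp_differentiable_at by blast
    then show "?\<beta> field_differentiable at \<nu>0 within ball 0 (\<rho> ^ N) - {0}"
      by (rule field_differentiable_at_within)
  qed
qed auto

section \<open>Branches as zero sets of Weierstrass polynomials\<close>

context puiseux_polynomial
begin

text \<open>For x = 1 / t^N and y = \<psi> l t / t^N the coordinates are y / x and 1 / x; the
  parameter t = 0 gives the point at infinity.\<close>

definition branch :: "complex \<Rightarrow> (complex \<times> complex) set" where
  "branch l = {(\<psi> l t, t ^ N) | t. norm t < \<rho>}"

lemma norm_power_N: "s ^ N = t ^ N \<Longrightarrow> norm s = norm (t :: complex)"
  using Npos by (metis norm_ge_zero norm_power power_eq_imp_eq_base)

lemma same_power:
  assumes "s ^ N = t ^ N" shows "\<exists>k. s = \<zeta> ^ k * t"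
proof (cases "t = 0")
  case False
  then have "(s / t) ^ N = 1" using assms by (simp add: power_divide)
  then obtain k where "s / t = \<zeta> ^ k" using unity by blast
  then show ?thesis using False by (intro exI[of _ k]) (simp add: field_simps)
qed (use norm_power_N[OF assms] in auto)

lemma orb_W: "l \<in> W \<Longrightarrow> orb l \<subseteq> W" by (auto simp: orb_def \<sigma>pow_W)

lemma finite_orb: "l \<in> W \<Longrightarrow> finite (orb l)" using orb_W finW finite_subset by blast

lemma branch_rotate:
  assumes "l \<in> W" shows "branch ((\<sigma> ^^ k) l) = branch l"
proof -
  have sub: "branch ((\<sigma> ^^ k) l) \<subseteq> branch l" if lW: "l \<in> W" for k l
  proof
    fix z assume "z \<in> branch ((\<sigma> ^^ k) l)"
    then obtain t where t: "z = (\<psi> l (\<zeta> ^ k * t), t ^ N)" "norm t < \<rho>"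
      using lW by (auto simp: branch_def \<psi>_\<sigma>pow)
    have "(\<zeta> ^ k * t) ^ N = t ^ N"
      using \<zeta>N by (simp add: power_mult_distrib) (metis mult.commute power_mult power_one)
    then show "z \<in> branch l" using t norm_power_N[of "\<zeta> ^ k * t" t] unfolding branch_def by force
  qed
  have "branch l = branch ((\<sigma> ^^ (k * (N - 1))) ((\<sigma> ^^ k) l))" using \<sigma>pow_funpow[OF assms] by simp
  then show ?thesis using sub[OF assms] sub[OF \<sigma>pow_W[OF assms]] by blast
qed

lemma branch_orb: "l \<in> W \<Longrightarrow> m \<in> W \<Longrightarrow> orb l = orb m \<Longrightarrow> branch l = branch m"
  using orb_eqD branch_rotate by metis

definition branch_poly :: "complex \<Rightarrow> complex \<Rightarrow> complex poly" where
  "branch_poly l t = (\<Prod>m\<in>orb l. [:- \<psi> m t, 1:])"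

lemma branch_poly_rotate:
  assumes "l \<in> W" "norm t < \<rho>"
  shows "branch_poly l (\<zeta> ^ k * t) = branch_poly l t"
proof -
  have bij: "bij_betw (\<sigma> ^^ k) (orb l) (orb l)"
  proof -
    have "inj_on (\<sigma> ^^ k) (orb l)"
      using bij_betw_imp_inj_on[OF \<sigma>pow_bij] orb_W[OF assms(1)] by (rule inj_on_subset)
    moreover have "(\<sigma> ^^ k) ` orb l \<subseteq> orb l"
    proof
      fix m assume "m \<in> (\<sigma> ^^ k) ` orb l"
      then obtain i where "m = (\<sigma> ^^ k) ((\<sigma> ^^ i) l)" by (auto simp: orb_def)
      then have "m = (\<sigma> ^^ (k + i)) l" by (simp add: funpow_add)
      then show "m \<in> orb l" unfolding orb_def by blast
    qed
    ultimately show ?thesis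
      using endo_inj_surj[OF finite_orb[OF assms(1)]] by (simp add: bij_betw_def)
  qed
  have "branch_poly l (\<zeta> ^ k * t) = (\<Prod>m\<in>orb l. [:- \<psi> ((\<sigma> ^^ k) m) t, 1:])"
    unfolding branch_poly_def using orb_W[OF assms(1)] assms(2)
    by (intro prod.cong refl) (auto simp: \<psi>_\<sigma>pow)
  also have "\<dots> = branch_poly l t"
    unfolding branch_poly_def by (rule prod.reindex_bij_betw[OF bij])
  finally show ?thesis .
qed

text \<open>A Weierstrass polynomial of the branch: multiplying over all conjugates makes the
  coefficients invariant under the monodromy, hence holomorphic in \<nu> near 0. It exhibits the
  branch as an analytic set.\<close>

definition branch_fun :: "complex \<Rightarrow> complex \<times> complex \<Rightarrow> complex" where
  "branch_fun l = (\<lambda>(\<mu>, \<nu>). poly (branch_poly l (nth_root N \<nu>)) \<mu>)"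

lemma holomorphic2_branch_fun:
  assumes l: "l \<in> W"
  shows "holomorphic2_on (branch_fun l) (UNIV \<times> ball 0 (\<rho> ^ N))"
proof -
  let ?\<beta> = "\<lambda>m \<nu>. coeff (branch_poly l (nth_root N \<nu>)) m"
  have hol\<beta>: "?\<beta> m holomorphic_on ball 0 (\<rho> ^ N)" for m
  proof (rule holomorphic_on_nth_root[OF Npos \<rho>])
    show "(\<lambda>t. coeff (branch_poly l t) m) holomorphic_on ball 0 \<rho>"
      unfolding branch_poly_def using orb_W[OF l] hol
      by (intro coeff_prod_linear_holomorphic finite_orb[OF l]) auto
    show "coeff (branch_poly l s) m = coeff (branch_poly l t) m" if "s ^ N = t ^ N" "norm t < \<rho>" for s t
      using same_power[OF that(1)] branch_poly_rotate[OF l that(2)] by auto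
  qed
  have deg: "degree (branch_poly l t) \<le> card (orb l)" for t
    unfolding branch_poly_def
    by (rule order.trans[OF degree_prod_sum_le[OF finite_orb[OF l]]]) simp
  have eq: "branch_fun l z = (\<Sum>m\<le>card (orb l). ?\<beta> m (snd z) * fst z ^ m)" for z
  proof -
    have "branch_fun l z = poly (branch_poly l (nth_root N (snd z))) (fst z)"
      by (simp add: branch_fun_def case_prod_unfold)
    also have "\<dots> = (\<Sum>m\<le>card (orb l). ?\<beta> m (snd z) * fst z ^ m)"
      unfolding poly_altdef using deg[of "nth_root N (snd z)"]
      by (intro sum.mono_neutral_left) (auto simp: coeff_eq_0)
    finally show ?thesis .
  qed
  have "holomorphic2_on (\<lambda>z. \<Sum>m\<le>card (orb l). ?\<beta> m (snd z) * fst z ^ m) (UNIV \<times> ball 0 (\<rho> ^ N))"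
    by (intro holomorphic2_on_sum holomorphic2_on_mult holomorphic2_on_power holomorphic2_on_fst
        holomorphic2_on_compose_field[OF holomorphic2_on_snd hol\<beta>]) auto
  then show ?thesis by (simp add: eq[abs_def])
qed

lemma branch_fun_eq_0_iff:
  assumes l: "l \<in> W" and \<nu>: "norm \<nu> < \<rho> ^ N"
  shows "branch_fun l (\<mu>, \<nu>) = 0 \<longleftrightarrow> (\<mu>, \<nu>) \<in> branch l"
proof
  let ?t = "nth_root N \<nu>"
  have t: "?t ^ N = \<nu>" "norm ?t < \<rho>"
    using nth_root_power[OF Npos] norm_nth_root_less[OF Npos _ \<nu>] \<rho> by auto
  assume "branch_fun l (\<mu>, \<nu>) = 0"
  then obtain m where m: "m \<in> orb l" "\<mu> = \<psi> m ?t"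
    using finite_orb[OF l] by (auto simp: branch_fun_def branch_poly_def poly_prod)
  then have "(\<mu>, \<nu>) \<in> branch m" using t by (auto simp: branch_def intro!: exI[of _ ?t])
  moreover obtain k where "m = (\<sigma> ^^ k) l" using m by (auto simp: orb_def)
  ultimately show "(\<mu>, \<nu>) \<in> branch l" using branch_rotate[OF l] by simp
next
  let ?t = "nth_root N \<nu>"
  assume "(\<mu>, \<nu>) \<in> branch l"
  then obtain t where t: "\<mu> = \<psi> l t" "\<nu> = t ^ N" "norm t < \<rho>" by (auto simp: branch_def)
  obtain k where k: "?t = \<zeta> ^ k * t" using same_power[of ?t t] nth_root_power[OF Npos] t by auto
  have "branch_poly l ?t = branch_poly l t" unfolding k using l t(3) by (rule branch_poly_rotate)
  moreover have "poly (branch_poly l t) \<mu> = 0"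
    unfolding branch_poly_def using t(1) finite_orb[OF l] orb_refl[of l] by (auto simp: poly_prod)
  ultimately show "branch_fun l (\<mu>, \<nu>) = 0" by (simp add: branch_fun_def)
qed

text \<open>Parameters with equal N-th powers differ by a power of \<zeta>. So
  \<open>\<psi> l\<close> agrees at t with a conjugate of \<open>\<psi> m\<close>, and for t
  \<noteq> 0 distinct series never agree.\<close>

lemma branch_meet:
  assumes lm: "l \<in> W" "m \<in> W" and t: "t \<noteq> 0" "norm t < \<rho>" and mem: "(\<psi> l t, t ^ N) \<in> branch m"
  shows "orb l = orb m"
proof -
  obtain s where s: "\<psi> l t = \<psi> m s" "t ^ N = s ^ N" "norm s < \<rho>" using mem by (auto simp: branch_def)
  obtain k where "s = \<zeta> ^ k * t" using same_power[of s t] s by auto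
  then have "\<psi> l t = \<psi> ((\<sigma> ^^ k) m) t" using s lm t by (simp add: \<psi>_\<sigma>pow)
  then have "l = (\<sigma> ^^ k) m" using \<psi>neq[of l "(\<sigma> ^^ k) m" t] lm t \<sigma>pow_W by blast
  then show ?thesis using orb_rotate lm by simp
qed

end

section \<open>Homogeneous coordinates and the projective closure\<close>

lemma proj_eq_iff: "proj X Y Z = proj X' Y' Z' \<longleftrightarrow> (\<exists>k. k \<noteq> 0 \<and> X' = k * X \<and> Y' = k * Y \<and> Z' = k * Z)"
proof
  assume "proj X Y Z = proj X' Y' Z'"
  moreover have "(X', Y', Z') \<in> proj X' Y' Z'" by (auto simp: proj_def intro!: exI[of _ 1])
  ultimately have "(X', Y', Z') \<in> proj X Y Z" by simp
  then show "\<exists>k. k \<noteq> 0 \<and> X' = k * X \<and> Y' = k * Y \<and> Z' = k * Z" unfolding proj_def by blast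
next
  assume "\<exists>k. k \<noteq> 0 \<and> X' = k * X \<and> Y' = k * Y \<and> Z' = k * Z"
  then obtain k where k: "k \<noteq> 0" "X' = k * X" "Y' = k * Y" "Z' = k * Z" by blast
  show "proj X Y Z = proj X' Y' Z'"
  proof
    show "proj X' Y' Z' \<subseteq> proj X Y Z"
    proof
      fix z assume "z \<in> proj X' Y' Z'"
      then obtain c where "c \<noteq> 0" "z = (c * X', c * Y', c * Z')" by (auto simp: proj_def)
      then have "c * k \<noteq> 0" "z = ((c * k) * X, (c * k) * Y, (c * k) * Z)" using k by auto
      then show "z \<in> proj X Y Z" unfolding proj_def by blast
    qed
    show "proj X Y Z \<subseteq> proj X' Y' Z'"
    proof
      fix z assume "z \<in> proj X Y Z"
      then obtain c where "c \<noteq> 0" "z = (c * X, c * Y, c * Z)" by (auto simp: proj_def)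
      then have "c / k \<noteq> 0" "z = ((c / k) * X', (c / k) * Y', (c / k) * Z')" using k by auto
      then show "z \<in> proj X' Y' Z'" unfolding proj_def by blast
    qed
  qed
qed

lemma support2_total_degree:
  assumes "(i, j) \<in> support2 f" shows "i + j \<le> total_degree2 f"
  unfolding total_degree2_def using assms by (intro Max_ge) (auto simp: finite_support2)

lemma homogenize2_scale:
  "homogenize2 f (k * X) (k * Y) (k * Z) = k ^ total_degree2 f * homogenize2 f X Y Z"
proof -
  have "k ^ i * k ^ j * k ^ (total_degree2 f - (i + j)) = k ^ total_degree2 f" if "(i, j) \<in> support2 f" for i j
    using support2_total_degree[OF that] by (simp flip: power_add)
  then show ?thesis
    unfolding homogenize2_def sum_distrib_left
    by (intro sum.cong) (auto simp: power_mult_distrib mult_ac)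
qed

lemma continuous_on_homogenize2:
  assumes "continuous_on S X" "continuous_on S Y" "continuous_on S Z"
  shows "continuous_on S (\<lambda>t. homogenize2 f (X t) (Y t) (Z t))"
  unfolding homogenize2_def case_prod_unfold using assms by (intro continuous_intros)

lemma proj_closure_iff:
  assumes "(X, Y, Z) \<noteq> (0, 0, 0)"
  shows "proj X Y Z \<in> proj_closure f \<longleftrightarrow> homogenize2 f X Y Z = 0"
proof
  assume "proj X Y Z \<in> proj_closure f"
  then obtain X' Y' Z' where "proj X Y Z = proj X' Y' Z'" "homogenize2 f X' Y' Z' = 0"
    by (auto simp: proj_closure_def)
  then obtain k where "k \<noteq> 0" "homogenize2 f (k * X) (k * Y) (k * Z) = 0" by (auto simp: proj_eq_iff)
  then show "homogenize2 f X Y Z = 0" by (simp add: homogenize2_scale)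
qed (use assms in \<open>auto simp: proj_closure_def\<close>)

locale curve_at_infinity = puiseux_polynomial W \<psi> e \<sigma> N \<zeta> c \<rho> g d
  for W \<psi> e \<sigma> N \<zeta> c \<rho> g d +
  fixes f :: "complex poly poly" and a :: complex
  assumes f_g: "\<And>x y. eval2 f (x + a * y) y = eval2 g x y" and deg_f: "total_degree2 f = d"
begin

text \<open>For t \<noteq> 0, [1 + a \<mu> : \<mu> : t^N] is the affine point (x + a y, y) with x =
  1 / t^N and y = \<mu> / t^N, and \<open>g\<close> factors. Continuity in t extends this to the
  line at infinity, t = 0.\<close>

lemma homogenize2_branches:
  assumes t: "norm t < \<rho>"
  shows "homogenize2 f (1 + a * \<mu>) \<mu> (t ^ N) = c * (\<Prod>l\<in>W. (\<mu> - \<psi> l t) ^ e l)"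
proof -
  let ?h = "\<lambda>t. homogenize2 f (1 + a * \<mu>) \<mu> (t ^ N)" and ?r = "\<lambda>t. c * (\<Prod>l\<in>W. (\<mu> - \<psi> l t) ^ e l)"
  have nz: "?h t = ?r t" if t: "t \<in> ball 0 \<rho> - {0}" for t
  proof -
    have t0: "t ^ N \<noteq> 0" using t by auto
    have "?h t = (t ^ N) ^ d * eval2 f ((1 + a * \<mu>) / t ^ N) (\<mu> / t ^ N)"
      using t0 by (simp add: homogenize2_eq deg_f)
    also have "eval2 f ((1 + a * \<mu>) / t ^ N) (\<mu> / t ^ N) = eval2 g (1 / t ^ N) (\<mu> / t ^ N)"
      unfolding f_g[symmetric] by (simp add: add_divide_distrib)
    also have "\<dots> = G t \<mu>" by (rule G_eq[OF t, symmetric])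
    finally have "?h t = (t ^ N) ^ d * G t \<mu>" .
    moreover have "t \<noteq> 0" using t by simp
    ultimately show ?thesis by (simp add: G_def power_mult)
  qed
  show ?thesis
  proof (cases "t = 0")
    case True
    have "continuous_on (ball 0 \<rho>) ?h" "continuous_on (ball 0 \<rho>) ?r"
      by (intro continuous_on_homogenize2 continuous_intros holomorphic_on_imp_continuous_on hol; simp)+
    then have lim: "(?h \<longlongrightarrow> ?h 0) (at 0)" "(?r \<longlongrightarrow> ?r 0) (at 0)"
      using \<rho> by (simp_all only: continuous_on_eq_continuous_at[OF open_ball] isCont_def) auto
    have "(?h \<longlongrightarrow> ?r 0) (at 0)"
      using lim(2) by (rule Lim_transform_eventually) (use ev_small in eventually_elim, simp add: nz)
    then show ?thesis using lim(1) tendsto_unique[OF trivial_limit_at] True by blast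
  qed (use nz t in simp)
qed

lemma homogenize2_eq_0_iff:
  assumes "norm \<nu> < \<rho> ^ N"
  shows "homogenize2 f (1 + a * \<mu>) \<mu> \<nu> = 0 \<longleftrightarrow> (\<exists>l\<in>I. (\<mu>, \<nu>) \<in> branch l)"
proof
  let ?t = "nth_root N \<nu>"
  have t: "?t ^ N = \<nu>" "norm ?t < \<rho>"
    using nth_root_power[OF Npos] norm_nth_root_less[OF Npos _ assms] \<rho> by auto
  assume "homogenize2 f (1 + a * \<mu>) \<mu> \<nu> = 0"
  then have "c * (\<Prod>l\<in>W. (\<mu> - \<psi> l ?t) ^ e l) = 0" using homogenize2_branches[OF t(2)] t(1) by simp
  then obtain l where "l \<in> W" "e l > 0" "\<mu> = \<psi> l ?t"
    using finW g by (auto simp: degree_bounded_def)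
  moreover from this have "(\<mu>, \<nu>) \<in> branch l"
    unfolding branch_def using t by (intro CollectI exI[of _ ?t]) simp
  ultimately show "\<exists>l\<in>I. (\<mu>, \<nu>) \<in> branch l" by (auto simp: I_def)
next
  assume "\<exists>l\<in>I. (\<mu>, \<nu>) \<in> branch l"
  then obtain l t where l: "l \<in> W" "e l > 0" "\<mu> = \<psi> l t" "\<nu> = t ^ N" "norm t < \<rho>"
    by (auto simp: I_def branch_def)
  then have "(\<Prod>l\<in>W. (\<mu> - \<psi> l t) ^ e l) = 0" using finW by auto
  then show "homogenize2 f (1 + a * \<mu>) \<mu> \<nu> = 0" using homogenize2_branches[OF l(5)] l(4) by simp
qed

definition rep :: "complex set \<Rightarrow> complex" where "rep Q = (SOME l. l \<in> I \<and> orb l = Q)"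

lemma rep: assumes "Q \<in> orb ` I" shows "rep Q \<in> I" "orb (rep Q) = Q"
proof -
  have "\<exists>l. l \<in> I \<and> orb l = Q" using assms by auto
  from someI_ex[OF this] show "rep Q \<in> I" "orb (rep Q) = Q" unfolding rep_def by simp_all
qed

text \<open>The branches through the point [1 + a v : v : 0] at infinity. By
  \<open>\<psi>_0_orb\<close> the condition does not depend on the representative.\<close>

definition orbs_at :: "complex \<Rightarrow> complex set set" where
  "orbs_at v = {Q \<in> orb ` I. \<psi> (rep Q) 0 = v}"

lemma \<psi>_0_orb:
  assumes "l \<in> W" "m \<in> W" "orb l = orb m" shows "\<psi> l 0 = \<psi> m 0"
proof -
  obtain k where "l = (\<sigma> ^^ k) m" using orb_eqD[OF assms(3)] by blast
  then show ?thesis using assms \<rho> by (simp add: \<psi>_\<sigma>pow)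
qed

end

text \<open>The chart coordinates are \<open>q\<close>, and \<open>[X q : Y q : Z q]\<close> the point of the projective plane;
  \<open>\<mu> = Y / (X - a Y)\<close> and \<open>\<nu> = Z / (X - a Y)\<close> are the affine coordinates at infinity in which the
  branches are parametrized, and \<open>q = (ot \<mu> / wd \<mu>, \<nu> / wd \<mu>)\<close> is the inverse change of
  coordinates.\<close>

locale branch_chart = curve_at_infinity W \<psi> e \<sigma> N \<zeta> c \<rho> g d f a
  for W \<psi> e \<sigma> N \<zeta> c \<rho> g d f a +
  fixes X Y Z :: "complex \<times> complex \<Rightarrow> complex" and wd ot :: "complex \<Rightarrow> complex"
  assumes XYZ: "holomorphic2_on X UNIV" "holomorphic2_on Y UNIV" "holomorphic2_on Z UNIV"
    and wd: "wd holomorphic_on UNIV" and ot: "ot holomorphic_on UNIV"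
    and XYZ_nz: "\<And>q. (X q, Y q, Z q) \<noteq> (0, 0, 0)"
    and chart_to: "\<And>\<mu> \<nu>. wd \<mu> \<noteq> 0 \<Longrightarrow> X (ot \<mu> / wd \<mu>, \<nu> / wd \<mu>) - a * Y (ot \<mu> / wd \<mu>, \<nu> / wd \<mu>) = 1 / wd \<mu> \<and>
       Y (ot \<mu> / wd \<mu>, \<nu> / wd \<mu>) = \<mu> / wd \<mu> \<and> Z (ot \<mu> / wd \<mu>, \<nu> / wd \<mu>) = \<nu> / wd \<mu>"
    and chart_from: "\<And>q. X q - a * Y q \<noteq> 0 \<Longrightarrow> wd (Y q / (X q - a * Y q)) \<noteq> 0 \<and>
       q = (ot (Y q / (X q - a * Y q)) / wd (Y q / (X q - a * Y q)),
            Z q / (X q - a * Y q) / wd (Y q / (X q - a * Y q)))"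
begin

definition den where "den q = X q - a * Y q"
definition \<xi> where "\<xi> q = (Y q / den q, Z q / den q)"
definition chi where "chi \<mu> \<nu> = (ot \<mu> / wd \<mu>, \<nu> / wd \<mu>)"
definition S where "S = (\<lambda>q. proj (X q) (Y q) (Z q)) -` proj_closure f"
text \<open>Since division by zero yields 0, points with \<open>den q\<close> = 0 would be read as
  (\<mu>, \<nu>) = (0, 0); the first condition excludes them.\<close>

definition T where "T l = {q. den q \<noteq> 0 \<and> \<xi> q \<in> branch l}"

lemma den_chi: "wd \<mu> \<noteq> 0 \<Longrightarrow> den (chi \<mu> \<nu>) \<noteq> 0"
  and \<xi>_chi: "wd \<mu> \<noteq> 0 \<Longrightarrow> \<xi> (chi \<mu> \<nu>) = (\<mu>, \<nu>)"
proof -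
  assume w: "wd \<mu> \<noteq> 0"
  then have "den (chi \<mu> \<nu>) = 1 / wd \<mu>" "Y (chi \<mu> \<nu>) = \<mu> / wd \<mu>" "Z (chi \<mu> \<nu>) = \<nu> / wd \<mu>"
    using chart_to[of \<mu> \<nu>] unfolding den_def chi_def by blast+
  then show "den (chi \<mu> \<nu>) \<noteq> 0" "\<xi> (chi \<mu> \<nu>) = (\<mu>, \<nu>)" using w by (simp_all add: \<xi>_def)
qed

lemma chi_\<xi>: "den q \<noteq> 0 \<Longrightarrow> wd (fst (\<xi> q)) \<noteq> 0 \<and> q = chi (fst (\<xi> q)) (snd (\<xi> q))"
  using chart_from[of q] by (simp add: \<xi>_def den_def chi_def)

lemma holomorphic2_den: "holomorphic2_on den UNIV"
proof -
  have "holomorphic2_on (\<lambda>q. X q + (- a) * Y q) UNIV"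
    by (intro holomorphic2_on_add holomorphic2_on_mult XYZ holomorphic2_on_const)
  then show ?thesis by (simp add: den_def[abs_def])
qed

lemma open_den: "open {q. den q \<noteq> 0}"
  using continuous_on_holomorphic2[OF holomorphic2_den] by (intro open_Collect_neq) auto

lemma holomorphic2_\<xi>:
  "holomorphic2_on (\<lambda>q. Y q / den q) {q. den q \<noteq> 0}" "holomorphic2_on (\<lambda>q. Z q / den q) {q. den q \<noteq> 0}"
  using XYZ holomorphic2_den by (auto intro!: holomorphic2_on_divide elim: holomorphic2_on_subset)

lemma continuous_\<xi>: "continuous_on {q. den q \<noteq> 0} \<xi>"
  unfolding \<xi>_def[abs_def] by (intro continuous_on_Pair continuous_on_holomorphic2 holomorphic2_\<xi>)

lemma eventually_\<xi>:
  assumes "den p \<noteq> 0" "open V" "\<xi> p \<in> V"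
  shows "\<forall>\<^sub>F q in nhds p. den q \<noteq> 0 \<and> \<xi> q \<in> V"
proof -
  have "open ({q. den q \<noteq> 0} \<inter> \<xi> -` V)"
    using continuous_\<xi> open_den assms(2) by (rule continuous_open_preimage)
  then show ?thesis using assms by (auto simp: eventually_nhds)
qed

lemma S_iff:
  assumes "den q \<noteq> 0"
  shows "q \<in> S \<longleftrightarrow> homogenize2 f (1 + a * fst (\<xi> q)) (fst (\<xi> q)) (snd (\<xi> q)) = 0"
proof -
  let ?D = "den q" and ?\<mu> = "fst (\<xi> q)" and ?\<nu> = "snd (\<xi> q)"
  have "X q = ?D * (1 + a * ?\<mu>)" "Y q = ?D * ?\<mu>" "Z q = ?D * ?\<nu>"
    using assms by (simp_all add: \<xi>_def distrib_left) (simp add: den_def)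
  then have "homogenize2 f (X q) (Y q) (Z q) = ?D ^ total_degree2 f * homogenize2 f (1 + a * ?\<mu>) ?\<mu> ?\<nu>"
    by (simp only: homogenize2_scale)
  then show ?thesis using assms by (simp add: S_def proj_closure_iff[OF XYZ_nz])
qed

lemma analytic_T:
  assumes l: "l \<in> W" and p: "den p \<noteq> 0" "\<xi> p = (v, 0)"
  shows "analytic_at p (T l)"
  unfolding analytic_at_def
proof (intro exI conjI ballI)
  let ?V = "UNIV \<times> ball 0 (\<rho> ^ N) :: (complex \<times> complex) set"
  let ?U = "{q. den q \<noteq> 0} \<inter> \<xi> -` ?V"
  show "open ?U" using continuous_\<xi> open_den by (rule continuous_open_preimage) (intro open_Times open_UNIV open_ball)
  show "p \<in> ?U" using p \<rho> by simp
  show "finite {\<lambda>q. branch_fun l (Y q / den q, Z q / den q)}" by simp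
  show "holomorphic2_on h ?U" if "h \<in> {\<lambda>q. branch_fun l (Y q / den q, Z q / den q)}" for h
  proof -
    have "holomorphic2_on (\<lambda>q. branch_fun l (Y q / den q, Z q / den q)) ?U"
      by (rule holomorphic2_on_compose[OF holomorphic2_on_subset[OF holomorphic2_\<xi>(1)]
            holomorphic2_on_subset[OF holomorphic2_\<xi>(2)] holomorphic2_branch_fun[OF l]])
         (auto simp: \<xi>_def)
    then show ?thesis using that by simp
  qed
  show "T l \<inter> ?U = {z \<in> ?U. \<forall>h\<in>{\<lambda>q. branch_fun l (Y q / den q, Z q / den q)}. h z = 0}"
    using branch_fun_eq_0_iff[OF l] by (auto simp: T_def \<xi>_def)
qed

lemma curve_in_T:
  assumes l: "l \<in> W" and v: "\<psi> l 0 = v" and wdv: "wd v \<noteq> 0"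
  shows "\<exists>r>0. ball (0 :: complex) r \<subseteq> ball 0 \<rho> \<and> (\<forall>t\<in>ball 0 r. wd (\<psi> l t) \<noteq> 0 \<and> chi (\<psi> l t) (t ^ N) \<in> T l)"
proof -
  have "continuous_on (ball 0 \<rho>) (\<lambda>t. wd (\<psi> l t))"
    using holomorphic_on_imp_continuous_on[OF wd] holomorphic_on_imp_continuous_on[OF hol[OF l]]
    by (rule continuous_on_compose2) auto
  then have "open (ball 0 \<rho> \<inter> (\<lambda>t. wd (\<psi> l t)) -` (- {0}))"
    by (intro continuous_open_preimage) auto
  moreover have "0 \<in> ball 0 \<rho> \<inter> (\<lambda>t. wd (\<psi> l t)) -` (- {0})" using v wdv \<rho> by simp
  ultimately obtain r where r: "r > 0" "ball 0 r \<subseteq> ball 0 \<rho> \<inter> (\<lambda>t. wd (\<psi> l t)) -` (- {0})" by (meson openE)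
  have "wd (\<psi> l t) \<noteq> 0 \<and> chi (\<psi> l t) (t ^ N) \<in> T l" if t: "t \<in> ball 0 r" for t
  proof -
    have "wd (\<psi> l t) \<noteq> 0" "norm t < \<rho>" using r(2) t by auto
    then show ?thesis using den_chi \<xi>_chi by (auto simp: T_def branch_def)
  qed
  then show ?thesis using r by (intro exI[of _ r]) blast
qed

text \<open>The case t \<mapsto> chi (\<psi> l t) (t^N) of \<open>irreducible_curve\<close>: near
  \<open>p\<close> the coordinate \<nu> = t^N is small, hence so is the parameter.\<close>

lemma irreducible_T:
  assumes l: "l \<in> W" "\<psi> l 0 = v" and p: "den p \<noteq> 0" "\<xi> p = (v, 0)"
  shows "irreducible_at p (T l)"
proof -
  have wdv: "wd v \<noteq> 0" and pchi: "p = chi v 0" using chi_\<xi>[OF p(1)] p(2) by simp_all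
  obtain r where r: "r > 0" "ball (0 :: complex) r \<subseteq> ball 0 \<rho>" "\<And>t. t \<in> ball 0 r \<Longrightarrow> wd (\<psi> l t) \<noteq> 0"
      "\<And>t. t \<in> ball 0 r \<Longrightarrow> chi (\<psi> l t) (t ^ N) \<in> T l"
    using curve_in_T[OF l wdv] by blast
  have \<psi>r: "\<psi> l holomorphic_on ball 0 r" using hol[OF l(1)] r(2) by (rule holomorphic_on_subset)
  have comp: "(\<lambda>t. h (\<psi> l t)) holomorphic_on ball 0 r" if "h holomorphic_on UNIV" for h
    using holomorphic_on_compose_gen[OF \<psi>r that] by (simp add: comp_def)
  show ?thesis
  proof (rule irreducible_curve[of r "\<lambda>t. ot (\<psi> l t) / wd (\<psi> l t)" "\<lambda>t. t ^ N / wd (\<psi> l t)"])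
    show "r > 0" by (fact r(1))
    show "(\<lambda>t. ot (\<psi> l t) / wd (\<psi> l t)) holomorphic_on ball 0 r"
      "(\<lambda>t. t ^ N / wd (\<psi> l t)) holomorphic_on ball 0 r"
      using comp[OF wd] comp[OF ot] r(3) by (auto intro!: holomorphic_intros)
    show "p = (ot (\<psi> l 0) / wd (\<psi> l 0), 0 ^ N / wd (\<psi> l 0))"
      using pchi l(2) Npos by (simp add: chi_def)
    show "analytic_at p (T l)" by (rule analytic_T[OF l(1) p])
    have "\<forall>\<^sub>F t in nhds 0. t \<in> ball 0 r" using r(1) by (intro eventually_nhds_in_open) auto
    then show "\<forall>\<^sub>F t in nhds 0. (ot (\<psi> l t) / wd (\<psi> l t), t ^ N / wd (\<psi> l t)) \<in> T l"
      by eventually_elim (use r(4) in \<open>simp add: chi_def\<close>)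
    fix \<epsilon> :: real assume \<epsilon>: "\<epsilon> > 0"
    have "\<forall>\<^sub>F q in nhds p. den q \<noteq> 0 \<and> \<xi> q \<in> UNIV \<times> ball 0 (\<epsilon> ^ N)"
      by (rule eventually_\<xi>[OF p(1)]) (use \<epsilon> p(2) in \<open>auto intro!: open_Times\<close>)
    then show "\<forall>\<^sub>F q in nhds p. q \<in> T l \<longrightarrow>
        (\<exists>t. norm t < \<epsilon> \<and> q = (ot (\<psi> l t) / wd (\<psi> l t), t ^ N / wd (\<psi> l t)))"
    proof eventually_elim
      case (elim q)
      show ?case
      proof
        assume "q \<in> T l"
        then obtain t where t: "\<xi> q = (\<psi> l t, t ^ N)" by (auto simp: T_def branch_def)
        then have "norm t ^ N < \<epsilon> ^ N" using elim by (simp add: norm_power)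
        then have "norm t < \<epsilon>" using \<epsilon> power_less_imp_less_base by (metis less_imp_le)
        moreover have "q = chi (\<psi> l t) (t ^ N)" using chi_\<xi>[of q] elim t by simp
        ultimately show "\<exists>t. norm t < \<epsilon> \<and> q = (ot (\<psi> l t) / wd (\<psi> l t), t ^ N / wd (\<psi> l t))"
          by (auto simp: chi_def)
      qed
    qed
  qed
qed

lemma T_germ_le:
  assumes l: "l \<in> W" "\<psi> l 0 = v" and m: "m \<in> W" and p: "den p \<noteq> 0" "\<xi> p = (v, 0)"
    and le: "germ_le p (T l) (T m)"
  shows "orb l = orb m"
proof -
  have wdv: "wd v \<noteq> 0" and pchi: "p = chi v 0" using chi_\<xi>[OF p(1)] p(2) by simp_all
  obtain r where r: "r > 0" "ball (0 :: complex) r \<subseteq> ball 0 \<rho>" "\<And>t. t \<in> ball 0 r \<Longrightarrow> wd (\<psi> l t) \<noteq> 0"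
      "\<And>t. t \<in> ball 0 r \<Longrightarrow> chi (\<psi> l t) (t ^ N) \<in> T l"
    using curve_in_T[OF l wdv] by blast
  have cont: "continuous_on (ball 0 r) (\<lambda>t. h (\<psi> l t))" if "h holomorphic_on UNIV" for h
    using holomorphic_on_imp_continuous_on[OF that]
      continuous_on_subset[OF holomorphic_on_imp_continuous_on[OF hol[OF l(1)]] r(2)]
    by (rule continuous_on_compose2) auto
  have "continuous_on (ball 0 r) (\<lambda>t. chi (\<psi> l t) (t ^ N))"
    unfolding chi_def using cont[OF wd] cont[OF ot] r(3) by (intro continuous_intros) auto
  then have "((\<lambda>t. chi (\<psi> l t) (t ^ N)) \<longlongrightarrow> chi (\<psi> l 0) (0 ^ N)) (at 0)"
    using r(1) by (simp only: continuous_on_eq_continuous_at[OF open_ball] isCont_def) auto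
  then have lim: "filterlim (\<lambda>t. chi (\<psi> l t) (t ^ N)) (nhds p) (at 0)"
    using pchi l(2) Npos by (simp add: zero_power)
  have "\<forall>\<^sub>F t in at 0. chi (\<psi> l t) (t ^ N) \<in> T l \<longrightarrow> chi (\<psi> l t) (t ^ N) \<in> T m"
    using lim le unfolding germ_le_def by (auto dest: filterlim_iff[THEN iffD1, rule_format])
  moreover have "\<forall>\<^sub>F t in at 0. t \<in> ball 0 r - {0 :: complex}"
    using r(1) by (auto simp: eventually_at intro!: exI[of _ r])
  ultimately have "\<forall>\<^sub>F t in at 0. chi (\<psi> l t) (t ^ N) \<in> T m \<and> t \<in> ball 0 r - {0}"
    by eventually_elim (use r(4) in auto)
  then obtain t where t: "chi (\<psi> l t) (t ^ N) \<in> T m" "t \<in> ball 0 r - {0}"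
    using eventually_happens'[OF at_neq_bot] by blast
  then have "(\<psi> l t, t ^ N) \<in> branch m" using r(3)[of t] \<xi>_chi by (auto simp: T_def)
  then show ?thesis using branch_meet[OF l(1) m, of t] t(2) r(2) by auto
qed

text \<open>Near \<open>p\<close> the curve is the union of the branches, and those that start
  elsewhere on the line at infinity stay away: small \<nu> forces small t, hence \<mu> near
  \<open>\<psi> l 0\<close> and far from \<open>v\<close>.\<close>

lemma germ_S:
  assumes p: "den p \<noteq> 0" "\<xi> p = (v, 0)"
  shows "germ_eq p S (\<Union>Q\<in>orbs_at v. T (rep Q))"
proof -
  have far: "\<forall>\<^sub>F q in nhds p. \<xi> q \<notin> branch l" if l: "l \<in> W" "\<psi> l 0 \<noteq> v" for l
  proof -
    define D where "D = norm (\<psi> l 0 - v) / 2"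
    have D: "D > 0" using l by (simp add: D_def)
    have "isCont (\<psi> l) 0"
      using holomorphic_on_imp_continuous_on[OF hol[OF l(1)]] \<rho> by (simp add: continuous_on_eq_continuous_at)
    then obtain \<eta> where \<eta>: "\<eta> > 0" "\<And>t. norm t < \<eta> \<Longrightarrow> norm (\<psi> l t - \<psi> l 0) < D"
      using D unfolding continuous_at_eps_delta by (auto simp: dist_norm)
    have "\<forall>\<^sub>F q in nhds p. den q \<noteq> 0 \<and> \<xi> q \<in> ball v D \<times> ball 0 (\<eta> ^ N)"
      by (rule eventually_\<xi>[OF p(1)]) (use \<eta> D p(2) in \<open>auto intro!: open_Times\<close>)
    then show ?thesis
    proof eventually_elim
      case (elim q)
      show ?case
      proof
        assume "\<xi> q \<in> branch l"
        then obtain t where t: "\<xi> q = (\<psi> l t, t ^ N)" by (auto simp: branch_def)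
        then have "norm t ^ N < \<eta> ^ N" using elim by (simp add: norm_power)
        then have "norm t < \<eta>" using \<eta>(1) power_less_imp_less_base by (metis less_imp_le)
        then have "norm (\<psi> l t - \<psi> l 0) < D" by (rule \<eta>(2))
        moreover have "norm (v - \<psi> l t) < D" using elim t by (simp add: dist_norm)
        ultimately show False
          using norm_triangle_ineq[of "v - \<psi> l t" "\<psi> l t - \<psi> l 0"] by (simp add: D_def norm_minus_commute)
      qed
    qed
  qed
  have "\<forall>\<^sub>F q in nhds p. \<forall>l\<in>{l \<in> W. \<psi> l 0 \<noteq> v}. \<xi> q \<notin> branch l"
    using far finW by (intro eventually_ball_finite) auto
  moreover have "\<forall>\<^sub>F q in nhds p. den q \<noteq> 0 \<and> \<xi> q \<in> UNIV \<times> ball 0 (\<rho> ^ N)"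
    by (rule eventually_\<xi>[OF p(1)]) (use \<rho> p(2) in \<open>auto intro!: open_Times\<close>)
  ultimately show ?thesis unfolding germ_eq_def
  proof eventually_elim
    case (elim q)
    have "norm (snd (\<xi> q)) < \<rho> ^ N" using elim(2) by (auto simp: mem_Times_iff)
    then have iff: "q \<in> S \<longleftrightarrow> (\<exists>l\<in>I. \<xi> q \<in> branch l)"
      using S_iff homogenize2_eq_0_iff elim(2) by simp
    show ?case
    proof
      assume "q \<in> S"
      then obtain l where l: "l \<in> I" "\<xi> q \<in> branch l" using iff by blast
      have lW: "l \<in> W" by (rule I_W[OF l(1)])
      have v: "\<psi> l 0 = v" using elim(1) l lW by blast
      have r: "rep (orb l) \<in> I" "orb (rep (orb l)) = orb l" using rep[of "orb l"] l(1) by auto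
      have "branch (rep (orb l)) = branch l" "\<psi> (rep (orb l)) 0 = \<psi> l 0"
        using branch_orb[OF I_W[OF r(1)] lW r(2)] \<psi>_0_orb[OF I_W[OF r(1)] lW r(2)] by auto
      then have "orb l \<in> orbs_at v" "q \<in> T (rep (orb l))"
        using l v elim(2) by (auto simp: orbs_at_def T_def)
      then show "q \<in> (\<Union>Q\<in>orbs_at v. T (rep Q))" by blast
    next
      assume "q \<in> (\<Union>Q\<in>orbs_at v. T (rep Q))"
      then show "q \<in> S" using iff rep by (auto simp: orbs_at_def T_def)
    qed
  qed
qed

lemma chart_components:
  assumes p: "den p \<noteq> 0" "\<xi> p = (v, 0)"
  shows "(\<forall>Q\<in>orbs_at v. germ p (T (rep Q)) \<in> irreducible_components_at p S) \<and>
    inj_on (\<lambda>Q. germ p (T (rep Q))) (orbs_at v)"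
proof
  have r: "rep Q \<in> W" "\<psi> (rep Q) 0 = v" "orb (rep Q) = Q" if "Q \<in> orbs_at v" for Q
    using that rep[of Q] I_W by (auto simp: orbs_at_def)
  have anti: "Q = R" if "Q \<in> orbs_at v" "R \<in> orbs_at v" "germ_le p (T (rep Q)) (T (rep R))" for Q R
    using T_germ_le[OF r(1,2)[OF that(1)] r(1)[OF that(2)] p that(3)] r(3) that by simp
  have fin: "finite (orbs_at v)" using finI by (simp add: orbs_at_def)
  show "\<forall>Q\<in>orbs_at v. germ p (T (rep Q)) \<in> irreducible_components_at p S"
  proof
    fix Q assume Q: "Q \<in> orbs_at v"
    show "germ p (T (rep Q)) \<in> irreducible_components_at p S"
    proof (rule irreducible_componentsI[where T="\<lambda>Q. T (rep Q)" and K="orbs_at v"])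
      show "irreducible_at p (T (rep R))" if "R \<in> orbs_at v" for R
        using irreducible_T[OF r(1,2)[OF that] p] .
    qed (use fin germ_S[OF p] anti Q in blast)+
  qed
  show "inj_on (\<lambda>Q. germ p (T (rep Q))) (orbs_at v)"
  proof (rule inj_onI)
    fix Q R assume QR: "Q \<in> orbs_at v" "R \<in> orbs_at v" "germ p (T (rep Q)) = germ p (T (rep R))"
    then have "germ_le p (T (rep Q)) (T (rep R))" by (simp add: germ_eq_iff germ_inject[unfolded germ_eq_iff])
    then show "Q = R" by (rule anti[OF QR(1,2)])
  qed
qed

end

section \<open>Branches over all points at infinity\<close>

context curve_at_infinity
begin

lemma inj_proj_charts: "inj (\<lambda>(u, v). proj 1 u v)" "inj (\<lambda>(u, v). proj u 1 v)"
  by (auto simp: inj_def proj_eq_iff)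

text \<open>\<open>proj_chart\<close> prefers the chart X = 1, which contains the point because its
  first coordinate is nonzero. There \<mu> = u / (1 - a u), with inverse u = \<mu> / (1 + a
  \<mu>).\<close>

lemma branches_at_chart1:
  assumes v: "1 + a * v \<noteq> 0"
  shows "\<exists>F. (\<forall>Q\<in>orbs_at v. F Q \<in> branches_at (proj (1 + a * v) v 0) (proj_closure f)) \<and> inj_on F (orbs_at v)"
proof -
  let ?P = "proj (1 + a * v) v 0" and ?ch = "\<lambda>(u, w). proj 1 u w" and ?p = "(v / (1 + a * v), 0)"
  interpret branch_chart W \<psi> e \<sigma> N \<zeta> c \<rho> g d f a "\<lambda>_. 1" fst snd "\<lambda>\<mu>. 1 + a * \<mu>" "\<lambda>\<mu>. \<mu>"
  proof
    show "(1::complex) - a * fst (\<mu> / (1 + a * \<mu>), \<nu> / (1 + a * \<mu>)) = 1 / (1 + a * \<mu>) \<and>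
        fst (\<mu> / (1 + a * \<mu>), \<nu> / (1 + a * \<mu>)) = \<mu> / (1 + a * \<mu>) \<and>
        snd (\<mu> / (1 + a * \<mu>), \<nu> / (1 + a * \<mu>)) = \<nu> / (1 + a * \<mu>)" if "1 + a * \<mu> \<noteq> 0" for \<mu> \<nu>
      using that by (simp add: field_simps)
    fix q :: "complex \<times> complex" assume q: "1 - a * fst q \<noteq> 0"
    have eq: "1 + a * (fst q / (1 - a * fst q)) = 1 / (1 - a * fst q)" using q by (simp add: field_simps)
    show "1 + a * (fst q / (1 - a * fst q)) \<noteq> 0 \<and>
       q = (fst q / (1 - a * fst q) / (1 + a * (fst q / (1 - a * fst q))),
            snd q / (1 - a * fst q) / (1 + a * (fst q / (1 - a * fst q))))"
      unfolding eq using q by (simp add: prod_eq_iff)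
  qed (auto intro!: holomorphic_intros holomorphic2_on_const holomorphic2_on_fst holomorphic2_on_snd)
  have "?P = ?ch ?p" using v by (auto simp: proj_eq_iff intro!: exI[of _ "1 / (1 + a * v)"])
  then have ch: "proj_chart ?P = ?ch" and inv: "inv ?ch ?P = ?p"
    using inj_proj_charts(1) by (auto simp: proj_chart_def intro: inv_f_eq)
  have den: "den ?p = 1 / (1 + a * v)" using v by (simp add: den_def field_simps)
  have "S = ?ch -` proj_closure f" by (simp add: S_def case_prod_unfold)
  then have br: "branches_at ?P (proj_closure f) = irreducible_components_at ?p S"
    by (simp only: branches_at_def ch inv)
  have "den ?p \<noteq> 0" "\<xi> ?p = (v, 0)" using v by (simp_all add: den \<xi>_def)
  note comps = chart_components[OF this]
  show ?thesis
    unfolding br by (rule exI[of _ "\<lambda>Q. germ ?p (T (rep Q))"]) (rule comps)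
qed

text \<open>Here v = - 1 / a, and the point is [0 : 1 : 0], outside the chart X = 1 and at the
  origin of the chart Y = 1.\<close>

lemma branches_at_chart2:
  assumes v: "1 + a * v = 0"
  shows "\<exists>F. (\<forall>Q\<in>orbs_at v. F Q \<in> branches_at (proj (1 + a * v) v 0) (proj_closure f)) \<and> inj_on F (orbs_at v)"
proof -
  let ?P = "proj (1 + a * v) v 0" and ?ch = "\<lambda>(u, w). proj u 1 w" and ?p = "(0 :: complex, 0 :: complex)"
  have a0: "a \<noteq> 0" and v0: "v \<noteq> 0" using v by auto
  interpret branch_chart W \<psi> e \<sigma> N \<zeta> c \<rho> g d f a fst "\<lambda>_. 1" snd "\<lambda>\<mu>. \<mu>" "\<lambda>\<mu>. 1 + a * \<mu>"
  proof
    show "fst ((1 + a * \<mu>) / \<mu>, \<nu> / \<mu>) - a * 1 = 1 / \<mu> \<and> 1 = \<mu> / \<mu> \<and>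
        snd ((1 + a * \<mu>) / \<mu>, \<nu> / \<mu>) = \<nu> / \<mu>" if "\<mu> \<noteq> 0" for \<mu> \<nu>
      using that by (simp add: add_divide_distrib)
    fix q :: "complex \<times> complex" assume q: "fst q - a * 1 \<noteq> 0"
    define D where "D = fst q - a * 1"
    have "D \<noteq> 0" using q unfolding D_def .
    then have "(1 + a * (1 / D)) / (1 / D) = D + a" by (simp add: distrib_right)
    then have "(1 + a * (1 / (fst q - a * 1))) / (1 / (fst q - a * 1)) = fst q" by (simp add: D_def)
    then show "1 / (fst q - a * 1) \<noteq> 0 \<and>
       q = ((1 + a * (1 / (fst q - a * 1))) / (1 / (fst q - a * 1)),
            snd q / (fst q - a * 1) / (1 / (fst q - a * 1)))"
      using q by (simp add: prod_eq_iff)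
  qed (auto intro!: holomorphic_intros holomorphic2_on_const holomorphic2_on_fst holomorphic2_on_snd)
  have P: "?P = ?ch ?p" using v v0 by (auto simp: proj_eq_iff intro!: exI[of _ "1 / v"])
  have "?P \<notin> range (\<lambda>(u, w). proj 1 u w)" using v by (auto simp: proj_eq_iff)
  then have ch: "proj_chart ?P = ?ch" and inv: "inv ?ch ?P = ?p"
    using P inj_proj_charts(2) by (auto simp: proj_chart_def intro: inv_f_eq)
  have den: "den ?p = - a" by (simp add: den_def)
  have "S = ?ch -` proj_closure f" by (simp add: S_def case_prod_unfold)
  then have br: "branches_at ?P (proj_closure f) = irreducible_components_at ?p S"
    by (simp only: branches_at_def ch inv)
  have "v = a * v / a" using a0 by simp
  also have "a * v = - 1" using v by (simp add: add_eq_0_iff)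
  finally have "1 / den ?p = v" unfolding den by simp
  note dv = this
  have \<xi>p: "\<xi> ?p = (v, 0)" unfolding \<xi>_def by (simp only: dv snd_conv div_0)
  have "den ?p \<noteq> 0" unfolding den neg_equal_0_iff_equal by (rule a0)
  note comps = chart_components[OF this \<xi>p]
  show ?thesis
    unfolding br by (rule exI[of _ "\<lambda>Q. germ ?p (T (rep Q))"]) (rule comps)
qed

text \<open>Orbits inject into branches: [1 + a v : v : 0] determines v, so different v give
  different points at infinity, and at a single point the germs differ by
  \<open>chart_components\<close>.\<close>

lemma card_orbits_le_branches:
  assumes fin: "finite (branches_at_infinity f)"
  shows "card (orb ` I) \<le> card (branches_at_infinity f)"
proof -
  have "\<forall>v. \<exists>F. (\<forall>Q\<in>orbs_at v. F Q \<in> branches_at (proj (1 + a * v) v 0) (proj_closure f)) \<and> inj_on F (orbs_at v)"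
    using branches_at_chart1 branches_at_chart2 by blast
  then obtain F where F: "\<And>v Q. Q \<in> orbs_at v \<Longrightarrow> F v Q \<in> branches_at (proj (1 + a * v) v 0) (proj_closure f)"
      "\<And>v. inj_on (F v) (orbs_at v)" by metis
  define vv where "vv Q = \<psi> (rep Q) 0" for Q
  define H where "H Q = (proj (1 + a * vv Q) (vv Q) 0, F (vv Q) Q)" for Q
  have at: "Q \<in> orbs_at (vv Q)" if "Q \<in> orb ` I" for Q using that by (simp add: orbs_at_def vv_def)
  have nz: "(1 + a * v, v, 0) \<noteq> (0, 0, 0 :: complex)" for v by auto
  have "H Q \<in> branches_at_infinity f" if Q: "Q \<in> orb ` I" for Q
  proof -
    have r: "rep Q \<in> W" "e (rep Q) > 0" using rep[OF Q] by (auto simp: I_def)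
    have "homogenize2 f (1 + a * vv Q) (vv Q) (0 ^ N) = c * (\<Prod>l\<in>W. (vv Q - \<psi> l 0) ^ e l)"
      using \<rho> by (intro homogenize2_branches) simp
    also have "(\<Prod>l\<in>W. (vv Q - \<psi> l 0) ^ e l) = 0"
      using r finW by (intro prod_zero bexI[of _ "rep Q"]) (auto simp: vv_def)
    finally have "homogenize2 f (1 + a * vv Q) (vv Q) 0 = 0" using Npos by (simp add: zero_power)
    then have "proj (1 + a * vv Q) (vv Q) 0 \<in> proj_closure f" using proj_closure_iff[OF nz] by blast
    moreover have "proj (1 + a * vv Q) (vv Q) 0 \<in> line_at_infinity"
      unfolding line_at_infinity_def using nz[of "vv Q"] by blast
    ultimately show ?thesis
      using F(1)[OF at[OF Q]] by (simp add: branches_at_infinity_def H_def)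
  qed
  moreover have "inj_on H (orb ` I)"
  proof (rule inj_onI)
    fix Q R assume QR: "Q \<in> orb ` I" "R \<in> orb ` I" "H Q = H R"
    then have "proj (1 + a * vv Q) (vv Q) 0 = proj (1 + a * vv R) (vv R) 0" by (simp add: H_def)
    then obtain k where k: "1 + a * vv R = k * (1 + a * vv Q)" "vv R = k * vv Q"
      by (auto simp: proj_eq_iff)
    then have "k = 1" by (simp add: algebra_simps)
    then have v: "vv Q = vv R" using k by simp
    then have "F (vv R) Q = F (vv R) R" using QR(3) by (simp add: H_def)
    then show "Q = R" using inj_onD[OF F(2), of "vv R" Q R] at[OF QR(1)] at[OF QR(2)] v by simp
  qed
  ultimately show ?thesis using fin by (intro card_inj_on_le[of H]) auto
qed

end

section \<open>Shears\<close>

lemma eval2_sum: "eval2 (\<Sum>i\<in>A. F i) x y = (\<Sum>i\<in>A. eval2 (F i) x y)"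
proof (cases "finite A")
  case True
  then show ?thesis by (induction A rule: finite_induct) (auto simp: eval2_add eval2_def[of 0])
qed (simp add: eval2_def)

text \<open>A bound instead of a maximum: it passes to sums and products and makes sense for the
  zero polynomial.\<close>

definition total_degree_le :: "complex poly poly \<Rightarrow> nat \<Rightarrow> bool" where
  "total_degree_le p n \<longleftrightarrow> (\<forall>i j. coeff (coeff p j) i \<noteq> 0 \<longrightarrow> i + j \<le> n)"

lemma total_degree_le_mult:
  assumes "total_degree_le p m" "total_degree_le q n"
  shows "total_degree_le (p * q) (m + n)"
  unfolding total_degree_le_def
proof (intro allI impI)
  fix i j assume "coeff (coeff (p * q) j) i \<noteq> 0"
  then have "(\<Sum>k\<le>j. coeff (coeff p k * coeff q (j - k)) i) \<noteq> 0" by (simp add: coeff_mult[of p q] coeff_sum)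
  then obtain k where k: "k \<le> j" "coeff (coeff p k * coeff q (j - k)) i \<noteq> 0"
    by (auto elim: sum.not_neutral_contains_not_neutral)
  then obtain l where l: "l \<le> i" "coeff (coeff p k) l * coeff (coeff q (j - k)) (i - l) \<noteq> 0"
    unfolding coeff_mult[of "coeff p k"] by (auto elim: sum.not_neutral_contains_not_neutral)
  then have "coeff (coeff p k) l \<noteq> 0" "coeff (coeff q (j - k)) (i - l) \<noteq> 0" by auto
  then have "l + k \<le> m" "(i - l) + (j - k) \<le> n" using assms unfolding total_degree_le_def by blast+
  then show "i + j \<le> m + n" using k(1) l(1) by linarith
qed

lemma total_degree_le_sum:
  assumes "\<And>i. i \<in> A \<Longrightarrow> total_degree_le (F i) n"
  shows "total_degree_le (\<Sum>i\<in>A. F i) n"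
  unfolding total_degree_le_def
proof (intro allI impI)
  fix i j assume "coeff (coeff (\<Sum>i\<in>A. F i) j) i \<noteq> 0"
  then have "(\<Sum>k\<in>A. coeff (coeff (F k) j) i) \<noteq> 0" by (simp add: coeff_sum)
  then obtain k where "k \<in> A" "coeff (coeff (F k) j) i \<noteq> 0"
    by (rule sum.not_neutral_contains_not_neutral)
  then show "i + j \<le> n" using assms by (auto simp: total_degree_le_def)
qed

lemma total_degree_le_power:
  assumes "total_degree_le p 1" shows "total_degree_le (p ^ n) n"
proof (induction n)
  case 0
  show ?case by (auto simp: total_degree_le_def coeff_1 split: if_splits)
next
  case (Suc n)
  then show ?case using total_degree_le_mult[OF assms, of "p ^ n" n] by simp
qed

text \<open>The coefficient of y^d in f (x + a y, y) is the value at (a, 1) of the top degree form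
  of f. This is a nonzero polynomial in a, so some \<open>a\<close> makes it nonzero.\<close>

lemma shear_exists:
  assumes nonconst: "\<not> (\<exists>c. f = [:[:c:]:])"
  shows "total_degree2 f > 0 \<and>
    (\<exists>a c g. degree_bounded g (total_degree2 f) c \<and> (\<forall>x y. eval2 f (x + a * y) y = eval2 g x y))"
proof
  define d where "d = total_degree2 f"
  have bound: "i + j \<le> d" if "(i, j) \<in> support2 f" for i j
    unfolding d_def using that by (rule support2_total_degree)
  have ne: "support2 f \<noteq> {}"
  proof
    assume "support2 f = {}"
    then have "coeff (coeff f j) i = 0" for i j by (auto simp: support2_def)
    then have "coeff f j = 0" for j by (intro poly_eqI) simp
    then have "f = [:[:0:]:]" by (intro poly_eqI) simp
    then show False using nonconst by blast
  qed
  have "Max ((\<lambda>(i, j). i + j) ` support2 f) \<in> (\<lambda>(i, j). i + j) ` support2 f"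
    using finite_support2 ne by (intro Max_in) auto
  then obtain i0 j0 where ij0: "(i0, j0) \<in> support2 f" "i0 + j0 = d"
    unfolding d_def total_degree2_def by auto
  show d0: "total_degree2 f > 0"
  proof (rule ccontr)
    assume "\<not> total_degree2 f > 0"
    then have z: "i = 0 \<and> j = 0" if "(i, j) \<in> support2 f" for i j
      using bound[OF that] by (simp add: d_def)
    have "coeff (coeff f j) i = coeff (coeff [:[:coeff (coeff f 0) 0:]:] j) i" for i j
      using z[of i j] by (auto simp: support2_def coeff_pCons split: nat.splits)
    then have "f = [:[:coeff (coeff f 0) 0:]:]" by (intro poly_eqI)
    then show False using nonconst by blast
  qed
  \<comment> \<open>The top degree form at y = 1. Its monomials have distinct exponents of x, so
    they cannot cancel.\<close>
  define top where "top = (\<Sum>(i, j)\<in>{(i, j) \<in> support2 f. i + j = d}. monom (coeff (coeff f j) i) i)"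
  have fintop: "finite {(i, j) \<in> support2 f. i + j = d}" by (rule finite_subset[OF _ finite_support2]) auto
  have "coeff top i0 = coeff (coeff f j0) i0"
  proof -
    have "coeff top i0 = (\<Sum>ij\<in>{(i, j) \<in> support2 f. i + j = d}. coeff (monom (coeff (coeff f (snd ij)) (fst ij)) (fst ij)) i0)"
      by (simp add: top_def coeff_sum case_prod_unfold)
    also have "\<dots> = (\<Sum>ij\<in>{(i0, j0)}. coeff (monom (coeff (coeff f (snd ij)) (fst ij)) (fst ij)) i0)"
      using fintop ij0 by (intro sum.mono_neutral_right) auto
    finally show ?thesis by simp
  qed
  then have "top \<noteq> 0" using ij0(1) by (auto simp: support2_def)
  then have "finite {z. poly top z = 0}" by (rule poly_roots_finite)
  then obtain a where a: "poly top a \<noteq> 0"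
    using infinite_UNIV_char_0[where 'a=complex] by (metis (mono_tags) UNIV_eq_I mem_Collect_eq)
  define lin :: "complex poly poly" where "lin = [:[:0, 1:], [:a:]:]"
  define term2 :: "nat \<Rightarrow> nat \<Rightarrow> complex poly poly" where
    "term2 i j = [:[:coeff (coeff f j) i:]:] * (lin ^ i * [:0, 1:] ^ j)" for i j
  define g where "g = (\<Sum>ij\<in>support2 f. term2 (fst ij) (snd ij))"
  have ev: "eval2 g x y = eval2 f (x + a * y) y" for x y
  proof -
    have "eval2 (term2 i j) x y = coeff (coeff f j) i * (x + a * y) ^ i * y ^ j" for i j
      unfolding term2_def lin_def eval2_mult eval2_power
      by (simp add: eval2_pCons eval2_def[of 0] mult.commute)
    then show ?thesis by (simp add: g_def eval2_sum eval2_altdef[of f] case_prod_unfold)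
  qed
  have tl: "total_degree_le lin 1" "total_degree_le ([:0, 1:] :: complex poly poly) 1"
    by (auto simp: total_degree_le_def lin_def coeff_pCons split: nat.splits)
  have t0: "total_degree_le [:[:b:]:] 0" for b
    by (auto simp: total_degree_le_def coeff_pCons split: nat.splits)
  have "total_degree_le (term2 (fst ij) (snd ij)) d" if "ij \<in> support2 f" for ij
  proof -
    have "total_degree_le (term2 (fst ij) (snd ij)) (0 + (fst ij + snd ij))"
      unfolding term2_def by (intro total_degree_le_mult total_degree_le_power t0 tl)
    moreover have "fst ij + snd ij \<le> d" using bound[of "fst ij" "snd ij"] that by simp
    ultimately show ?thesis unfolding total_degree_le_def by (metis add_0 le_trans)
  qed
  then have gd: "total_degree_le g d" unfolding g_def by (rule total_degree_le_sum)
  define c where "c = coeff (coeff g d) 0"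
  have gc: "coeff g d = [:c:]"
  proof (rule poly_eqI)
    fix i show "coeff (coeff g d) i = coeff [:c:] i"
    proof (cases i)
      case (Suc n)
      have "\<not> Suc n + d \<le> d" by simp
      then have "coeff (coeff g d) (Suc n) = 0" using gd unfolding total_degree_le_def by blast
      then show ?thesis using Suc by simp
    qed (simp add: c_def)
  qed
  have "c = coeff (fiber g 0) d" by (simp add: coeff_fiber gc)
  also have "fiber g 0 = (\<Sum>ij\<in>support2 f. monom (coeff (coeff f (snd ij)) (fst ij) * a ^ fst ij) (fst ij + snd ij))"
  proof -
    have "poly (fiber g 0) y = poly (\<Sum>ij\<in>support2 f. monom (coeff (coeff f (snd ij)) (fst ij) * a ^ fst ij) (fst ij + snd ij)) y" for y
      by (simp add: poly_fiber ev eval2_altdef[of f] poly_sum poly_monom case_prod_unfold power_mult_distrib power_add mult_ac)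
    then show ?thesis by (simp add: poly_eq_poly_eq_iff[symmetric] fun_eq_iff)
  qed
  also have "coeff \<dots> d = (\<Sum>ij\<in>support2 f. if fst ij + snd ij = d then coeff (coeff f (snd ij)) (fst ij) * a ^ fst ij else 0)"
    by (simp add: coeff_sum eq_commute)
  also have "\<dots> = (\<Sum>ij\<in>{(i, j) \<in> support2 f. i + j = d}. coeff (coeff f (snd ij)) (fst ij) * a ^ fst ij)"
    by (rule sum.mono_neutral_cong_right) (auto simp: finite_support2)
  also have "\<dots> = poly top a"
    by (simp add: top_def poly_sum poly_monom case_prod_unfold)
  finally have c0: "c \<noteq> 0" using a by simp
  have "degree_bounded g d c" using gd gc c0 by (simp add: degree_bounded_def total_degree_le_def)
  then show "\<exists>a c g. degree_bounded g (total_degree2 f) c \<and> (\<forall>x y. eval2 f (x + a * y) y = eval2 g x y)"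
    using ev unfolding d_def by metis
qed

section \<open>Gradient and critical sequences under the shear\<close>

lemma has_field_derivative_eval2_line:
  "((\<lambda>y. eval2 f (x + a * y) y) has_field_derivative
     a * eval2 (map_poly pderiv f) (x + a * y) y + eval2 (pderiv f) (x + a * y) y) (at y)"
proof (induction f)
  case 0
  then show ?case by (simp add: eval2_def)
next
  case (pCons b p)
  have "((\<lambda>y. poly b (x + a * y)) has_field_derivative poly (pderiv b) (x + a * y) * a) (at y)"
    by (rule DERIV_chain2[OF poly_DERIV]) (auto intro!: derivative_eq_intros)
  then have "((\<lambda>y. poly b (x + a * y) + y * eval2 p (x + a * y) y) has_field_derivative
     poly (pderiv b) (x + a * y) * a + (1 * eval2 p (x + a * y) y +
      (a * eval2 (map_poly pderiv p) (x + a * y) y + eval2 (pderiv p) (x + a * y) y) * y)) (at y)"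
    by (intro DERIV_add DERIV_mult DERIV_ident pCons.IH)
  moreover have "map_poly pderiv (pCons b p) = pCons (pderiv b) (map_poly pderiv p)"
    by (rule map_poly_pCons) (use pCons.hyps in auto)
  ultimately show ?case
    by (simp add: eval2_pCons pderiv_pCons eval2_add algebra_simps)
qed

lemma eval2_pderiv_shear:
  assumes "\<And>x y. eval2 f (x + a * y) y = eval2 g x y"
  shows "eval2 (pderiv g) x y = a * eval2 (map_poly pderiv f) (x + a * y) y + eval2 (pderiv f) (x + a * y) y"
proof (rule DERIV_unique)
  show "((\<lambda>y. eval2 g x y) has_field_derivative eval2 (pderiv g) x y) (at y)"
    using poly_DERIV[of "fiber g x" y] by (simp add: poly_fiber pderiv_fiber)
  show "((\<lambda>y. eval2 g x y) has_field_derivative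
     a * eval2 (map_poly pderiv f) (x + a * y) y + eval2 (pderiv f) (x + a * y) y) (at y)"
    using has_field_derivative_eval2_line[of f x a y] by (simp add: assms)
qed

text \<open>The y-derivative of \<open>g\<close> is a combination of the partial derivatives of
  \<open>f\<close>. |x| tends to infinity because where y dominates x, the bounded values of
  \<open>g\<close> bound y and hence the point, and elsewhere |p| is at most a multiple of 1 +
  |x|.\<close>

lemma sheared_sequence:
  assumes g: "degree_bounded g d c" and d: "d > 0"
    and f_g: "\<And>x y. eval2 f (x + a * y) y = eval2 g x y"
    and crit: "critical_value_at_infinity f \<tau>"
  shows "\<exists>x y. filterlim (\<lambda>k. norm (x k)) at_top sequentially \<and>
    (\<lambda>k. eval2 g (x k) (y k)) \<longlonglongrightarrow> \<tau> \<and> (\<lambda>k. eval2 (pderiv g) (x k) (y k)) \<longlonglongrightarrow> 0"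
proof -
  obtain p where p: "filterlim (\<lambda>k. norm (p k)) at_top sequentially" "(\<lambda>k. grad2 f (p k)) \<longlonglongrightarrow> 0"
      "(\<lambda>k. eval2 f (fst (p k)) (snd (p k))) \<longlonglongrightarrow> \<tau>"
    using crit by (auto simp: critical_value_at_infinity_def)
  define x where "x k = fst (p k) - a * snd (p k)" for k
  define y where "y k = snd (p k)" for k
  have px: "fst (p k) = x k + a * y k" for k by (simp add: x_def y_def)
  have lim: "(\<lambda>k. eval2 g (x k) (y k)) \<longlonglongrightarrow> \<tau>"
    using p(3) by (simp add: f_g[symmetric] px[symmetric]) (simp add: y_def)
  have "(\<lambda>k. a * fst (grad2 f (p k)) + snd (grad2 f (p k))) \<longlonglongrightarrow> a * fst (0 :: complex \<times> complex) + snd (0 :: complex \<times> complex)"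
    by (intro tendsto_intros p)
  moreover have "a * fst (grad2 f (p k)) + snd (grad2 f (p k)) = eval2 (pderiv g) (x k) (y k)" for k
    unfolding eval2_pderiv_shear[OF f_g] px[symmetric] by (simp add: grad2_def case_prod_unfold y_def)
  ultimately have lim': "(\<lambda>k. eval2 (pderiv g) (x k) (y k)) \<longlonglongrightarrow> 0" by simp
  have c0: "c \<noteq> 0" using g by (simp add: degree_bounded_def)
  obtain K where K: "K \<ge> 1" "\<And>x y. norm y \<ge> K * (1 + norm x) \<Longrightarrow> norm (eval2 g x y) \<ge> norm c / 2 * norm y ^ d"
    using eval2_lower_bound[OF g] by blast
  \<comment> \<open>Where |y| < K (1 + |x|), one has |p| \<le> |x| + (1 + |a|) |y| \<le> M (1 +
    |x|).\<close>
  define M where "M = 1 + (1 + norm a) * K"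
  have M: "M \<ge> 1" using K(1) by (simp add: M_def)
  have norm_p: "norm (p k) \<le> norm (x k) + (1 + norm a) * norm (y k)" for k
  proof -
    have "norm (p k) \<le> norm (fst (p k)) + norm (snd (p k))"
      by (metis norm_Pair_le prod.collapse)
    also have "norm (fst (p k)) \<le> norm (x k) + norm a * norm (y k)"
      unfolding px by (metis norm_mult norm_triangle_ineq)
    finally show ?thesis by (simp add: y_def algebra_simps)
  qed
  \<comment> \<open>Bounds |p| where y dominates: there |c| / 2 |y| \<le> |g| < |\<tau>| + 1, and
    |x| \<le> |y| gives |p| \<le> (2 + |a|) |y|.\<close>
  define C where "C = (2 + norm a) * (2 * (norm \<tau> + 1) / norm c)"
  have e1: "\<forall>\<^sub>F k in sequentially. norm (eval2 g (x k) (y k)) < norm \<tau> + 1"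
    by (rule order_tendstoD[OF tendsto_norm[OF lim]]) simp
  have xlim: "filterlim (\<lambda>k. norm (x k)) at_top sequentially"
    unfolding filterlim_at_top
  proof
    fix R :: real
    have "\<forall>\<^sub>F k in sequentially. norm (p k) > max C (M * (R + 1))"
      using p(1) unfolding filterlim_at_top_dense by blast
    then show "\<forall>\<^sub>F k in sequentially. R \<le> norm (x k)" using e1
    proof eventually_elim
      case (elim k)
      have "norm (y k) < K * (1 + norm (x k))"
      proof (rule ccontr)
        assume "\<not> norm (y k) < K * (1 + norm (x k))"
        then have big: "norm (y k) \<ge> K * (1 + norm (x k))" by simp
        have x_le: "1 + norm (x k) \<le> norm (y k)"
          using big K(1) mult_right_mono[of 1 K "1 + norm (x k)"] by simp
        then have y1: "norm (y k) \<ge> 1" using norm_ge_zero[of "x k"] by linarith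
        have "norm (y k) ^ 1 \<le> norm (y k) ^ d" using y1 d by (intro power_increasing) auto
        then have "norm c / 2 * norm (y k) \<le> norm c / 2 * norm (y k) ^ d" by (intro mult_left_mono) auto
        also have "\<dots> \<le> norm \<tau> + 1" using K(2)[OF big] elim(2) by linarith
        finally have "norm (y k) \<le> 2 * (norm \<tau> + 1) / norm c" using c0 by (simp add: field_simps)
        then have "(2 + norm a) * norm (y k) \<le> C" unfolding C_def by (intro mult_left_mono) auto
        moreover have "norm (p k) \<le> (2 + norm a) * norm (y k)"
          using norm_p[of k] x_le by (simp add: algebra_simps)
        ultimately show False using elim(1) by simp
      qed
      then have "(1 + norm a) * norm (y k) \<le> (1 + norm a) * (K * (1 + norm (x k)))"
        by (intro mult_left_mono) auto
      then have "norm (p k) \<le> M * (1 + norm (x k))"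
        using norm_p[of k] by (simp add: M_def algebra_simps)
      then have "M * (R + 1) < M * (1 + norm (x k))" using elim(1) by simp
      then show ?case using M by simp
    qed
  qed
  show ?thesis using xlim lim lim' by blast
qed

theorem theorem2p1:
  fixes f :: "complex poly poly" and n :: nat
  assumes nonconstant: "\<not> (\<exists>c. f = [:[:c:]:])"
    and branches: "finite (branches_at_infinity f)" "card (branches_at_infinity f) = n"
  shows "finite {\<tau>. critical_value_at_infinity f \<tau> \<and> \<tau> \<noteq> 0} \<and>
         card {\<tau>. critical_value_at_infinity f \<tau> \<and> \<tau> \<noteq> 0} \<le> n"
proof -
  define d where "d = total_degree2 f"
  obtain a c g where d: "d > 0" and g: "degree_bounded g d c"
    and f_g: "\<And>x y. eval2 f (x + a * y) y = eval2 g x y"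
    using shear_exists[OF nonconstant] unfolding d_def by blast
  obtain W :: "complex set" and \<psi> e \<sigma> N \<zeta> \<rho> where rs: "root_system W \<psi> e \<sigma> N (N * d) \<zeta> \<rho>"
    and pp: "\<And>u. u ^ N = 1 \<Longrightarrow> \<exists>k. u = \<zeta> ^ k"
      "\<And>l. l \<in> W \<Longrightarrow> \<psi> l holomorphic_on ball 0 \<rho>" "(\<Sum>l\<in>W. e l) = d"
      "\<And>t y. t \<in> ball 0 \<rho> - {0} \<Longrightarrow> eval2 g (1 / t ^ N) y = c * (\<Prod>l\<in>W. (y - \<psi> l t / t ^ N) ^ e l)"
      "\<And>t v. t \<in> ball 0 \<rho> - {0} \<Longrightarrow> eval2 (pderiv g) (1 / t ^ N) v = 0 \<Longrightarrow> \<exists>l\<in>W. v = \<psi> l t / t ^ N"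
    by (rule puiseux_root_system[OF g d]) (rule that)
  interpret root_system W \<psi> e \<sigma> N "N * d" \<zeta> c \<rho> by (rule rs)
  interpret curve_at_infinity W \<psi> e \<sigma> N \<zeta> c \<rho> g d f a
    by unfold_locales (fact g d pp f_g d_def[symmetric])+
  have sub: "{\<tau>. critical_value_at_infinity f \<tau> \<and> \<tau> \<noteq> 0} \<subseteq> {\<tau>. \<exists>j. good j \<tau>}"
    using sheared_sequence[OF g d f_g] critical_sequence_good by blast
  have "card {\<tau>. critical_value_at_infinity f \<tau> \<and> \<tau> \<noteq> 0} \<le> card {\<tau>. \<exists>j. good j \<tau>}"
    using card_good_values sub by (intro card_mono) auto
  also have "\<dots> \<le> card (orb ` I)" using card_good_values by blast
  also have "\<dots> \<le> n" using card_orbits_le_branches[OF branches(1)] branches(2) by simp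
  finally show ?thesis using card_good_values sub finite_subset by blast
qed

end
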